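(* Let $p\ge 3$ be a prime. Let $W_{\mathrm{tors}}\subset \mathbb{Z}_p^5$ be the set of tuples $[a_1,a_2,a_3,a_4,a_6]\in\mathbb{Z}_p^5$ such that the equation $y^2+a_1xy+a_3y=x^3+a_2x^2+a_4x+a_6$ defines an elliptic curve $E$ over $\mathbb{Q}_p$ which has a non-trivial $3$-torsion point in $E(\mathbb{Q}_p)$. Then \[ \mu_{\mathbb{Z}_p^5}(W_{\mathrm{tors}})=\begin{cases} \dfrac{p^2(3p^6+4p^2-4p+4)}{8(p^8+p^6+p^4+p^2+1)} & \text{if } p\equiv 1 \pmod 3,\\[2mm] \dfrac{p^2}{2(p^2+p+1)} & \text{if } p\equiv 2\pmod 3,\\[2mm] \dfrac{3}{26} & \text{if } p=3. \end{cases} \]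
   Context: $\mu_{\mathbb{Z}_p^5}$ denotes the Haar measure on $\mathbb{Z}_p^5$ normalized so that $\mu_{\mathbb{Z}_p^5}(\mathbb{Z}_p^5)=1$. *)

theory Defs
  imports
    "HOL-Probability.Probability"
    "HOL-Computational_Algebra.Computational_Algebra"
    "HOL-Algebra.Algebraic_Closure_Type"
    "Berlekamp_Zassenhaus.Finite_Field"
begin

section \<open>The \<open>p\<close>-adic integers\<close>

text \<open>
  The prime \<open>p\<close> is the cardinality of a type \<open>'p\<close> of class \<^class>\<open>prime_card\<close>.
  The ring of \<open>p\<close>-adic integers is the inverse limit of the rings of integers modulo \<open>p^n\<close>:
  an element is a sequence of residues \<open>f n\<close> in \<open>{0..<p^n}\<close>, each
  the reduction of the next one (the range condition follows from the equation).
\<close>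

typedef (overloaded) 'p padic_int =
  "{f :: nat \<Rightarrow> int. \<forall>n. f n = f (Suc n) mod int CARD('p::prime_card) ^ n}"
  morphisms padic_residue Abs_padic_int
  by (intro exI[of _ "\<lambda>_. 0"]) simp

setup_lifting type_definition_padic_int

lemma mod_pow_Suc_mod: "(a::int) mod q ^ Suc n mod q ^ n = a mod q ^ n"
  by (intro mod_mod_cancel) simp

lemma padic_compat_closed:
  fixes f g :: "nat \<Rightarrow> int"
  assumes f: "\<forall>n. f n = f (Suc n) mod q ^ n" and g: "\<forall>n. g n = g (Suc n) mod q ^ n"
  shows "(f n + g n) mod q ^ n = (f (Suc n) + g (Suc n)) mod q ^ Suc n mod q ^ n"
    "(f n - g n) mod q ^ n = (f (Suc n) - g (Suc n)) mod q ^ Suc n mod q ^ n"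
    "(f n * g n) mod q ^ n = (f (Suc n) * g (Suc n)) mod q ^ Suc n mod q ^ n"
    "(- f n) mod q ^ n = (- f (Suc n)) mod q ^ Suc n mod q ^ n"
  unfolding mod_pow_Suc_mod f[THEN spec, of n] g[THEN spec, of n]
  by (simp_all only: mod_simps)

lemma padic_residue_compat:
  fixes x :: "'p::prime_card padic_int"
  shows "padic_residue x (Suc n) mod int CARD('p) ^ n = padic_residue x n"
    "padic_residue x n mod int CARD('p) ^ n = padic_residue x n"
proof -
  have *: "padic_residue x n = padic_residue x (Suc n) mod int CARD('p) ^ n"
    using padic_residue[of x] by blast
  show "padic_residue x (Suc n) mod int CARD('p) ^ n = padic_residue x n"
    by (rule *[symmetric])
  show "padic_residue x n mod int CARD('p) ^ n = padic_residue x n"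
    by (subst (1 2) *) (rule mod_mod_trivial)
qed

lemma padic_int_eqI: "(\<And>n. padic_residue x n = padic_residue y n) \<Longrightarrow> x = y"
  by (metis padic_residue_inject ext)

instantiation padic_int :: (prime_card) comm_ring_1
begin

lift_definition zero_padic_int :: "'a padic_int" is "\<lambda>n. 0"
  by simp

lift_definition one_padic_int :: "'a padic_int" is "\<lambda>n. 1 mod int CARD('a) ^ n"
  by (simp only: mod_pow_Suc_mod simp_thms)

lift_definition plus_padic_int :: "'a padic_int \<Rightarrow> 'a padic_int \<Rightarrow> 'a padic_int"
  is "\<lambda>f g n. (f n + g n) mod int CARD('a) ^ n"
  by (intro allI padic_compat_closed)

lift_definition uminus_padic_int :: "'a padic_int \<Rightarrow> 'a padic_int"
  is "\<lambda>f n. (- f n) mod int CARD('a) ^ n"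
  by (intro allI padic_compat_closed)

lift_definition minus_padic_int :: "'a padic_int \<Rightarrow> 'a padic_int \<Rightarrow> 'a padic_int"
  is "\<lambda>f g n. (f n - g n) mod int CARD('a) ^ n"
  by (intro allI padic_compat_closed)

lift_definition times_padic_int :: "'a padic_int \<Rightarrow> 'a padic_int \<Rightarrow> 'a padic_int"
  is "\<lambda>f g n. (f n * g n) mod int CARD('a) ^ n"
  by (intro allI padic_compat_closed)

lemmas padic_residue_ops =
  zero_padic_int.rep_eq one_padic_int.rep_eq plus_padic_int.rep_eq uminus_padic_int.rep_eq
  minus_padic_int.rep_eq times_padic_int.rep_eq

instance
proof
  fix a b c :: "'a padic_int"
  show "a * b * c = a * (b * c)"
    by (rule padic_int_eqI) (simp add: padic_residue_ops mod_simps mult.assoc)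
  show "a * b = b * a"
    by (rule padic_int_eqI) (simp add: padic_residue_ops mult.commute)
  show "1 * a = a"
    by (rule padic_int_eqI) (simp add: padic_residue_ops mod_simps padic_residue_compat)
  show "a + b + c = a + (b + c)"
    by (rule padic_int_eqI) (simp add: padic_residue_ops mod_simps add.assoc)
  show "a + b = b + a"
    by (rule padic_int_eqI) (simp add: padic_residue_ops add.commute)
  show "0 + a = a"
    by (rule padic_int_eqI) (simp add: padic_residue_ops padic_residue_compat)
  show "- a + a = 0"
    by (rule padic_int_eqI) (simp add: padic_residue_ops mod_simps)
  show "a - b = a + - b"
    by (rule padic_int_eqI) (simp add: padic_residue_ops mod_simps)
  show "(a + b) * c = a * c + b * c"
    by (rule padic_int_eqI) (simp add: padic_residue_ops mod_simps distrib_right)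
  have "1 mod int CARD('a) ^ 1 = 1"
    using prime_gt_1_nat[OF prime_card[where 'a = 'a]] by simp
  hence "padic_residue (0 :: 'a padic_int) 1 \<noteq> padic_residue 1 1"
    by (simp only: padic_residue_ops)
  thus "(0 :: 'a padic_int) \<noteq> 1"
    by metis
qed

end

lemma padic_residue_mod:
  fixes x :: "'p::prime_card padic_int"
  assumes "m \<le> n"
  shows "padic_residue x n mod int CARD('p) ^ m = padic_residue x m"
  using assms
proof (induction n rule: dec_induct)
  case base
  show ?case by (rule padic_residue_compat)
next
  case (step n)
  have "padic_residue x (Suc n) mod int CARD('p) ^ n = padic_residue x n"
    by (rule padic_residue_compat)
  thus ?case
    using step by (metis le_imp_power_dvd mod_mod_cancel)
qed

lemma padic_residue_range:
  fixes x :: "'p::prime_card padic_int"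
  shows "0 \<le> padic_residue x n" "padic_residue x n < int CARD('p) ^ n"
proof -
  have "int CARD('p) ^ n > 0"
    using prime_gt_0_nat[OF prime_card[where 'a = 'p]] by simp
  thus "0 \<le> padic_residue x n" "padic_residue x n < int CARD('p) ^ n"
    using pos_mod_sign[of "int CARD('p) ^ n" "padic_residue x n"]
      pos_mod_bound[of "int CARD('p) ^ n" "padic_residue x n"]
    by (simp_all only: padic_residue_compat)
qed

instance padic_int :: (prime_card) idom
proof
  fix x y :: "'a padic_int"
  assume "x \<noteq> 0" "y \<noteq> 0"
  let ?p = "int CARD('a)"
  have nz: "\<exists>m. \<forall>n\<ge>m. \<not> ?p ^ m dvd padic_residue z n" if "z \<noteq> 0" for z :: "'a padic_int"
  proof -
    from that obtain m where "padic_residue z m \<noteq> 0"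
      by (metis padic_int_eqI zero_padic_int.rep_eq)
    thus ?thesis
      by (intro exI[of _ m]) (auto simp: dvd_eq_mod_eq_0 padic_residue_mod)
  qed
  obtain m n where m: "\<forall>k\<ge>m. \<not> ?p ^ m dvd padic_residue x k"
    and n: "\<forall>k\<ge>n. \<not> ?p ^ n dvd padic_residue y k"
    using nz \<open>x \<noteq> 0\<close> \<open>y \<noteq> 0\<close> by metis
  let ?a = "padic_residue x (m + n)" and ?b = "padic_residue y (m + n)"
  have pr: "Factorial_Ring.prime ?p"
    by (rule prime_card_int)
  have ab: "\<not> ?p ^ m dvd ?a" "\<not> ?p ^ n dvd ?b"
    using m n by auto
  hence nz': "?a \<noteq> 0" "?b \<noteq> 0"
    by auto
  have "multiplicity ?p ?a < m" "multiplicity ?p ?b < n"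
    using ab multiplicity_dvd' by (meson not_le)+
  hence "multiplicity ?p (?a * ?b) < m + n"
    using pr nz' by (subst prime_elem_multiplicity_mult_distrib) auto
  hence "\<not> ?p ^ (m + n) dvd ?a * ?b"
    using pr nz' by (subst power_dvd_iff_le_multiplicity) (auto dest: not_prime_unit)
  hence "padic_residue (x * y) (m + n) \<noteq> padic_residue 0 (m + n)"
    by (simp add: times_padic_int.rep_eq zero_padic_int.rep_eq dvd_eq_mod_eq_0)
  thus "x * y \<noteq> 0"
    by metis
qed

text \<open>
  The \<open>p\<close>-adic topology: the cosets of the ideals generated by \<open>p^n\<close> form a basis.
\<close>

instantiation padic_int :: (prime_card) topological_space
begin

definition open_padic_int :: "'a padic_int set \<Rightarrow> bool" where
  "open S \<longleftrightarrow> (\<forall>x\<in>S. \<exists>n. \<forall>y. padic_residue y n = padic_residue x n \<longrightarrow> y \<in> S)"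

instance
proof
  show "open (UNIV :: 'a padic_int set)"
    by (simp add: open_padic_int_def)
next
  fix S T :: "'a padic_int set"
  assume ST: "open S" "open T"
  show "open (S \<inter> T)"
    unfolding open_padic_int_def
  proof
    fix x assume "x \<in> S \<inter> T"
    then obtain m n where
      "\<forall>y. padic_residue y m = padic_residue x m \<longrightarrow> y \<in> S"
      "\<forall>y. padic_residue y n = padic_residue x n \<longrightarrow> y \<in> T"
      using ST unfolding open_padic_int_def by blast
    thus "\<exists>n. \<forall>y. padic_residue y n = padic_residue x n \<longrightarrow> y \<in> S \<inter> T"
      by (intro exI[of _ "max m n"])
         (metis IntI max.cobounded1 max.cobounded2 padic_residue_mod)
  qed
next
  fix K :: "'a padic_int set set"
  assume "\<forall>S\<in>K. open S"
  thus "open (\<Union>K)"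
    unfolding open_padic_int_def by (meson Union_iff)
qed

end

lemma open_padic_coset: "open {x :: 'p::prime_card padic_int. padic_residue x n = a}"
  by (auto simp: open_padic_int_def)

instance padic_int :: (prime_card) t2_space
proof
  fix x y :: "'a padic_int"
  assume "x \<noteq> y"
  then obtain n where "padic_residue x n \<noteq> padic_residue y n"
    by (metis padic_int_eqI)
  thus "\<exists>U V. open U \<and> open V \<and> x \<in> U \<and> y \<in> V \<and> U \<inter> V = {}"
    by (intro exI[of _ "{z. padic_residue z n = padic_residue x n}"]
          exI[of _ "{z. padic_residue z n = padic_residue y n}"])
       (auto simp: open_padic_coset)
qed

lemma open_padic_eq_Union:
  fixes S :: "'p::prime_card padic_int set"
  assumes "open S"
  shows "S = \<Union>{C \<in> range (\<lambda>(n, a). {x. padic_residue x n = a}). C \<subseteq> S}"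
    (is "S = \<Union>?B")
proof
  show "S \<subseteq> \<Union>?B"
  proof
    fix x assume "x \<in> S"
    then obtain n where "\<forall>y. padic_residue y n = padic_residue x n \<longrightarrow> y \<in> S"
      using assms unfolding open_padic_int_def by blast
    hence "{y. padic_residue y n = padic_residue x n} \<in> ?B"
      by (auto intro!: image_eqI[of _ _ "(n, padic_residue x n)"])
    thus "x \<in> \<Union>?B"
      by (rule UnionI) simp
  qed
qed auto

instance padic_int :: (prime_card) second_countable_topology
proof
  let ?B = "range (\<lambda>(n, a). {x :: 'a padic_int. padic_residue x n = a})"
  have "topological_basis ?B"
    unfolding topological_basis_def
  proof (intro conjI ballI allI impI)
    fix S :: "'a padic_int set"
    assume "open S"
    thus "\<exists>B'\<subseteq>?B. \<Union>B' = S"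
      using open_padic_eq_Union[of S]
      by (intro exI[of _ "{C \<in> ?B. C \<subseteq> S}"]) auto
  qed (auto simp: open_padic_coset)
  moreover have "countable ?B"
    by simp
  ultimately show "\<exists>B :: 'a padic_int set set. countable B \<and> open = generate_topology B"
    using topological_basis_imp_subbasis by blast
qed

lemma eventually_padic_residue_eq:
  "eventually (\<lambda>y. padic_residue y n = padic_residue x n) (nhds x)"
  by (rule eventually_nhds_in_open[OF open_padic_coset, of x n "padic_residue x n", simplified])

lemma tendsto_padic_intI:
  fixes f :: "'b \<Rightarrow> 'p::prime_card padic_int"
  assumes "\<And>n. eventually (\<lambda>z. padic_residue (f z) n = padic_residue x n) F"
  shows "(f \<longlongrightarrow> x) F"
proof (rule topological_tendstoI)
  fix S assume "open S" "x \<in> S"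
  then obtain n where "\<forall>y. padic_residue y n = padic_residue x n \<longrightarrow> y \<in> S"
    unfolding open_padic_int_def by blast
  thus "eventually (\<lambda>z. f z \<in> S) F"
    using assms[of n] by (auto elim: eventually_mono)
qed

instance padic_int :: (prime_card) topological_ab_group_add
proof
  fix a b :: "'a padic_int"
  show "((\<lambda>z. fst z + snd z) \<longlongrightarrow> a + b) (nhds a \<times>\<^sub>F nhds b)"
  proof (rule tendsto_padic_intI)
    fix n
    show "eventually (\<lambda>z. padic_residue (fst z + snd z) n = padic_residue (a + b) n)
            (nhds a \<times>\<^sub>F nhds b)"
      using eventually_prodI[OF eventually_padic_residue_eq[of n a] eventually_padic_residue_eq[of n b]]
      by (rule eventually_mono) (simp add: plus_padic_int.rep_eq)
  qed
  show "(uminus \<longlongrightarrow> - a) (nhds a)"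
  proof (rule tendsto_padic_intI)
    fix n
    show "eventually (\<lambda>z. padic_residue (- z) n = padic_residue (- a) n) (nhds a)"
      by (rule eventually_mono[OF eventually_padic_residue_eq[of n a]])
         (simp add: uminus_padic_int.rep_eq)
  qed
qed

instance prod :: (topological_monoid_add, topological_monoid_add) topological_monoid_add
proof
  fix a b :: "'a \<times> 'b"
  have "((\<lambda>z. (fst (fst z) + fst (snd z), snd (fst z) + snd (snd z))) \<longlongrightarrow>
          (fst a + fst b, snd a + snd b)) (nhds a \<times>\<^sub>F nhds b)"
    by (intro tendsto_intros filterlim_fst filterlim_snd)
  thus "((\<lambda>z. fst z + snd z) \<longlongrightarrow> a + b) (nhds a \<times>\<^sub>F nhds b)"
    by (simp add: plus_prod_def)
qed

instance prod :: (topological_group_add, topological_group_add) topological_group_add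
proof
  fix a :: "'a \<times> 'b"
  have "((\<lambda>z. (- fst z, - snd z)) \<longlongrightarrow> (- fst a, - snd a)) (nhds a)"
    by (intro tendsto_intros filterlim_ident)
  thus "(uminus \<longlongrightarrow> - a) (nhds a)"
    by (simp add: uminus_prod_def[abs_def])
qed

instance prod :: (topological_ab_group_add, topological_ab_group_add) topological_ab_group_add ..


section \<open>Haar measure\<close>

text \<open>
  On a compact second countable abelian group, such as \<open>\<int>\<^sub>p\<^sup>5\<close>, every finite Borel measure is
  regular, so the normalized Haar measure is the translation invariant probability measure on
  the Borel sets.
\<close>

definition is_normalized_haar :: "'a::topological_ab_group_add measure \<Rightarrow> bool" where
  "is_normalized_haar M \<longleftrightarrow>
     sets M = sets borel \<and> emeasure M UNIV = 1 \<and>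
     (\<forall>a. \<forall>A\<in>sets borel. emeasure M ((+) a ` A) = emeasure M A)"

definition haar_measure :: "'a::topological_ab_group_add measure" where
  "haar_measure = (THE M. is_normalized_haar M)"

lemma measurable_translate [measurable]:
  "(+) (a :: 'a::topological_ab_group_add) \<in> borel_measurable borel"
  by (intro borel_measurable_continuous_onI continuous_intros)

lemma translate_eq_vimage: "(+) (a :: 'a::ab_group_add) ` A = (+) (- a) -` A"
proof -
  have "x \<in> (+) a ` A" if "- a + x \<in> A" for x
    using that by (intro image_eqI[of x "(+) a" "- a + x"]) simp_all
  thus ?thesis
    by auto
qed

lemma is_normalized_haar_iff_distr:
  "is_normalized_haar (M :: 'a::topological_ab_group_add measure) \<longleftrightarrow>
     sets M = sets borel \<and> emeasure M UNIV = 1 \<and> (\<forall>a. distr M borel ((+) a) = M)"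
proof -
  have "(\<forall>a. \<forall>A\<in>sets borel. emeasure M ((+) a ` A) = emeasure M A) \<longleftrightarrow>
          (\<forall>a. distr M borel ((+) a) = M)" if M: "sets M = sets borel"
  proof -
    have sp: "space M = UNIV"
      using sets_eq_imp_space_eq[OF M] by simp
    have meas: "(+) a \<in> measurable M borel" for a
      using measurable_translate measurable_cong_sets[OF M refl] by blast
    have em: "emeasure (distr M borel ((+) a)) A = emeasure M ((+) (- a) ` A)"
      if "A \<in> sets borel" for a A
      using that by (simp only: emeasure_distr[OF meas] sp translate_eq_vimage minus_minus Int_UNIV_right)
    show ?thesis
    proof
      assume inv: "\<forall>a. \<forall>A\<in>sets borel. emeasure M ((+) a ` A) = emeasure M A"
      show "\<forall>a. distr M borel ((+) a) = M"
        using inv by (intro allI measure_eqI) (simp_all only: sets_distr M em)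
    next
      assume inv: "\<forall>a. distr M borel ((+) a) = M"
      show "\<forall>a. \<forall>A\<in>sets borel. emeasure M ((+) a ` A) = emeasure M A"
        using inv em[of _ "- a" for a] by (metis minus_minus)
    qed
  qed
  thus ?thesis
    unfolding is_normalized_haar_def by blast
qed

lemma is_normalized_haar_unique:
  fixes M N :: "'a::{second_countable_topology, topological_ab_group_add} measure"
  assumes "is_normalized_haar M" "is_normalized_haar N"
  shows "M = N"
proof (rule measure_eqI)
  have sets: "sets M = sets borel" "sets N = sets borel"
    and one: "emeasure M UNIV = 1" "emeasure N UNIV = 1"
    using assms by (auto simp: is_normalized_haar_def)
  show "sets M = sets N"
    by (simp add: sets)
  have sp: "space M = UNIV" "space N = UNIV"
    using sets by (simp_all add: sets_eq_imp_space_eq)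
  interpret M: prob_space M
    by standard (simp add: sp one)
  interpret N: prob_space N
    by standard (simp add: sp one)
  interpret MN: pair_sigma_finite M N ..
  fix A assume "A \<in> sets M"
  hence A: "A \<in> sets borel"
    by (simp add: sets)
  have add: "(\<lambda>z. fst z + snd z :: 'a) \<in> borel_measurable (borel \<Otimes>\<^sub>M borel)"
    unfolding borel_prod by (intro borel_measurable_continuous_onI continuous_intros)
  have ind: "(\<lambda>z. indicator A (fst z + snd z) :: ennreal) \<in> borel_measurable (M \<Otimes>\<^sub>M N)"
    using measurable_compose[OF add borel_measurable_indicator[OF A]]
    by (subst measurable_cong_sets[OF sets_pair_measure_cong refl])
       (simp_all add: sets)
  have inner: "(\<integral>\<^sup>+y. indicator A (x + y) \<partial>K) = emeasure K A"
    if K: "is_normalized_haar K" for K :: "'a measure" and x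
  proof -
    have sK: "sets K = sets borel" and dK: "distr K borel ((+) x) = K"
      using K by (auto simp: is_normalized_haar_iff_distr)
    have "emeasure K A = (\<integral>\<^sup>+y. indicator A y \<partial>distr K borel ((+) x))"
      using A by (simp add: dK sK)
    also have "\<dots> = (\<integral>\<^sup>+y. indicator A (x + y) \<partial>K)"
      using A by (subst nn_integral_distr) (auto simp: measurable_cong_sets[OF sK refl])
    finally show ?thesis ..
  qed
  have "emeasure N A = (\<integral>\<^sup>+x. \<integral>\<^sup>+y. indicator A (x + y) \<partial>N \<partial>M)"
    by (simp add: inner[OF assms(2)] sp one)
  also have "\<dots> = (\<integral>\<^sup>+y. \<integral>\<^sup>+x. indicator A (x + y) \<partial>M \<partial>N)"
    using MN.Fubini'[of "\<lambda>x y. indicator A (x + y)"] ind by (simp add: case_prod_beta')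
  also have "\<dots> = emeasure M A"
    by (subst add.commute) (simp add: inner[OF assms(1)] sp one)
  finally show "emeasure M A = emeasure N A" ..
qed

lemma is_normalized_haar_pair:
  fixes M :: "'a::{second_countable_topology, topological_ab_group_add} measure"
    and N :: "'b::{second_countable_topology, topological_ab_group_add} measure"
  assumes "is_normalized_haar M" "is_normalized_haar N"
  shows "is_normalized_haar (M \<Otimes>\<^sub>M N)"
  unfolding is_normalized_haar_iff_distr
proof (intro conjI allI)
  have M: "sets M = sets borel" "emeasure M UNIV = 1" "\<And>a. distr M borel ((+) a) = M"
    and N: "sets N = sets borel" "emeasure N UNIV = 1" "\<And>a. distr N borel ((+) a) = N"
    using assms by (auto simp: is_normalized_haar_iff_distr)
  have sp: "space M = UNIV" "space N = UNIV"
    using M(1) N(1) by (simp_all add: sets_eq_imp_space_eq)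
  interpret M: prob_space M
    by standard (simp add: sp M)
  interpret N: prob_space N
    by standard (simp add: sp N)
  have s: "sets (M \<Otimes>\<^sub>M N) = sets (borel \<Otimes>\<^sub>M borel)"
    by (intro sets_pair_measure_cong M N)
  show "sets (M \<Otimes>\<^sub>M N) = sets borel"
    unfolding s borel_prod ..
  show "emeasure (M \<Otimes>\<^sub>M N) UNIV = 1"
    using N.emeasure_pair_measure_Times[of UNIV M UNIV] sets.top[of M] sets.top[of N]
    by (simp add: sp M N)
  fix c :: "'a \<times> 'b"
  have "distr (M \<Otimes>\<^sub>M N) borel ((+) c) =
          distr (M \<Otimes>\<^sub>M N) (borel \<Otimes>\<^sub>M borel) (\<lambda>(x, y). (fst c + x, snd c + y))"
    unfolding borel_prod by (intro distr_cong) (auto simp: plus_prod_def)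
  also have "\<dots> = distr M borel ((+) (fst c)) \<Otimes>\<^sub>M distr N borel ((+) (snd c))"
    by (rule pair_measure_distr[symmetric])
       (simp_all add: measurable_cong_sets[OF M(1) refl] measurable_cong_sets[OF N(1) refl]
          M N N.sigma_finite_measure_axioms)
  also have "\<dots> = M \<Otimes>\<^sub>M N"
    by (simp add: M N)
  finally show "distr (M \<Otimes>\<^sub>M N) borel ((+) c) = M \<Otimes>\<^sub>M N" .
qed


text \<open>
  On the \<open>p\<close>-adic integers, a Haar measure is the law of \<open>\<Sum>i. d i * p^i\<close> with independent
  digits \<open>d i\<close>, uniformly distributed in \<open>{0..<p}\<close>.
\<close>

lemma padic_measure_eqI:
  fixes M N :: "'p::prime_card padic_int measure"
  assumes M: "sets M = sets borel" and N: "sets N = sets borel"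
    and eq: "\<And>n a. emeasure M {x. padic_residue x n = a} = emeasure N {x. padic_residue x n = a}"
    and fin: "emeasure M UNIV \<noteq> \<infinity>"
  shows "M = N"
proof (rule measure_eqI_generator_eq)
  let ?B = "range (\<lambda>(n, a). {x :: 'p padic_int. padic_residue x n = a})"
  show "Int_stable ?B"
  proof (rule Int_stableI, clarify)
    fix m n a b
    have *: "{x :: 'p padic_int. padic_residue x m = a} \<inter> {x. padic_residue x n = b} \<in> ?B"
      if "m \<le> n" for m n a b
    proof (cases "b mod int CARD('p) ^ m = a")
      case True
      hence "{x :: 'p padic_int. padic_residue x m = a} \<inter> {x. padic_residue x n = b} =
               {x. padic_residue x n = b}"
        using padic_residue_mod[OF that, where 'p = 'p] by auto
      thus ?thesis
        by (auto intro: image_eqI[of _ _ "(n, b)"])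
    next
      case False
      hence "{x :: 'p padic_int. padic_residue x m = a} \<inter> {x. padic_residue x n = b} = {}"
        using padic_residue_mod[OF that, where 'p = 'p] by auto
      moreover have "padic_residue x 0 \<noteq> - 1" for x :: "'p padic_int"
        using padic_residue_range(1)[of x 0] by linarith
      hence "{} = {x :: 'p padic_int. padic_residue x 0 = - 1}"
        by simp
      ultimately show ?thesis
        by (auto intro: image_eqI[of _ _ "(0, - 1)"])
    qed
    show "{x :: 'p padic_int. padic_residue x m = a} \<inter> {x. padic_residue x n = b} \<in> ?B"
      using *[of m n a b] *[of n m b a] by (cases "m \<le> n") (auto simp: Int_commute)
  qed
  have "sets (borel :: 'p padic_int measure) = sigma_sets UNIV ?B"
  proof
    show "sets borel \<subseteq> sigma_sets UNIV ?B"
    proof (subst borel_def, subst sets_measure_of, simp, rule sigma_sets_mono, rule subsetI)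
      fix S :: "'p padic_int set"
      assume "S \<in> Collect open"
      hence "S = \<Union>{C \<in> ?B. C \<subseteq> S}"
        using open_padic_eq_Union by blast
      moreover have "\<Union>{C \<in> ?B. C \<subseteq> S} \<in> sigma_sets UNIV ?B"
        by (rule sigma_sets_UNION) (auto intro: countable_subset[of _ ?B] sigma_sets.Basic)
      ultimately show "S \<in> sigma_sets UNIV ?B"
        by simp
    qed
    show "sigma_sets UNIV ?B \<subseteq> sets borel"
      by (intro sets.sigma_sets_subset') (auto intro!: borel_open open_padic_coset)
  qed
  thus "sets M = sigma_sets UNIV ?B" "sets N = sigma_sets UNIV ?B"
    using M N by simp_all
  show "range (\<lambda>_::nat. {x :: 'p padic_int. padic_residue x 0 = 0}) \<subseteq> ?B"
    by (auto intro: image_eqI[of _ _ "(0, 0)"])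
  have "padic_residue x 0 = 0" for x :: "'p padic_int"
    using padic_residue_range[of x 0] by simp
  thus "(\<Union>i::nat. {x :: 'p padic_int. padic_residue x 0 = 0}) = UNIV"
    "\<And>i. emeasure M {x. padic_residue x 0 = 0} \<noteq> \<infinity>"
    using fin by simp_all
qed (use eq in auto)

lemma is_normalized_haar_padicI:
  fixes M :: "'p::prime_card padic_int measure"
  assumes M: "sets M = sets borel"
    and ball: "\<And>n a. 0 \<le> a \<Longrightarrow> a < int CARD('p) ^ n \<Longrightarrow>
                 emeasure M {x. padic_residue x n = a} = ennreal (1 / CARD('p) ^ n)"
  shows "is_normalized_haar M"
  unfolding is_normalized_haar_iff_distr
proof (intro conjI allI)
  have sp: "space M = UNIV"
    using M by (simp add: sets_eq_imp_space_eq)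
  have "padic_residue x 0 = 0" for x :: "'p padic_int"
    using padic_residue_range[of x 0] by simp
  thus one: "emeasure M UNIV = 1"
    using ball[of 0 0] by simp
  fix c
  have meas: "(+) c \<in> measurable M borel"
    using measurable_translate measurable_cong_sets[OF M refl] by blast
  show "distr M borel ((+) c) = M"
  proof (rule padic_measure_eqI)
    fix n a
    let ?q = "int CARD('p) ^ n"
    have q: "?q > 0"
      using prime_gt_0_nat[OF prime_card[where 'a = 'p]] by simp
    have "emeasure (distr M borel ((+) c)) {x. padic_residue x n = a} =
            emeasure M {x. padic_residue (c + x) n = a}"
      by (subst emeasure_distr[OF meas]) (auto simp: open_padic_coset sp vimage_def)
    also have "\<dots> = emeasure M {x. padic_residue x n = a}"
    proof (cases "0 \<le> a \<and> a < ?q")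
      case True
      have "padic_residue (c + x) n = a \<longleftrightarrow> padic_residue x n = (a - padic_residue c n) mod ?q" for x
      proof -
        have "padic_residue (c + x) n = a \<longleftrightarrow>
                (padic_residue c n + padic_residue x n) mod ?q = a mod ?q"
          using True by (simp add: plus_padic_int.rep_eq)
        also have "\<dots> \<longleftrightarrow> padic_residue x n mod ?q = (a - padic_residue c n) mod ?q"
          by (simp add: mod_eq_dvd_iff algebra_simps)
        finally show ?thesis
          by (simp add: padic_residue_compat)
      qed
      thus ?thesis
        using ball True q by simp
    next
      case False
      hence "padic_residue x n \<noteq> a" for x :: "'p padic_int"
        using padic_residue_range[of x n] by auto
      thus ?thesis
        by simp
    qed
    finally show "emeasure (distr M borel ((+) c)) {x. padic_residue x n = a} =
                    emeasure M {x. padic_residue x n = a}" .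
  next
    have "emeasure (distr M borel ((+) c)) UNIV = emeasure M UNIV"
      by (subst emeasure_distr[OF meas]) (auto simp: sp)
    thus "emeasure (distr M borel ((+) c)) UNIV \<noteq> \<infinity>"
      by (simp add: one)
  qed (simp_all add: M)
qed (rule M)

lift_definition padic_of_digits :: "(nat \<Rightarrow> int) \<Rightarrow> 'p::prime_card padic_int"
  is "\<lambda>d n. (\<Sum>i<n. d i * int CARD('p) ^ i) mod int CARD('p) ^ n"
  by (simp only: mod_pow_Suc_mod) (simp add: mod_simps)

lemma digit_sum_eq_iff:
  fixes d :: "nat \<Rightarrow> int"
  assumes "q > 0" "\<And>i. 0 \<le> d i \<and> d i < q" "0 \<le> a" "a < q ^ n"
  shows "(\<Sum>i<n. d i * q ^ i) mod q ^ n = a \<longleftrightarrow> (\<forall>i<n. d i = a div q ^ i mod q)"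
  using assms(3,4)
proof (induction n arbitrary: a)
  case (Suc n)
  have range: "0 \<le> (\<Sum>i<m. d i * q ^ i) \<and> (\<Sum>i<m. d i * q ^ i) < q ^ m" for m
  proof (induction m)
    case (Suc m)
    have "d m * q ^ m \<le> (q - 1) * q ^ m"
      using assms(1) assms(2)[of m] by (intro mult_right_mono) auto
    thus ?case
      using Suc assms(1) assms(2)[of m] by (auto simp: algebra_simps)
  qed simp
  let ?s = "\<Sum>i<n. d i * q ^ i"
  have q: "q ^ n > 0"
    using assms(1) by simp
  have low: "a mod q ^ n div q ^ i mod q = a div q ^ i mod q" if "i < n" for i
  proof -
    from that have n: "q ^ n = q ^ i * q ^ (n - i)"
      by (simp flip: power_add)
    have "a mod q ^ n div q ^ i = a div q ^ i mod q ^ (n - i)"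
      using assms(1) unfolding n by (simp add: zmod_zmult2_eq)
    moreover have "q dvd q ^ (n - i)"
      using that by (simp add: dvd_power)
    ultimately show ?thesis
      by (simp add: mod_mod_cancel)
  qed
  have "a div q ^ n < q"
  proof (rule ccontr)
    assume "\<not> a div q ^ n < q"
    hence "q * q ^ n \<le> a div q ^ n * q ^ n"
      using q by (intro mult_right_mono) auto
    also have "\<dots> \<le> a"
      using q div_mult_mod_eq[of a "q ^ n"] pos_mod_sign[of "q ^ n" a] by linarith
    finally show False
      using Suc.prems by simp
  qed
  hence top: "a div q ^ n mod q = a div q ^ n"
    using Suc.prems q by (simp add: pos_imp_zdiv_nonneg_iff)
  have "(\<Sum>i<Suc n. d i * q ^ i) mod q ^ Suc n = a \<longleftrightarrow> ?s + d n * q ^ n = a"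
    using range[of "Suc n"] by simp
  also have "\<dots> \<longleftrightarrow> ?s = a mod q ^ n \<and> d n = a div q ^ n"
    using range[of n] q assms(1) mod_div_mult_eq[of a "q ^ n"] by (auto simp: div_pos_pos_trivial)
  also have "?s = a mod q ^ n \<longleftrightarrow> ?s mod q ^ n = a mod q ^ n"
    using range[of n] by simp
  also have "\<dots> \<longleftrightarrow> (\<forall>i<n. d i = a div q ^ i mod q)"
    using Suc.IH[of "a mod q ^ n"] q low by simp
  finally show ?case
    by (auto simp: less_Suc_eq top)
qed simp

lemma ex_normalized_haar_padic: "\<exists>M :: 'p::prime_card padic_int measure. is_normalized_haar M"
proof -
  let ?p = "CARD('p)"
  define U where "U = uniform_count_measure {0..<int ?p}"
  define D where "D = (\<Pi>\<^sub>M i\<in>(UNIV::nat set). U)"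
  have p: "?p > 0"
    using prime_gt_0_nat[OF prime_card[where 'a = 'p]] by simp
  interpret U: prob_space U
    unfolding U_def using p by (intro prob_space_uniform_count_measure) auto
  interpret P: product_prob_space "\<lambda>_::nat. U" UNIV ..
  have spU: "space U = {0..<int ?p}"
    by (simp add: U_def space_uniform_count_measure)
  have spD: "space D = UNIV \<rightarrow>\<^sub>E {0..<int ?p}"
    by (simp add: D_def space_PiM spU)
  have cyl: "{d \<in> space D. padic_residue (padic_of_digits d :: 'p padic_int) n = a} \<in> sets D \<and>
      emeasure D {d \<in> space D. padic_residue (padic_of_digits d :: 'p padic_int) n = a} =
        ennreal (1 / ?p ^ n)" if a: "0 \<le> a" "a < int ?p ^ n" for n a
  proof -
    let ?X = "\<lambda>i. {a div int ?p ^ i mod int ?p}"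
    have "{d \<in> space D. padic_residue (padic_of_digits d :: 'p padic_int) n = a} =
            prod_emb UNIV (\<lambda>_. U) {..<n} (Pi\<^sub>E {..<n} ?X)"
    proof (rule Set.set_eqI)
      fix d
      have "d \<in> space D \<and> padic_residue (padic_of_digits d :: 'p padic_int) n = a \<longleftrightarrow>
              d \<in> space D \<and> (\<forall>i<n. d i = a div int ?p ^ i mod int ?p)"
        using digit_sum_eq_iff[of "int ?p" d a n] p a
        by (auto simp: spD padic_of_digits.rep_eq PiE_iff)
      thus "d \<in> {d \<in> space D. padic_residue (padic_of_digits d :: 'p padic_int) n = a} \<longleftrightarrow>
              d \<in> prod_emb UNIV (\<lambda>_. U) {..<n} (Pi\<^sub>E {..<n} ?X)"
        by (auto simp: prod_emb_iff spD spU PiE_iff)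
    qed
    moreover have X: "?X i \<in> sets U" for i
      using p by (auto simp: U_def sets_uniform_count_measure)
    hence "emeasure D (prod_emb UNIV (\<lambda>_. U) {..<n} (Pi\<^sub>E {..<n} ?X)) = (\<Prod>i<n. emeasure U (?X i))"
      unfolding D_def by (intro P.emeasure_PiM_emb) auto
    moreover have "prod_emb UNIV (\<lambda>_. U) {..<n} (Pi\<^sub>E {..<n} ?X) \<in> sets D"
      unfolding D_def using X by (intro sets_PiM_I) auto
    moreover have "emeasure U (?X i) = ennreal (1 / ?p)" for i
      using p X[of i] unfolding U_def
      by (subst emeasure_uniform_count_measure) (auto simp: sets_uniform_count_measure)
    moreover have "(\<Prod>i<n. ennreal (1 / ?p)) = ennreal (1 / ?p ^ n)"
      by (simp add: ennreal_power power_one_over divide_simps)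
    ultimately show ?thesis
      by simp
  qed
  have meas: "(padic_of_digits :: _ \<Rightarrow> 'p padic_int) \<in> measurable D borel"
  proof (rule borel_measurableI)
    fix S :: "'p padic_int set"
    assume "open S"
    let ?B = "{C \<in> range (\<lambda>(n, a). {x :: 'p padic_int. padic_residue x n = a}). C \<subseteq> S}"
    have "padic_of_digits -` C \<inter> space D \<in> sets D" if C: "C \<in> ?B" for C
    proof -
      from C obtain n a where [simp]: "C = {x. padic_residue x n = a}"
        by auto
      have "padic_of_digits -` C \<inter> space D =
              {d \<in> space D. padic_residue (padic_of_digits d :: 'p padic_int) n = a}"
        by auto
      also have "\<dots> \<in> sets D"
      proof (cases "0 \<le> a \<and> a < int ?p ^ n")
        case False
        hence "padic_residue x n \<noteq> a" for x :: "'p padic_int"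
          using padic_residue_range[of x n] by auto
        thus ?thesis
          by simp
      qed (use cyl in blast)
      finally show ?thesis .
    qed
    moreover have "countable ?B"
      by (rule countable_subset[of _ "range (\<lambda>(n, a). {x. padic_residue x n = a})"]) auto
    ultimately have "(\<Union>C\<in>?B. padic_of_digits -` C \<inter> space D) \<in> sets D"
      by (intro sets.countable_UN') auto
    also have "(\<Union>C\<in>?B. padic_of_digits -` C \<inter> space D) = padic_of_digits -` \<Union>?B \<inter> space D"
      by blast
    finally show "padic_of_digits -` S \<inter> space D \<in> sets D"
      using open_padic_eq_Union[OF \<open>open S\<close>] by simp
  qed
  have "is_normalized_haar (distr D borel (padic_of_digits :: _ \<Rightarrow> 'p padic_int))"
  proof (rule is_normalized_haar_padicI)
    fix n a
    assume a: "0 \<le> a" "a < int ?p ^ n"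
    have "padic_of_digits -` {x :: 'p padic_int. padic_residue x n = a} \<inter> space D =
            {d \<in> space D. padic_residue (padic_of_digits d :: 'p padic_int) n = a}"
      by auto
    thus "emeasure (distr D borel padic_of_digits) {x :: 'p padic_int. padic_residue x n = a} =
            ennreal (1 / ?p ^ n)"
      using cyl[OF a] by (subst emeasure_distr[OF meas]) (auto simp: open_padic_coset)
  qed simp
  thus ?thesis
    by blast
qed

lemma haar_measure_padic5:
  "is_normalized_haar (haar_measure ::
     ('p::prime_card padic_int \<times> 'p padic_int \<times> 'p padic_int \<times> 'p padic_int \<times> 'p padic_int) measure)"
proof -
  obtain M :: "'p padic_int measure" where "is_normalized_haar M"
    using ex_normalized_haar_padic by blast
  hence *: "is_normalized_haar (M \<Otimes>\<^sub>M M \<Otimes>\<^sub>M M \<Otimes>\<^sub>M M \<Otimes>\<^sub>M M)"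
    by (intro is_normalized_haar_pair)
  show ?thesis
    unfolding haar_measure_def using * by (rule theI) (rule is_normalized_haar_unique[OF _ *])
qed

section \<open>Weierstrass equations and elliptic curves\<close>

type_synonym 'a weierstrass = "'a \<times> 'a \<times> 'a \<times> 'a \<times> 'a"
  \<comment> \<open>the coefficients \<open>[a\<^sub>1, a\<^sub>2, a\<^sub>3, a\<^sub>4, a\<^sub>6]\<close>\<close>

fun map_weierstrass :: "('a \<Rightarrow> 'b) \<Rightarrow> 'a weierstrass \<Rightarrow> 'b weierstrass" where
  "map_weierstrass h (a1, a2, a3, a4, a6) = (h a1, h a2, h a3, h a4, h a6)"

text \<open>
  The homogenization \<open>F\<close> of the Weierstrass equation, followed by its three partial derivatives.
\<close>

fun weierstrass_form :: "'a::comm_ring_1 weierstrass \<Rightarrow> 'a \<Rightarrow> 'a \<Rightarrow> 'a \<Rightarrow> 'a" where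
  "weierstrass_form (a1, a2, a3, a4, a6) x y z =
     y ^ 2 * z + a1 * x * y * z + a3 * y * z ^ 2
       - (x ^ 3 + a2 * x ^ 2 * z + a4 * x * z ^ 2 + a6 * z ^ 3)"

fun weierstrass_form_dx :: "'a::comm_ring_1 weierstrass \<Rightarrow> 'a \<Rightarrow> 'a \<Rightarrow> 'a \<Rightarrow> 'a" where
  "weierstrass_form_dx (a1, a2, a3, a4, a6) x y z =
     a1 * y * z - (3 * x ^ 2 + 2 * a2 * x * z + a4 * z ^ 2)"

fun weierstrass_form_dy :: "'a::comm_ring_1 weierstrass \<Rightarrow> 'a \<Rightarrow> 'a \<Rightarrow> 'a \<Rightarrow> 'a" where
  "weierstrass_form_dy (a1, a2, a3, a4, a6) x y z =
     2 * y * z + a1 * x * z + a3 * z ^ 2"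

fun weierstrass_form_dz :: "'a::comm_ring_1 weierstrass \<Rightarrow> 'a \<Rightarrow> 'a \<Rightarrow> 'a \<Rightarrow> 'a" where
  "weierstrass_form_dz (a1, a2, a3, a4, a6) x y z =
     y ^ 2 + a1 * x * y + 2 * a3 * y * z - (a2 * x ^ 2 + 2 * a4 * x * z + 3 * a6 * z ^ 2)"

text \<open>
  A Weierstrass equation over a field defines an elliptic curve if the plane projective cubic
  \<open>F = 0\<close> is smooth, i.e. has no singular point over the algebraic closure.
\<close>

definition defines_elliptic_curve :: "'a::field weierstrass \<Rightarrow> bool" where
  "defines_elliptic_curve E \<longleftrightarrow>
     (let F = map_weierstrass to_ac E
      in \<nexists>x y z :: 'a alg_closure. (x, y, z) \<noteq> (0, 0, 0) \<and>
           weierstrass_form F x y z = 0 \<and> weierstrass_form_dx F x y z = 0 \<and>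
           weierstrass_form_dy F x y z = 0 \<and> weierstrass_form_dz F x y z = 0)"

text \<open>
  The only point of the cubic at infinity is \<open>[0 : 1 : 0]\<close>, the neutral element \<open>Infinity\<close> of
  the group law.
\<close>

datatype 'a ec_point = Infinity | Affine 'a 'a

fun ec_points :: "'a::field weierstrass \<Rightarrow> 'a ec_point set" where
  "ec_points (a1, a2, a3, a4, a6) =
     insert Infinity {Affine x y | x y.
       y ^ 2 + a1 * x * y + a3 * y = x ^ 3 + a2 * x ^ 2 + a4 * x + a6}"

text \<open>
  Chord and tangent addition: \<open>y = l * x + m\<close> is the line through the two points (the tangent
  if they coincide), and the sum is the reflection \<open>(x, y) \<mapsto> (x, - y - a\<^sub>1 x - a\<^sub>3)\<close> of its third
  intersection point with the curve.
\<close>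

fun ec_add :: "'a::field weierstrass \<Rightarrow> 'a ec_point \<Rightarrow> 'a ec_point \<Rightarrow> 'a ec_point" where
  "ec_add E Infinity Q = Q"
| "ec_add E P Infinity = P"
| "ec_add (a1, a2, a3, a4, a6) (Affine x1 y1) (Affine x2 y2) =
     (if x1 = x2 \<and> y1 = - y2 - a1 * x2 - a3 then Infinity
      else let
        l = (if x1 = x2 then (3 * x1 ^ 2 + 2 * a2 * x1 + a4 - a1 * y1) / (2 * y1 + a1 * x1 + a3)
             else (y2 - y1) / (x2 - x1));
        m = y1 - l * x1;
        x3 = l ^ 2 + a1 * l - a2 - x1 - x2
      in Affine x3 (- (l * x3 + m) - a1 * x3 - a3))"

definition has_nontrivial_3_torsion_point :: "'a::field weierstrass \<Rightarrow> bool" where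
  "has_nontrivial_3_torsion_point E \<longleftrightarrow>
     (\<exists>P\<in>ec_points E. P \<noteq> Infinity \<and> ec_add E (ec_add E P P) P = Infinity)"

type_synonym 'p padic = "'p padic_int fract"
  \<comment> \<open>the field \<open>\<rat>\<^sub>p\<close> of \<open>p\<close>-adic numbers\<close>

definition W_tors :: "'p::prime_card padic_int weierstrass set" where
  "W_tors = {w. let E = map_weierstrass to_fract w :: 'p padic weierstrass
                in defines_elliptic_curve E \<and> has_nontrivial_3_torsion_point E}"

end

theory Submission
  imports Defs "HOL-Number_Theory.Residue_Primitive_Roots"
begin

text \<open>
  Completing the square turns the equation into \<open>y\<^sup>2 = f(x)\<close> with
  \<open>f = x\<^sup>3 + a\<^sub>2 x\<^sup>2 + a\<^sub>4 x + a\<^sub>6\<close>, and Haar measure is invariant under this shear. The points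
  of order three are the flexes; a flex at \<open>x = r\<close> with tangent line \<open>y = \<alpha> x + \<beta>\<close> amounts to
  \<open>f = (\<alpha> x + \<beta>)\<^sup>2 + (x - r)\<^sup>3\<close>, and valuations force \<open>\<alpha>, \<beta>, r\<close> to be integral. Put
  \<open>b = \<alpha> r + \<beta>\<close>; the curve is smooth iff \<open>b \<noteq> 0\<close> and \<open>4 \<alpha>\<^sup>3 \<noteq> 27 b\<close>. So the set in question is, up to
  a null set, the image of \<open>(\<alpha>, \<beta>, r) \<mapsto> (a\<^sub>2, a\<^sub>4, a\<^sub>6)\<close>, whose Jacobian is \<open>- 12 b\<^sup>2\<close>. Its fibres have
  \<open>8\<close> points if \<open>-3\<close> is a square and \<open>8 \<alpha>\<^sup>3 - 54 b\<close> is a cube, and \<open>2\<close> points otherwise. Hence the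
  measure is the integral of \<open>\<bar>3 b\<^sup>2\<bar>\<close> weighted by \<open>1 / 8\<close> or \<open>1 / 2\<close>. The change of variables is
  done one variable at a time: for fixed \<open>a\<^sub>2, a\<^sub>4\<close> the slope \<open>\<alpha>\<close> determines \<open>a\<^sub>6\<close>, and locally this
  is a similarity with factor \<open>\<bar>b\<^sup>2 / \<alpha>\<bar>\<close>. Finally, splitting off the multiples of \<open>p\<close>
  gives linear equations for the integral of \<open>\<bar>b\<bar>\<^sup>2\<close>, for the measure of the set of cubes, and
  for the integral of \<open>\<bar>b\<bar>\<^sup>2\<close> over the pairs with \<open>8 \<alpha>\<^sup>3 - 54 b\<close> a cube.
\<close>

section \<open>The \<open>p\<close>-adic absolute value\<close>

text \<open>The eight nonzero points of E[3] come in pairs with slopes \<alpha> and -\<alpha>; over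
  the p-adic numbers two or all eight are present. All eight require a square root of -3, as the
  Weil pairing predicts, and one further cube root. So the weight is 1/2, lowered by 3/8 on the
  pairs with a cube. The integral of |b|^2 over those pairs reproduces itself under (\<alpha>, b)
  \<mapsto> (p \<alpha>, p^3 b), for which 8 \<alpha>^3 - 54 b is homogeneous; the factor is
  p^(-10), and (p^10 - 1) / (p^2 - 1) is the polynomial in the denominator of the answer. The number
  of cubic residues modulo p enters as an unknown and is eliminated: cubing is three-to-one, so the
  measure of the cubes is a third of the integral of |x|^2. The obstacle is p = 3. Substituting r
  for a2 costs the factor |3| = 1/3, all perturbation estimates carry |3| along, and integrality of
  r needs a parity argument on valuations. On the other hand -3 is then no square, so only the
  weight 1/2 occurs.\<close>

lemma CARD_prime_gt_1: "1 < CARD('p::prime_card)"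
  using prime_gt_1_nat[OF prime_card[where 'a = 'p]] .

lemma CARD_prime_power_pos: "0 < int CARD('p::prime_card) ^ n"
  using CARD_prime_gt_1[where 'p = 'p] by simp

lemma padic_residue_of_int:
  "padic_residue (of_int k :: 'p::prime_card padic_int) n = k mod int CARD('p) ^ n"
proof (induction k rule: int_induct[where k = 0])
  case (step1 i)
  thus ?case by (simp add: padic_residue_ops mod_simps)
next
  case (step2 i)
  thus ?case by (simp add: padic_residue_ops mod_simps)
qed (simp add: padic_residue_ops)

lemma padic_residue_0_index: "padic_residue x 0 = 0"
  using padic_residue_range[of x 0] by simp

lemma padic_residue_eq_mono:
  fixes x y :: "'p::prime_card padic_int"
  assumes "padic_residue x n = padic_residue y n" "m \<le> n"
  shows "padic_residue x m = padic_residue y m"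
  using assms padic_residue_mod[of m n x] padic_residue_mod[of m n y] by simp

lemma padic_residue_eq_iff_diff:
  "padic_residue x n = padic_residue y n \<longleftrightarrow> padic_residue (x - y) n = 0"
  for x y :: "'p::prime_card padic_int"
proof -
  have "padic_residue (x - y) n = 0 \<longleftrightarrow>
    padic_residue x n mod int CARD('p) ^ n = padic_residue y n mod int CARD('p) ^ n"
    by (simp add: padic_residue_ops mod_eq_dvd_iff dvd_eq_mod_eq_0)
  thus ?thesis
    by (simp add: padic_residue_compat)
qed

lemma ex_padic_residue_seq:
  assumes "\<And>n. f n = f (Suc n) mod int CARD('p::prime_card) ^ n"
  shows "\<exists>x :: 'p padic_int. \<forall>n. padic_residue x n = f n"
proof -
  have "f \<in> {f. \<forall>n. f n = f (Suc n) mod int CARD('p) ^ n}"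
    using assms by blast
  from Abs_padic_int_inverse[OF this] show ?thesis
    by (intro exI[of _ "Abs_padic_int f"]) simp
qed

section \<open>Isometries of the p-adic integers\<close>

definition padic_isometry :: "('p::prime_card padic_int \<Rightarrow> 'p padic_int) \<Rightarrow> bool" where
  "padic_isometry G \<longleftrightarrow>
     (\<forall>n x y. padic_residue (G x) n = padic_residue (G y) n \<longleftrightarrow> padic_residue x n = padic_residue y n)"

text \<open>Modulo p^n an isometry induces an injective map of a finite set into itself, so
  pigeonhole makes it onto.\<close>

lemma padic_isometry_residue_surj:
  fixes G :: "'p::prime_card padic_int \<Rightarrow> 'p padic_int" and a :: "'p padic_int"
  assumes "padic_isometry G"
  obtains i where "0 \<le> i" "i < int CARD('p) ^ n" "padic_residue (G (of_int i)) n = padic_residue a n"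
proof -
  let ?R = "{0..<int CARD('p) ^ n}"
  let ?h = "\<lambda>i. padic_residue (G (of_int i)) n"
  have "inj_on ?h ?R"
  proof (rule inj_onI)
    fix i j
    assume *: "i \<in> ?R" "j \<in> ?R" "?h i = ?h j"
    have "padic_residue (of_int i :: 'p padic_int) n = padic_residue (of_int j :: 'p padic_int) n"
      using assms *(3) unfolding padic_isometry_def by blast
    thus "i = j"
      using *(1,2) by (simp add: padic_residue_of_int)
  qed
  moreover have "?h ` ?R \<subseteq> ?R"
    by (auto simp: padic_residue_range)
  ultimately have "?h ` ?R = ?R"
    by (intro endo_inj_surj) auto
  moreover have "padic_residue a n \<in> ?R"
    by (simp add: padic_residue_range)
  ultimately have "padic_residue a n \<in> ?h ` ?R"
    by simp
  then obtain i where "i \<in> ?R" "?h i = padic_residue a n"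
    by auto
  thus ?thesis
    using that by auto
qed

text \<open>Substitute for Hensel's lemma: the approximate preimages at successive levels are
  compatible because G also reflects congruences, so they glue to an exact one.\<close>

lemma padic_isometry_surj:
  fixes G :: "'p::prime_card padic_int \<Rightarrow> 'p padic_int"
  assumes G: "padic_isometry G"
  shows "surj G"
proof -
  have "\<exists>x. G x = a" for a
  proof -
    have "\<exists>i. 0 \<le> i \<and> i < int CARD('p) ^ n \<and> padic_residue (G (of_int i)) n = padic_residue a n" for n
      by (rule padic_isometry_residue_surj[OF G, of n a]) blast
    hence "\<exists>f. \<forall>n. 0 \<le> f n \<and> f n < int CARD('p) ^ n \<and>
        padic_residue (G (of_int (f n))) n = padic_residue a n"
      by (intro choice) blast
    then obtain f where f: "\<And>n. 0 \<le> f n \<and> f n < int CARD('p) ^ n"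
      "\<And>n. padic_residue (G (of_int (f n))) n = padic_residue a n"
      by blast
    have "f n = f (Suc n) mod int CARD('p) ^ n" for n
    proof -
      have "padic_residue (G (of_int (f (Suc n)))) n = padic_residue (G (of_int (f n))) n"
        using f(2)[of "Suc n"] f(2)[of n] by (metis padic_residue_compat(1))
      hence "padic_residue (of_int (f (Suc n)) :: 'p padic_int) n = padic_residue (of_int (f n) :: 'p padic_int) n"
        using G unfolding padic_isometry_def by blast
      thus ?thesis
        using f(1)[of n] by (simp add: padic_residue_of_int)
    qed
    then obtain x :: "'p padic_int" where x: "\<And>n. padic_residue x n = f n"
      using ex_padic_residue_seq[of f] by blast
    have "padic_residue (G x) n = padic_residue a n" for n
    proof -
      have "padic_residue x n = padic_residue (of_int (f n) :: 'p padic_int) n"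
        using f(1)[of n] by (simp add: x padic_residue_of_int)
      hence "padic_residue (G x) n = padic_residue (G (of_int (f n))) n"
        using G unfolding padic_isometry_def by blast
      thus ?thesis by (simp add: f)
    qed
    thus ?thesis
      by (blast intro: padic_int_eqI)
  qed
  thus ?thesis
    unfolding surj_def by metis
qed

lemma padic_isometry_inj: "padic_isometry G \<Longrightarrow> inj G"
proof (rule injI)
  fix x y
  assume "padic_isometry G" "G x = G y"
  hence "padic_residue x n = padic_residue y n" for n
    unfolding padic_isometry_def by metis
  thus "x = y"
    by (rule padic_int_eqI)
qed

section \<open>Uniformizer and units\<close>

definition unif :: "'p::prime_card padic_int" where
  "unif = of_nat CARD('p)"

lemma unif_power: "unif ^ n = (of_int (int CARD('p) ^ n) :: 'p::prime_card padic_int)"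
  by (simp add: unif_def)

lemma unif_power_dvd_iff: "unif ^ n dvd x \<longleftrightarrow> padic_residue x n = 0"
  for x :: "'p::prime_card padic_int"
proof
  assume "unif ^ n dvd x"
  thus "padic_residue x n = 0"
    by (auto simp: unif_power padic_residue_ops padic_residue_of_int simp del: of_int_power of_int_of_nat_eq)
next
  assume x: "padic_residue x n = 0"
  let ?p = "int CARD('p)"
  have p: "?p ^ m > 0" for m
    by (rule CARD_prime_power_pos)
  \<comment> \<open>Compatibility of the sequence that defines the quotient: its residue modulo p^k
    is read off from x modulo p^(n + k).\<close>
  have "padic_residue x (n + k) div ?p ^ n = padic_residue x (n + Suc k) div ?p ^ n mod ?p ^ k" for k
  proof -
    have "padic_residue x (n + k) = padic_residue x (n + Suc k) mod (?p ^ n * ?p ^ k)"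
      using padic_residue_compat(1)[of x "n + k"] by (simp flip: power_add)
    thus ?thesis
      using p[of k] p[of n] by (simp add: zmod_zmult2_eq)
  qed
  then obtain y :: "'p padic_int" where y: "\<And>k. padic_residue y k = padic_residue x (n + k) div ?p ^ n"
    using ex_padic_residue_seq[of "\<lambda>k. padic_residue x (n + k) div ?p ^ n"] by blast
  have "padic_residue x m = padic_residue (unif ^ n * y) m" for m
  proof -
    have "padic_residue x (n + m) mod ?p ^ n = 0"
      using padic_residue_mod[of n "n + m" x] x by simp
    hence "?p ^ n * (padic_residue x (n + m) div ?p ^ n) = padic_residue x (n + m)"
      by auto
    thus ?thesis
      using padic_residue_mod[of m "n + m" x]
      by (simp add: unif_power padic_residue_ops padic_residue_of_int mod_simps y
          del: of_int_power of_int_of_nat_eq)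
  qed
  thus "unif ^ n dvd x"
    by (metis dvdI padic_int_eqI)
qed

lemma unif_nonzero: "(unif :: 'p::prime_card padic_int) \<noteq> 0"
proof -
  have "padic_residue (unif :: 'p padic_int) 2 = int CARD('p) mod int CARD('p) ^ 2"
    by (metis padic_residue_of_int power_one_right unif_power)
  also have "\<dots> = int CARD('p)"
    using CARD_prime_gt_1[where 'p = 'p] by (simp add: power2_eq_square)
  finally show ?thesis
    using CARD_prime_gt_1[where 'p = 'p] by (auto simp: padic_residue_ops)
qed

lemma residue_1_mult_eq_0_iff:
  "padic_residue (x * y) 1 = 0 \<longleftrightarrow> padic_residue x 1 = 0 \<or> padic_residue y 1 = 0"
  for x y :: "'p::prime_card padic_int"
proof -
  have pr: "Factorial_Ring.prime (int CARD('p))"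
    by (rule prime_card_int)
  have "padic_residue (x * y) 1 = 0 \<longleftrightarrow> int CARD('p) dvd padic_residue x 1 * padic_residue y 1"
    by (simp add: padic_residue_ops dvd_eq_mod_eq_0)
  also have "\<dots> \<longleftrightarrow> int CARD('p) dvd padic_residue x 1 \<or> int CARD('p) dvd padic_residue y 1"
    using pr by (rule prime_dvd_mult_iff)
  also have "\<dots> \<longleftrightarrow> padic_residue x 1 = 0 \<or> padic_residue y 1 = 0"
    using padic_residue_compat(2)[of x 1] padic_residue_compat(2)[of y 1]
    by (simp add: dvd_eq_mod_eq_0)
  finally show ?thesis .
qed

lemma unit_mult_residue_eq_0_iff:
  fixes u x :: "'p::prime_card padic_int"
  assumes u: "padic_residue u 1 \<noteq> 0"
  shows "padic_residue (u * x) n = 0 \<longleftrightarrow> padic_residue x n = 0"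
proof -
  have "\<not> int CARD('p) dvd padic_residue u n" if "n > 0"
    using padic_residue_mod[of 1 n u] u that by (auto simp: dvd_eq_mod_eq_0)
  hence cop: "coprime (int CARD('p) ^ n) (padic_residue u n)"
    using prime_imp_coprime[OF prime_card_int[where 'a = 'p]] by (cases "n = 0") auto
  have "padic_residue (u * x) n = 0 \<longleftrightarrow> int CARD('p) ^ n dvd padic_residue u n * padic_residue x n"
    by (simp add: padic_residue_ops dvd_eq_mod_eq_0)
  also have "\<dots> \<longleftrightarrow> int CARD('p) ^ n dvd padic_residue x n"
    using cop by (simp add: coprime_dvd_mult_right_iff)
  also have "\<dots> \<longleftrightarrow> padic_residue x n = 0"
    using padic_residue_compat(2)[of x n] by (simp add: dvd_eq_mod_eq_0)
  finally show ?thesis .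
qed

text \<open>Multiplication by an element with nonzero residue is an isometry, hence onto, and a
  preimage of 1 is the inverse.\<close>

lemma padic_unit_iff: "x dvd 1 \<longleftrightarrow> padic_residue x 1 \<noteq> 0" for x :: "'p::prime_card padic_int"
proof
  assume "x dvd 1"
  then obtain y where "1 = x * y" ..
  moreover have "padic_residue (1 :: 'p padic_int) 1 \<noteq> 0"
    using CARD_prime_gt_1[where 'p = 'p] by (simp add: padic_residue_ops)
  ultimately show "padic_residue x 1 \<noteq> 0"
    using residue_1_mult_eq_0_iff[of x y] by auto
next
  assume x: "padic_residue x 1 \<noteq> 0"
  have "padic_isometry (\<lambda>z. x * z)"
    unfolding padic_isometry_def
    using unit_mult_residue_eq_0_iff[OF x]
    by (subst (1 2) padic_residue_eq_iff_diff) (simp flip: right_diff_distrib)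
  hence "surj (\<lambda>z. x * z)"
    by (rule padic_isometry_surj)
  thus "x dvd 1"
    by (metis dvdI surjD)
qed

text \<open>\<open>Suc n\<close> because every residue modulo p^0 is 0: the least n with x nonzero
  modulo p^(n + 1) is the valuation of x.\<close>

definition padic_norm :: "'p::prime_card padic_int \<Rightarrow> real" where
  "padic_norm x = (if x = 0 then 0 else 1 / real CARD('p) ^ (LEAST n. padic_residue x (Suc n) \<noteq> 0))"

lemma padic_norm_0 [simp]: "padic_norm 0 = 0"
  by (simp add: padic_norm_def)

lemma unif_unit_factorE:
  fixes x :: "'p::prime_card padic_int"
  assumes "x \<noteq> 0"
  obtains n u where "x = unif ^ n * u" "u dvd 1" "padic_norm x = 1 / real CARD('p) ^ n"
proof -
  define n where "n = (LEAST n. padic_residue x (Suc n) \<noteq> 0)"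
  obtain m where "padic_residue x m \<noteq> 0"
    using assms by (metis padic_int_eqI zero_padic_int.rep_eq)
  moreover from this obtain k where "m = Suc k"
    by (cases m) (auto simp: padic_residue_0_index)
  ultimately have ex: "\<exists>n. padic_residue x (Suc n) \<noteq> 0"
    by auto
  have n: "padic_residue x (Suc n) \<noteq> 0"
    unfolding n_def by (rule LeastI_ex[OF ex])
  have "padic_residue x n = 0"
  proof (cases n)
    case (Suc k)
    thus ?thesis
      using not_less_Least[of k "\<lambda>n. padic_residue x (Suc n) \<noteq> 0"] by (auto simp: n_def)
  qed (simp add: padic_residue_0_index)
  then obtain u where u: "x = unif ^ n * u"
    by (metis dvdE unif_power_dvd_iff)
  have "padic_residue u 1 \<noteq> 0"
  proof
    assume "padic_residue u 1 = 0"
    hence "unif dvd u"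
      using unif_power_dvd_iff[of 1 u] by simp
    hence "unif ^ Suc n dvd x"
      unfolding u by (metis dvd_refl mult_dvd_mono power_Suc2)
    thus False
      using n by (simp only: unif_power_dvd_iff)
  qed
  hence "u dvd 1"
    by (simp add: padic_unit_iff)
  moreover have "padic_norm x = 1 / real CARD('p) ^ n"
    using assms by (simp add: padic_norm_def n_def)
  ultimately show ?thesis
    using u that by blast
qed

lemma unif_power_dvd_unit_mult_iff:
  assumes "u dvd 1"
  shows "unif ^ m dvd (unif ^ n * u :: 'p::prime_card padic_int) \<longleftrightarrow> m \<le> n"
proof
  assume *: "unif ^ m dvd unif ^ n * u"
  show "m \<le> n"
  proof (rule ccontr)
    assume "\<not> m \<le> n"
    hence "unif ^ Suc n dvd (unif ^ m :: 'p padic_int)"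
      by (intro le_imp_power_dvd) simp
    hence "unif ^ Suc n dvd unif ^ n * u"
      using * dvd_trans by blast
    hence "unif ^ n * unif dvd unif ^ n * u"
      by (simp only: power_Suc2)
    hence "unif dvd u"
      using unif_nonzero by (subst (asm) dvd_mult_cancel_left) auto
    hence "padic_residue u 1 = 0"
      using unif_power_dvd_iff[of 1 u] by simp
    thus False
      using assms by (simp add: padic_unit_iff)
  qed
qed (simp add: le_imp_power_dvd dvd_mult2)

lemma inverse_CARD_power_le_iff:
  "1 / real CARD('p::prime_card) ^ m \<le> 1 / real CARD('p) ^ n \<longleftrightarrow> n \<le> m"
  using CARD_prime_gt_1[where 'p = 'p] by (simp add: divide_simps)

lemma padic_norm_le_iff: "padic_norm x \<le> 1 / real CARD('p) ^ n \<longleftrightarrow> padic_residue x n = 0"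
  for x :: "'p::prime_card padic_int"
proof (cases "x = 0")
  case True
  thus ?thesis by (simp add: padic_residue_ops)
next
  case False
  then obtain m u where *: "x = unif ^ m * u" "u dvd 1" "padic_norm x = 1 / real CARD('p) ^ m"
    by (rule unif_unit_factorE)
  have "padic_norm x \<le> 1 / real CARD('p) ^ n \<longleftrightarrow> n \<le> m"
    unfolding *(3) by (rule inverse_CARD_power_le_iff)
  also have "\<dots> \<longleftrightarrow> unif ^ n dvd x"
    unfolding *(1) by (rule unif_power_dvd_unit_mult_iff[OF *(2), symmetric])
  finally show ?thesis
    by (simp only: unif_power_dvd_iff)
qed

lemma padic_norm_unif_unit:
  assumes "u dvd 1"
  shows "padic_norm (unif ^ n * u :: 'p::prime_card padic_int) = 1 / real CARD('p) ^ n"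
proof -
  let ?x = "unif ^ n * u"
  have "?x \<noteq> 0"
    using assms unif_nonzero by auto
  then obtain m v where *: "?x = unif ^ m * v" "v dvd 1" "padic_norm ?x = 1 / real CARD('p) ^ m"
    by (rule unif_unit_factorE)
  have "unif ^ n dvd unif ^ m * v" "unif ^ m dvd unif ^ n * u"
    unfolding *(1)[symmetric] by (simp, simp add: *(1))
  hence "m = n"
    using unif_power_dvd_unit_mult_iff[OF *(2)] unif_power_dvd_unit_mult_iff[OF assms]
    by (metis order_antisym)
  thus ?thesis using * by simp
qed

lemma padic_norm_nonneg [simp]: "0 \<le> padic_norm x"
  by (simp add: padic_norm_def)

lemma padic_norm_eq_0_iff [simp]: "padic_norm x = 0 \<longleftrightarrow> x = 0"
  for x :: "'p::prime_card padic_int"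
  using CARD_prime_gt_1[where 'p = 'p] by (simp add: padic_norm_def)

lemma padic_norm_pos_iff [simp]: "0 < padic_norm x \<longleftrightarrow> x \<noteq> 0"
  using padic_norm_nonneg[of x] padic_norm_eq_0_iff[of x] by linarith

lemma padic_norm_mult: "padic_norm (x * y) = padic_norm x * padic_norm y"
  for x y :: "'p::prime_card padic_int"
proof (cases "x = 0 \<or> y = 0")
  case False
  obtain m u where x: "x = unif ^ m * u" "u dvd 1" "padic_norm x = 1 / real CARD('p) ^ m"
    using False by (auto intro: unif_unit_factorE[of x])
  obtain n v where y: "y = unif ^ n * v" "v dvd 1" "padic_norm y = 1 / real CARD('p) ^ n"
    using False by (auto intro: unif_unit_factorE[of y])
  have "x * y = unif ^ (m + n) * (u * v)" "u * v dvd 1"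
    using x y by (simp_all add: power_add mult_ac is_unit_mult_iff)
  hence "padic_norm (x * y) = 1 / real CARD('p) ^ (m + n)"
    by (simp only: padic_norm_unif_unit)
  thus ?thesis
    by (simp only: x(3) y(3) power_add) simp
qed auto

lemma padic_norm_1 [simp]: "padic_norm 1 = 1"
  using padic_norm_unif_unit[of 1 0] by simp

lemma padic_norm_power: "padic_norm (x ^ n) = padic_norm x ^ n"
  by (induction n) (simp_all add: padic_norm_mult)

lemma padic_norm_le_1: "padic_norm x \<le> 1"
  using padic_norm_le_iff[of x 0] by (simp add: padic_residue_0_index)

lemma padic_norm_unif: "padic_norm (unif :: 'p::prime_card padic_int) = 1 / real CARD('p)"
  using padic_norm_unif_unit[of "1 :: 'p padic_int" 1] by simp

lemma padic_norm_minus [simp]: "padic_norm (- x) = padic_norm x"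
proof -
  have "padic_norm (- 1 :: 'a padic_int) ^ 2 = 1"
    by (simp flip: padic_norm_power)
  hence "padic_norm (- 1 :: 'a padic_int) = 1"
    using padic_norm_nonneg[of "- 1 :: 'a padic_int"] unfolding power2_eq_1_iff by linarith
  thus ?thesis
    using padic_norm_mult[of "- 1" x] by simp
qed

lemma padic_norm_diff_commute: "padic_norm (x - y) = padic_norm (y - x)"
  using padic_norm_minus[of "x - y"] by simp

lemma padic_norm_add_le: "padic_norm (x + y) \<le> max (padic_norm x) (padic_norm y)"
  for x y :: "'p::prime_card padic_int"
proof (cases "x = 0 \<or> y = 0")
  case False
  obtain m where x: "padic_norm x = 1 / real CARD('p) ^ m"
    using False by (auto intro: unif_unit_factorE[of x])
  obtain n where y: "padic_norm y = 1 / real CARD('p) ^ n"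
    using False by (auto intro: unif_unit_factorE[of y])
  have "padic_residue x (min m n) = 0" "padic_residue y (min m n) = 0"
    unfolding padic_norm_le_iff[symmetric] x y inverse_CARD_power_le_iff by simp_all
  hence "padic_norm (x + y) \<le> 1 / real CARD('p) ^ (min m n)"
    by (simp add: padic_norm_le_iff padic_residue_ops)
  thus ?thesis
    unfolding x y by (cases "m \<le> n") (auto simp: min_def)
qed auto

lemma padic_norm_add_less: "padic_norm x < r \<Longrightarrow> padic_norm y < r \<Longrightarrow> padic_norm (x + y) < r"
  using padic_norm_add_le[of x y] by linarith

lemma padic_norm_diff_less: "padic_norm x < r \<Longrightarrow> padic_norm y < r \<Longrightarrow> padic_norm (x - y) < r"
  using padic_norm_add_less[of x r "- y"] by simp

lemma padic_norm_add_le': "padic_norm x \<le> r \<Longrightarrow> padic_norm y \<le> r \<Longrightarrow> padic_norm (x + y) \<le> r"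
  using padic_norm_add_le[of x y] by linarith

lemma padic_norm_diff_le': "padic_norm x \<le> r \<Longrightarrow> padic_norm y \<le> r \<Longrightarrow> padic_norm (x - y) \<le> r"
  using padic_norm_add_le'[of x r "- y"] by simp

text \<open>The ultrametric inequality for x = (x + y) - y excludes any cancellation.\<close>

lemma padic_norm_add_eq: "padic_norm y < padic_norm x \<Longrightarrow> padic_norm (x + y) = padic_norm x"
  using padic_norm_add_le[of x y] padic_norm_add_le[of "x + y" "- y"] by auto

lemma padic_norm_eq_of_close: "padic_norm (x - y) < padic_norm x \<Longrightarrow> padic_norm y = padic_norm x"
  using padic_norm_add_eq[of "y - x" x] by (simp add: padic_norm_diff_commute)

lemma padic_unit_iff_norm: "x dvd 1 \<longleftrightarrow> padic_norm x = 1" for x :: "'p::prime_card padic_int"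
proof
  assume "x dvd 1"
  thus "padic_norm x = 1"
    using padic_norm_unif_unit[of x 0] by simp
next
  assume 1: "padic_norm x = 1"
  hence "x \<noteq> 0"
    by auto
  then obtain n u where "x = unif ^ n * u" "u dvd 1" "padic_norm x = 1 / real CARD('p) ^ n"
    by (rule unif_unit_factorE)
  moreover from this(3) 1 CARD_prime_gt_1[where 'p = 'p] have "n = 0"
    using power_eq_1_iff[of "real CARD('p)" n] by auto
  ultimately show "x dvd 1" by simp
qed

lemma padic_dvd_iff_norm: "x dvd y \<longleftrightarrow> padic_norm y \<le> padic_norm x" for x y :: "'p::prime_card padic_int"
proof
  assume "x dvd y"
  then obtain z where "y = x * z" ..
  thus "padic_norm y \<le> padic_norm x"
    using padic_norm_le_1[of z] by (simp add: padic_norm_mult mult_left_le)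
next
  assume le: "padic_norm y \<le> padic_norm x"
  show "x dvd y"
  proof (cases "x = 0")
    case True
    hence "padic_norm y = 0"
      using le by (intro antisym) simp_all
    thus ?thesis by simp
  next
    case False
    then obtain n u where *: "x = unif ^ n * u" "u dvd 1" "padic_norm x = 1 / real CARD('p) ^ n"
      by (rule unif_unit_factorE)
    hence "unif ^ n dvd y"
      using le by (simp only: unif_power_dvd_iff padic_norm_le_iff)
    thus ?thesis
      using * by (simp add: mult_unit_dvd_iff)
  qed
qed

lemma padic_norm_lt_1_iff: "padic_norm x < 1 \<longleftrightarrow> unif dvd x" for x :: "'p::prime_card padic_int"
  using padic_unit_iff[of x] padic_unit_iff_norm[of x] padic_norm_le_1[of x] unif_power_dvd_iff[of 1 x]
  by (auto simp: less_le)

lemma padic_norm_of_int_eq_1: 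
  "coprime k (int CARD('p)) \<Longrightarrow> padic_norm (of_int k :: 'p::prime_card padic_int) = 1"
  using CARD_prime_gt_1[where 'p = 'p]
  by (auto simp flip: padic_unit_iff_norm simp: padic_unit_iff padic_residue_of_int
      dvd_eq_mod_eq_0[symmetric] coprime_absorb_right)

lemma padic_norm_numeral_eq_1: 
  "coprime (numeral k) CARD('p) \<Longrightarrow> padic_norm (numeral k :: 'p::prime_card padic_int) = 1"
  using padic_norm_of_int_eq_1[of "numeral k", where 'p = 'p] coprime_int_iff[of "numeral k" "CARD('p)"]
  by simp

text \<open>Cancelling numerals such as 2, 3 and 27 in polynomial identities rests on this. Two
  natural numbers are separated at the level of their maximum, because m < p^n for m \<le>
  n.\<close>

instance padic_int :: (prime_card) ring_char_0
proof
  have res: "padic_residue (of_nat m :: 'a padic_int) n = int m" if "m \<le> n" for m n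
  proof -
    have "m < CARD('a) ^ n"
      using CARD_prime_gt_1[where 'p = 'a] that power_gt_expt[of "CARD('a)" n] by auto
    hence "int m < int CARD('a) ^ n"
      unfolding of_nat_power[symmetric] by (simp only: of_nat_less_iff)
    hence "int m mod int CARD('a) ^ n = int m"
      by (intro mod_pos_pos_trivial) auto
    thus ?thesis
      using padic_residue_of_int[of "int m" n, where 'p = 'a] by simp
  qed
  show "inj (of_nat :: nat \<Rightarrow> 'a padic_int)"
  proof (rule injI)
    fix m n :: nat
    assume "of_nat m = (of_nat n :: 'a padic_int)"
    hence "int m = int n"
      using res[OF max.cobounded1[of m n]] res[OF max.cobounded2[of n m]] by argo
    thus "m = n"
      by simp
  qed
qed

section \<open>Measure and integration on the \<open>p\<close>-adic integers\<close>

lemma haar_measure_padic: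
  "is_normalized_haar (haar_measure :: 'p::prime_card padic_int measure)"
proof -
  obtain M :: "'p padic_int measure" where *: "is_normalized_haar M"
    using ex_normalized_haar_padic by blast
  show ?thesis
    unfolding haar_measure_def using * by (rule theI) (rule is_normalized_haar_unique[OF _ *])
qed

lemma sets_haar_padic [measurable_cong]:
  "sets (haar_measure :: 'p::prime_card padic_int measure) = sets borel"
  using haar_measure_padic by (auto simp: is_normalized_haar_def)

lemma space_haar_padic [simp]: "space (haar_measure :: 'p::prime_card padic_int measure) = UNIV"
  using sets_eq_imp_space_eq[OF sets_haar_padic[where 'p = 'p]] by simp

lemma emeasure_haar_padic_UNIV [simp]:
  "emeasure (haar_measure :: 'p::prime_card padic_int measure) UNIV = 1"
  using haar_measure_padic by (auto simp: is_normalized_haar_def)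

lemma prob_space_haar_padic: "prob_space (haar_measure :: 'p::prime_card padic_int measure)"
  by standard simp

lemma emeasure_haar_padic_translate:
  fixes A :: "'p::prime_card padic_int set"
  shows "A \<in> sets borel \<Longrightarrow> emeasure haar_measure ((+) a ` A) = emeasure haar_measure A"
  using haar_measure_padic[where 'p = 'p] unfolding is_normalized_haar_def by blast

lemma distr_haar_padic_translate:
  "distr haar_measure borel ((+) (a :: 'p::prime_card padic_int)) = haar_measure"
  using haar_measure_padic[where 'p = 'p] unfolding is_normalized_haar_iff_distr by blast

text \<open>The residue classes form a countable base, so it suffices to test them.\<close>

lemma borel_measurable_padicI:
  fixes f :: "'a \<Rightarrow> 'p::prime_card padic_int"
  assumes "\<And>n a. {x \<in> space N. padic_residue (f x) n = a} \<in> sets N"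
  shows "f \<in> borel_measurable N"
proof (rule borel_measurableI)
  fix S :: "'p padic_int set"
  assume "open S"
  let ?B = "{C \<in> range (\<lambda>(n, a). {x :: 'p padic_int. padic_residue x n = a}). C \<subseteq> S}"
  have "f -` C \<inter> space N \<in> sets N" if C: "C \<in> ?B" for C
  proof -
    from C obtain n a where "C = {x. padic_residue x n = a}"
      by auto
    hence "f -` C \<inter> space N = {x \<in> space N. padic_residue (f x) n = a}"
      by auto
    thus ?thesis
      using assms by simp
  qed
  moreover have "countable ?B"
    by (rule countable_subset[of _ "range (\<lambda>(n, a). {x. padic_residue x n = a})"]) auto
  ultimately have "(\<Union>C\<in>?B. f -` C \<inter> space N) \<in> sets N"
    by (intro sets.countable_UN') auto
  also have "(\<Union>C\<in>?B. f -` C \<inter> space N) = f -` \<Union>?B \<inter> space N"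
    by blast
  finally show "f -` S \<inter> space N \<in> sets N"
    using open_padic_eq_Union[OF \<open>open S\<close>] by simp
qed

lemma sets_padic_residue_eq [measurable]: 
  "{x :: 'p::prime_card padic_int. padic_residue x n = a} \<in> sets borel"
  by (intro borel_open open_padic_coset)

lemma sets_padic_residue_preimage:
  fixes f :: "'a \<Rightarrow> 'p::prime_card padic_int"
  assumes "f \<in> borel_measurable N"
  shows "{x \<in> space N. padic_residue (f x) n = a} \<in> sets N"
proof -
  have "f -` {x. padic_residue x n = a} \<inter> space N \<in> sets N"
    using measurable_sets[OF assms sets_padic_residue_eq] .
  moreover have "f -` {x. padic_residue x n = a} \<inter> space N = {x \<in> space N. padic_residue (f x) n = a}"
    by auto
  ultimately show ?thesis
    by simp
qed

lemma borel_measurable_padic_times [measurable]: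
  fixes f g :: "'a \<Rightarrow> 'p::prime_card padic_int"
  assumes f: "f \<in> borel_measurable N" and g: "g \<in> borel_measurable N"
  shows "(\<lambda>x. f x * g x) \<in> borel_measurable N"
proof (rule borel_measurable_padicI)
  fix n a
  let ?q = "int CARD('p) ^ n"
  have "{x \<in> space N. padic_residue (f x * g x) n = a} =
    (\<Union>(i, j)\<in>{(i, j). i * j mod ?q = a}.
      {x \<in> space N. padic_residue (f x) n = i} \<inter> {x \<in> space N. padic_residue (g x) n = j})"
    by (auto simp: padic_residue_ops)
  also have "\<dots> \<in> sets N"
    using sets_padic_residue_preimage[OF f] sets_padic_residue_preimage[OF g]
    by (intro sets.countable_UN') auto
  finally show "{x \<in> space N. padic_residue (f x * g x) n = a} \<in> sets N" .
qed

lemma borel_measurable_padic_plus [measurable]: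
  fixes f g :: "'a \<Rightarrow> 'p::prime_card padic_int"
  assumes f: "f \<in> borel_measurable N" and g: "g \<in> borel_measurable N"
  shows "(\<lambda>x. f x + g x) \<in> borel_measurable N"
proof (rule borel_measurable_padicI)
  fix n a
  let ?q = "int CARD('p) ^ n"
  have "{x \<in> space N. padic_residue (f x + g x) n = a} =
    (\<Union>(i, j)\<in>{(i, j). (i + j) mod ?q = a}.
      {x \<in> space N. padic_residue (f x) n = i} \<inter> {x \<in> space N. padic_residue (g x) n = j})"
    by (auto simp: padic_residue_ops)
  also have "\<dots> \<in> sets N"
    using sets_padic_residue_preimage[OF f] sets_padic_residue_preimage[OF g]
    by (intro sets.countable_UN') auto
  finally show "{x \<in> space N. padic_residue (f x + g x) n = a} \<in> sets N" .
qed

lemma borel_measurable_padic_uminus [measurable]: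
  fixes f :: "'a \<Rightarrow> 'p::prime_card padic_int"
  assumes f: "f \<in> borel_measurable N"
  shows "(\<lambda>x. - f x) \<in> borel_measurable N"
  using borel_measurable_padic_times[OF borel_measurable_const f, of "-1"] by simp

lemma borel_measurable_padic_minus [measurable]:
  fixes f g :: "'a \<Rightarrow> 'p::prime_card padic_int"
  assumes f: "f \<in> borel_measurable N" and g: "g \<in> borel_measurable N"
  shows "(\<lambda>x. f x - g x) \<in> borel_measurable N"
  using borel_measurable_padic_plus[OF f borel_measurable_padic_uminus[OF g]] by simp

lemma borel_measurable_padic_power [measurable]:
  fixes f :: "'a \<Rightarrow> 'p::prime_card padic_int"
  assumes f: "f \<in> borel_measurable N"
  shows "(\<lambda>x. f x ^ n) \<in> borel_measurable N"
  by (induction n) (auto intro: borel_measurable_padic_times f)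

lemma padic_residue_eq_iff_norm:
  "padic_residue x n = padic_residue y n \<longleftrightarrow> padic_norm (x - y) \<le> 1 / real CARD('p) ^ n"
  for x y :: "'p::prime_card padic_int"
  unfolding padic_norm_le_iff by (rule padic_residue_eq_iff_diff)

lemma ex_inverse_CARD_power_less:
  assumes "0 < e"
  shows "\<exists>n. 1 / real CARD('p::prime_card) ^ n < e"
  using reals_power_lt_ex[OF assms, of "real CARD('p)"] CARD_prime_gt_1[where 'p = 'p]
  by (auto simp: power_one_over)

text \<open>The sets where the norm exceeds a are open: the norm is locally constant away from 0,
  and they contain 0 only if a is negative.\<close>

lemma borel_measurable_padic_norm [measurable]:
  "(padic_norm :: 'p::prime_card padic_int \<Rightarrow> real) \<in> borel_measurable borel"
proof -
  have "open {x :: 'p padic_int. a < padic_norm x}" for a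
    unfolding open_padic_int_def
  proof
    fix x :: "'p padic_int"
    assume x: "x \<in> {x. a < padic_norm x}"
    show "\<exists>n. \<forall>y :: 'p padic_int. padic_residue y n = padic_residue x n \<longrightarrow> y \<in> {x. a < padic_norm x}"
    proof (cases "x = 0")
      case True
      hence "a < 0"
        using x by simp
      hence "a < padic_norm y" for y :: "'p padic_int"
        by (rule less_le_trans) simp
      thus ?thesis by (intro exI[of _ 0]) auto
    next
      case False
      then obtain n where n: "1 / real CARD('p) ^ n < padic_norm x"
        using ex_inverse_CARD_power_less[of "padic_norm x", where 'p = 'p] by auto
      have "padic_norm y = padic_norm x" if "padic_residue y n = padic_residue x n" for y :: "'p padic_int"
      proof (rule padic_norm_eq_of_close)
        have "padic_residue x n = padic_residue y n"
          using that ..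
        thus "padic_norm (x - y) < padic_norm x"
          using n unfolding padic_residue_eq_iff_norm by linarith
      qed
      thus ?thesis
        using x by (intro exI[of _ n]) (metis mem_Collect_eq)
    qed
  qed
  hence "{x :: 'p padic_int. a < padic_norm x} \<in> sets borel" for a
    by (rule borel_open)
  thus ?thesis
    unfolding borel_measurable_iff_greater by simp
qed

text \<open>The p^n classes are translates of the class of 0 and partition the space.\<close>

lemma emeasure_padic_residue_class:
  assumes a: "0 \<le> a" "a < int CARD('p::prime_card) ^ n"
  shows "emeasure haar_measure {x :: 'p padic_int. padic_residue x n = a} = ennreal (1 / real CARD('p) ^ n)"
proof -
  let ?M = "haar_measure :: 'p padic_int measure"
  let ?q = "int CARD('p) ^ n"
  let ?C = "\<lambda>a. {x :: 'p padic_int. padic_residue x n = a}"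
  interpret prob_space ?M
    by (rule prob_space_haar_padic)
  have eq: "emeasure ?M (?C a) = emeasure ?M (?C 0)" if "a \<in> {0..<?q}" for a
  proof -
    have "(+) (of_int a) ` ?C 0 = ?C a"
    proof (intro equalityI subsetI)
      fix x assume "x \<in> ?C a"
      hence "padic_residue x n = padic_residue (of_int a :: 'p padic_int) n"
        using that by (simp add: padic_residue_of_int)
      hence "x - of_int a \<in> ?C 0"
        by (simp add: padic_residue_eq_iff_diff)
      thus "x \<in> (+) (of_int a) ` ?C 0"
        by (rule rev_image_eqI) simp
    next
      fix x assume "x \<in> (+) (of_int a) ` ?C 0"
      then obtain y where y: "x = of_int a + y" "padic_residue y n = 0"
        by auto
      hence "padic_residue x n = padic_residue (of_int a :: 'p padic_int) n"
        by (subst padic_residue_eq_iff_diff) simp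
      thus "x \<in> ?C a"
        using that by (simp add: padic_residue_of_int)
    qed
    thus ?thesis
      using emeasure_haar_padic_translate[of "?C 0" "of_int a"] by simp
  qed
  have "1 = emeasure ?M (\<Union>a\<in>{0..<?q}. ?C a)"
  proof -
    have "(\<Union>a\<in>{0..<?q}. ?C a) = UNIV"
      by (auto simp: padic_residue_range)
    thus ?thesis by simp
  qed
  also have "\<dots> = (\<Sum>a\<in>{0..<?q}. emeasure ?M (?C a))"
    by (intro sum_emeasure[symmetric]) (auto simp: disjoint_family_on_def sets_haar_padic)
  also have "\<dots> = (\<Sum>a\<in>{0..<?q}. emeasure ?M (?C 0))"
    by (intro sum.cong refl eq)
  also have "\<dots> = ennreal (real CARD('p) ^ n) * emeasure ?M (?C 0)"
    by (simp add: ennreal_of_nat_eq_real_of_nat)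
  finally have "ennreal (real CARD('p) ^ n * measure ?M (?C 0)) = ennreal 1"
    by (simp add: emeasure_eq_measure ennreal_mult)
  hence "real CARD('p) ^ n * measure ?M (?C 0) = 1"
    by (subst (asm) ennreal_inj) auto
  hence "measure ?M (?C 0) = 1 / real CARD('p) ^ n"
    by (auto simp: field_simps)
  thus ?thesis
    using eq[of a] a by (simp add: emeasure_eq_measure)
qed

lemma emeasure_padic_residue_ball:
  "emeasure haar_measure {x :: 'p padic_int. padic_residue x n = padic_residue y n} = ennreal (1 / real CARD('p) ^ n)"
  for y :: "'p::prime_card padic_int"
  by (rule emeasure_padic_residue_class[OF padic_residue_range])

lemma emeasure_haar_padic_singleton [simp]:
  "emeasure haar_measure {x :: 'p::prime_card padic_int} = 0"
proof (rule ccontr)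
  interpret prob_space "haar_measure :: 'p padic_int measure"
    by (rule prob_space_haar_padic)
  assume "emeasure haar_measure {x} \<noteq> 0"
  hence "measure haar_measure {x} > 0"
    by (simp add: emeasure_eq_measure zero_less_measure_iff)
  then obtain n where n: "1 / real CARD('p) ^ n < measure haar_measure {x}"
    using ex_inverse_CARD_power_less[where 'p = 'p] by blast
  have "measure haar_measure {x} \<le> measure haar_measure {y :: 'p padic_int. padic_residue y n = padic_residue x n}"
    by (intro finite_measure_mono) (auto simp: sets_haar_padic)
  also have "\<dots> = 1 / real CARD('p) ^ n"
    by (simp add: measure_def emeasure_padic_residue_ball)
  finally show False
    using n by simp
qed

lemma AE_haar_padic_not_eq: "AE x in haar_measure. x \<noteq> (a :: 'p::prime_card padic_int)"
  by (rule AE_I[of _ _ "{a}"]) (auto simp: sets_haar_padic)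

text \<open>Exact division as a total function: the value 0 outside the natural domain lets the flex
  data below be Borel functions of all their arguments.\<close>

definition padic_div :: "'p::prime_card padic_int \<Rightarrow> 'p padic_int \<Rightarrow> 'p padic_int" where
  "padic_div y c = (if c \<noteq> 0 \<and> c dvd y then THE z. y = c * z else 0)"

lemma padic_div_mult [simp]: "c \<noteq> 0 \<Longrightarrow> padic_div (c * z) c = z"
  unfolding padic_div_def by (auto intro!: the_equality)

lemma mult_padic_div [simp]: "c \<noteq> 0 \<Longrightarrow> c dvd y \<Longrightarrow> c * padic_div y c = y"
  by auto

lemma sets_padic_dvd:
  fixes f g :: "'a \<Rightarrow> 'p::prime_card padic_int"
  assumes "f \<in> borel_measurable N" "g \<in> borel_measurable N"
  shows "{x \<in> space N. f x dvd g x} \<in> sets N"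
  unfolding padic_dvd_iff_norm
  by (intro borel_measurable_le measurable_compose[OF _ borel_measurable_padic_norm] assms)

lemma borel_measurable_padic_div [measurable]:
  fixes f g :: "'a \<Rightarrow> 'p::prime_card padic_int"
  assumes f: "f \<in> borel_measurable N" and g: "g \<in> borel_measurable N"
  shows "(\<lambda>x. padic_div (g x) (f x)) \<in> borel_measurable N"
proof (rule borel_measurable_padicI)
  fix n a
  have nz: "{x \<in> space N. f x \<noteq> 0} \<in> sets N"
  proof -
    have "{x \<in> space N. 0 dvd f x} \<in> sets N"
      using f by (intro sets_padic_dvd) auto
    moreover have "{x \<in> space N. f x \<noteq> 0} = space N - {x \<in> space N. 0 dvd f x}"
      by auto
    ultimately show ?thesis by auto
  qed
  show "{x \<in> space N. padic_residue (padic_div (g x) (f x)) n = a} \<in> sets N"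
  proof (cases "a \<in> {0..<int CARD('p) ^ n}")
    case True
    have iff: "padic_residue (padic_div (g x) (f x)) n = a \<longleftrightarrow> f x * unif ^ n dvd g x - f x * of_int a"
      if x: "f x \<noteq> 0" "f x dvd g x" for x
    proof -
      have "padic_residue (padic_div (g x) (f x)) n = a \<longleftrightarrow>
        padic_residue (padic_div (g x) (f x)) n = padic_residue (of_int a :: 'p padic_int) n"
        using True by (simp add: padic_residue_of_int)
      also have "\<dots> \<longleftrightarrow> unif ^ n dvd padic_div (g x) (f x) - of_int a"
        by (simp add: unif_power_dvd_iff flip: padic_residue_eq_iff_diff)
      also have "\<dots> \<longleftrightarrow> f x * unif ^ n dvd f x * (padic_div (g x) (f x) - of_int a)"
        using x by simp
      finally show ?thesis
        using x by (simp add: right_diff_distrib)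
    qed
    \<comment> \<open>The second set of the union is where the default value 0 is taken; it enters
      only for a = 0.\<close>
    have "{x \<in> space N. padic_residue (padic_div (g x) (f x)) n = a} =
      ({x \<in> space N. f x \<noteq> 0} \<inter> {x \<in> space N. f x dvd g x} \<inter>
        {x \<in> space N. f x * unif ^ n dvd g x - f x * of_int a}) \<union>
      (if a = 0 then space N - ({x \<in> space N. f x \<noteq> 0} \<inter> {x \<in> space N. f x dvd g x}) else {})"
      (is "?L = ?R")
    proof (rule Set.set_eqI)
      fix x
      show "x \<in> ?L \<longleftrightarrow> x \<in> ?R"
      proof (cases "f x \<noteq> 0 \<and> f x dvd g x")
        case True
        thus ?thesis using iff[of x] by auto
      next
        case False
        hence "padic_residue (padic_div (g x) (f x)) n = 0"
          unfolding padic_div_def by (auto simp: padic_residue_ops)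
        thus ?thesis using False by auto
      qed
    qed
    also have "?R \<in> sets N"
    proof -
      have "{x \<in> space N. f x dvd g x} \<in> sets N"
        by (intro sets_padic_dvd f g)
      moreover have "{x \<in> space N. f x * unif ^ n dvd g x - f x * of_int a} \<in> sets N"
        by (intro sets_padic_dvd borel_measurable_padic_times borel_measurable_padic_minus
            borel_measurable_const f g)
      ultimately show ?thesis
        using nz by auto
    qed
    finally show ?thesis .
  next
    case False
    hence "padic_residue x n \<noteq> a" for x :: "'p padic_int"
      using padic_residue_range[of x n] by auto
    thus ?thesis by simp
  qed
qed

lemma nn_integral_padic_translate:
  fixes f :: "'p::prime_card padic_int \<Rightarrow> ennreal"
  assumes [measurable]: "f \<in> borel_measurable borel"
  shows "(\<integral>\<^sup>+x. f (a + x) \<partial>haar_measure) = (\<integral>\<^sup>+x. f x \<partial>haar_measure)"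
proof -
  have "(\<integral>\<^sup>+x. f x \<partial>haar_measure) = (\<integral>\<^sup>+x. f x \<partial>distr haar_measure borel ((+) a))"
    by (simp add: distr_haar_padic_translate)
  also have "\<dots> = (\<integral>\<^sup>+x. f (a + x) \<partial>haar_measure)"
    by (rule nn_integral_distr) (simp_all add: measurable_cong_sets[OF sets_haar_padic refl])
  finally show ?thesis ..
qed

lemma emeasure_padic_multiples:
  fixes c :: "'p::prime_card padic_int"
  assumes "c \<noteq> 0"
  shows "emeasure haar_measure {y. c dvd y} = ennreal (padic_norm c)"
proof -
  obtain n u where c: "c = unif ^ n * u" "u dvd 1" "padic_norm c = 1 / real CARD('p) ^ n"
    using assms by (rule unif_unit_factorE)
  have "c dvd y \<longleftrightarrow> padic_residue y n = 0" for y
    unfolding c(1) mult_unit_dvd_iff[OF c(2)] by (rule unif_power_dvd_iff)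
  hence eq: "{y. c dvd y} = {y. padic_residue y n = 0}"
    by (rule Collect_cong)
  show ?thesis
    unfolding eq c(3) by (rule emeasure_padic_residue_class[OF order_refl CARD_prime_power_pos])
qed

text \<open>Conditioned on c dividing y, the quotient y / c is again normalized Haar, by uniqueness,
  and the condition has probability |c|. The shift by d is then a translation.\<close>

lemma nn_integral_padic_affine:
  fixes f :: "'p::prime_card padic_int \<Rightarrow> ennreal" and c d :: "'p padic_int"
  assumes [measurable]: "f \<in> borel_measurable borel" and c: "c \<noteq> 0"
  shows "(\<integral>\<^sup>+y. f y * indicator {y. c dvd y - d} y \<partial>haar_measure) =
    ennreal (padic_norm c) * (\<integral>\<^sup>+x. f (d + c * x) \<partial>haar_measure)"
proof -
  let ?M = "haar_measure :: 'p padic_int measure"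
  interpret prob_space ?M
    by (rule prob_space_haar_padic)
  define A where "A = {y. c dvd y}"
  define \<delta> where "\<delta> y = padic_div y c" for y
  have A [measurable]: "A \<in> sets borel"
  proof -
    have "{y \<in> space borel. c dvd y} \<in> sets borel"
      by (rule sets_padic_dvd) auto
    thus ?thesis
      unfolding A_def by simp
  qed
  have MA: "emeasure ?M A = ennreal (padic_norm c)"
    unfolding A_def by (rule emeasure_padic_multiples[OF c])
  have pos: "padic_norm c > 0"
    using c by simp
  have \<delta> [measurable]: "\<delta> \<in> borel_measurable borel"
    unfolding \<delta>_def by measurable
  have \<delta>_mult: "\<delta> (c * x) = x" for x
    using c by (simp add: \<delta>_def)
  have mult_\<delta>: "c * \<delta> y = y" if "y \<in> A" for y
    using c that by (simp add: \<delta>_def A_def)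
  let ?N = "distr (uniform_measure ?M A) borel \<delta>"
  have emN: "emeasure ?N S = emeasure ?M (A \<inter> \<delta> -` S) / emeasure ?M A" if S [measurable]: "S \<in> sets borel" for S
    using measurable_sets[OF \<delta> S] by (subst emeasure_distr) (auto simp: sets_haar_padic)
  have "is_normalized_haar ?N"
    unfolding is_normalized_haar_def
  proof (intro conjI allI ballI)
    show "emeasure ?N UNIV = 1"
      using pos by (subst emN) (auto simp: MA ennreal_divide_self)
  next
    fix a and S :: "'p padic_int set"
    assume S [measurable]: "S \<in> sets borel"
    have aS: "(+) a ` S \<in> sets borel"
      unfolding translate_eq_vimage using measurable_sets[OF measurable_translate S, of "- a"] by simp
    \<comment> \<open>Translating the quotient by a is translating y by c * a, which preserves Haar
      measure and the multiples of c.\<close>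
    have "A \<inter> \<delta> -` ((+) a ` S) = (+) (c * a) ` (A \<inter> \<delta> -` S)"
    proof (intro equalityI subsetI)
      fix y
      assume y: "y \<in> A \<inter> \<delta> -` ((+) a ` S)"
      then obtain s where s: "s \<in> S" "\<delta> y = a + s"
        by auto
      hence "y = c * a + c * s"
        using mult_\<delta>[of y] y by (simp add: ring_distribs)
      thus "y \<in> (+) (c * a) ` (A \<inter> \<delta> -` S)"
        using s by (auto simp: \<delta>_mult A_def)
    next
      fix y
      assume "y \<in> (+) (c * a) ` (A \<inter> \<delta> -` S)"
      then obtain z where z: "y = c * a + z" "z \<in> A" "\<delta> z \<in> S"
        by auto
      have y: "y = c * (a + \<delta> z)"
        using z mult_\<delta>[of z] by (simp add: ring_distribs)
      hence "\<delta> y = a + \<delta> z"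
        by (simp only: \<delta>_mult)
      thus "y \<in> A \<inter> \<delta> -` ((+) a ` S)"
        using z y by (auto simp: A_def)
    qed
    moreover have "A \<inter> \<delta> -` S \<in> sets borel"
      using measurable_sets[OF \<delta> S] by auto
    ultimately show "emeasure ?N ((+) a ` S) = emeasure ?N S"
      by (simp only: emN[OF aS] emN[OF S] emeasure_haar_padic_translate)
  qed simp
  hence N: "?N = ?M"
    using haar_measure_padic by (rule is_normalized_haar_unique)
  have "(\<integral>\<^sup>+x. f (d + c * x) \<partial>?M) = (\<integral>\<^sup>+x. f (d + c * x) \<partial>?N)"
    by (simp add: N)
  also have "\<dots> = (\<integral>\<^sup>+y. f (d + c * \<delta> y) \<partial>uniform_measure ?M A)"
    by (subst nn_integral_distr) (auto simp: sets_haar_padic cong: measurable_cong_sets)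
  also have "\<dots> = (\<integral>\<^sup>+y. f (d + c * \<delta> y) * indicator A y \<partial>?M) / ennreal (padic_norm c)"
    by (subst nn_integral_uniform_measure) (auto simp: MA)
  also have "(\<integral>\<^sup>+y. f (d + c * \<delta> y) * indicator A y \<partial>?M) = (\<integral>\<^sup>+y. f (d + y) * indicator A y \<partial>?M)"
    by (intro nn_integral_cong) (auto simp: mult_\<delta> indicator_def)
  also have "\<dots> = (\<integral>\<^sup>+y. f (d + y) * indicator A (d + y - d) \<partial>?M)"
    by simp
  also have "\<dots> = (\<integral>\<^sup>+y. f y * indicator A (y - d) \<partial>?M)"
    by (rule nn_integral_padic_translate) measurable
  also have "\<dots> = (\<integral>\<^sup>+y. f y * indicator {y. c dvd y - d} y \<partial>?M)"
    by (intro nn_integral_cong) (auto simp: A_def indicator_def)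
  finally have *: "(\<integral>\<^sup>+x. f (d + c * x) \<partial>?M) =
    (\<integral>\<^sup>+y. f y * indicator {y. c dvd y - d} y \<partial>?M) / ennreal (padic_norm c)" .
  have "ennreal (padic_norm c) * (t / ennreal (padic_norm c)) = t" for t
    using pos by (simp add: ennreal_times_divide mult.commute[of _ t] mult_divide_eq_ennreal)
  thus ?thesis
    unfolding * by simp
qed

lemma nn_integral_padic_unit_affine:
  fixes f :: "'p::prime_card padic_int \<Rightarrow> ennreal" and c d :: "'p padic_int"
  assumes "f \<in> borel_measurable borel" and c: "padic_norm c = 1"
  shows "(\<integral>\<^sup>+x. f (d + c * x) \<partial>haar_measure) = (\<integral>\<^sup>+y. f y \<partial>haar_measure)"
proof -
  have "c dvd 1"
    using c by (simp add: padic_unit_iff_norm)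
  hence "c dvd y" for y
    using dvd_trans one_dvd by blast
  moreover have "c \<noteq> 0"
    using c by auto
  ultimately show ?thesis
    using nn_integral_padic_affine[OF assms(1), of c d] c by simp
qed

lemma padic_isometry_iff_norm:
  fixes G :: "'p::prime_card padic_int \<Rightarrow> 'p padic_int"
  assumes "\<And>x y. padic_norm (G x - G y) = padic_norm (x - y)"
  shows "padic_isometry G"
  unfolding padic_isometry_def padic_residue_eq_iff_norm assms by simp

text \<open>The preimage of a residue class is a residue class of the same level, and Haar measure
  is characterized by giving each class of level n the mass p^(-n).\<close>

lemma
  fixes G :: "'p::prime_card padic_int \<Rightarrow> 'p padic_int"
  assumes G: "padic_isometry G"
  shows borel_measurable_padic_isometry: "G \<in> borel_measurable borel"
    and distr_padic_isometry: "distr haar_measure borel G = haar_measure"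
proof -
  have cls: "\<exists>y :: 'p padic_int. {x. padic_residue (G x) n = a} = {x. padic_residue x n = padic_residue y n}"
    if "0 \<le> a" "a < int CARD('p) ^ n" for n a
  proof -
    obtain y where y: "G y = of_int a"
      using padic_isometry_surj[OF G] by (metis surjD)
    have "padic_residue (of_int a :: 'p padic_int) n = a"
      using that by (simp add: padic_residue_of_int)
    hence "padic_residue (G x) n = a \<longleftrightarrow> padic_residue x n = padic_residue y n" for x
      using G y unfolding padic_isometry_def by metis
    thus ?thesis by blast
  qed
  show meas: "G \<in> borel_measurable borel"
  proof (rule borel_measurable_padicI)
    fix n a
    show "{x \<in> space borel. padic_residue (G x) n = a} \<in> sets borel"
    proof (cases "0 \<le> a \<and> a < int CARD('p) ^ n")
      case True
      then obtain y :: "'p padic_int" where "{x. padic_residue (G x) n = a} = {x. padic_residue x n = padic_residue y n}"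
        using cls by blast
      thus ?thesis
        by (simp add: sets_padic_residue_eq)
    next
      case False
      hence "padic_residue (G x) n \<noteq> a" for x
        using padic_residue_range[of "G x" n] by auto
      thus ?thesis by simp
    qed
  qed
  have "is_normalized_haar (distr haar_measure borel G)"
  proof (rule is_normalized_haar_padicI)
    fix n a
    assume "0 \<le> a" "a < int CARD('p) ^ n"
    then obtain y :: "'p padic_int" where y: "{x. padic_residue (G x) n = a} = {x. padic_residue x n = padic_residue y n}"
      using cls by blast
    have "emeasure (distr haar_measure borel G) {x :: 'p padic_int. padic_residue x n = a} =
        emeasure haar_measure {x. padic_residue (G x) n = a}"
      using meas by (subst emeasure_distr)
        (auto simp: vimage_def measurable_cong_sets[OF sets_haar_padic refl] sets_padic_residue_eq)
    thus "emeasure (distr haar_measure borel G) {x :: 'p padic_int. padic_residue x n = a} =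
        ennreal (1 / real (CARD('p) ^ n))"
      unfolding y by (simp add: emeasure_padic_residue_ball)
  qed simp
  thus "distr haar_measure borel G = haar_measure"
    using haar_measure_padic by (rule is_normalized_haar_unique)
qed

lemma nn_integral_padic_isometry:
  fixes f :: "'p::prime_card padic_int \<Rightarrow> ennreal"
  assumes "padic_isometry G" "f \<in> borel_measurable borel"
  shows "(\<integral>\<^sup>+x. f (G x) \<partial>haar_measure) = (\<integral>\<^sup>+x. f x \<partial>haar_measure)"
proof -
  have "(\<integral>\<^sup>+x. f x \<partial>haar_measure) = (\<integral>\<^sup>+x. f x \<partial>distr haar_measure borel G)"
    by (simp add: distr_padic_isometry assms(1))
  also have "\<dots> = (\<integral>\<^sup>+x. f (G x) \<partial>haar_measure)"
    using borel_measurable_padic_isometry[OF assms(1)] assms(2)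
    by (intro nn_integral_distr) (simp_all add: measurable_cong_sets[OF sets_haar_padic refl])
  finally show ?thesis ..
qed

section \<open>The area formula\<close>

lemma padic_isometry_inv:
  assumes "padic_isometry G"
  shows "padic_isometry (inv_into UNIV G)"
  using assms surj_f_inv_f[OF padic_isometry_surj[OF assms]] unfolding padic_isometry_def
  by metis

text \<open>On a ball where g multiplies all distances by k, translations and dilations of source
  and target turn g into an isometry; the claim reduces to affine and isometric
  substitutions.\<close>

lemma
  fixes g :: "'p::prime_card padic_int \<Rightarrow> 'p padic_int" and w :: "'p padic_int \<Rightarrow> ennreal"
    and x\<^sub>0 :: "'p padic_int"
  assumes k: "k > 0" and w [measurable]: "w \<in> borel_measurable borel"
    and iso: "\<And>y z. padic_residue y N = padic_residue x\<^sub>0 N \<Longrightarrow> padic_residue z N = padic_residue x\<^sub>0 N \<Longrightarrow>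
      padic_norm (g y - g z) = k * padic_norm (y - z)"
  shows nn_integral_area_ball:
      "(\<integral>\<^sup>+x. ennreal k * w x * indicator {x. padic_residue x N = padic_residue x\<^sub>0 N} x \<partial>haar_measure) =
       (\<integral>\<^sup>+y. (\<Sum>x | padic_residue x N = padic_residue x\<^sub>0 N \<and> g x = y. w x) \<partial>haar_measure)"
    and borel_measurable_area_ball:
      "(\<lambda>y. \<Sum>x | padic_residue x N = padic_residue x\<^sub>0 N \<and> g x = y. w x) \<in> borel_measurable borel"
proof -
  let ?B = "{x. padic_residue x N = padic_residue x\<^sub>0 N}"
  let ?S = "\<lambda>y. \<Sum>x | padic_residue x N = padic_residue x\<^sub>0 N \<and> g x = y. w x"
  define u where "u = (unif ^ N :: 'p padic_int)"
  have u: "u \<noteq> 0"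
    by (simp add: u_def unif_nonzero)
  have mem: "x \<in> ?B \<longleftrightarrow> u dvd x - x\<^sub>0" for x
    unfolding u_def unif_power_dvd_iff mem_Collect_eq by (rule padic_residue_eq_iff_diff)
  have memu: "x\<^sub>0 + u * z \<in> ?B" for z
    unfolding mem by simp
  have iso': "padic_norm (g (x\<^sub>0 + u * z) - g (x\<^sub>0 + u * z')) = k * padic_norm u * padic_norm (z - z')" for z z'
  proof -
    have "padic_norm (g (x\<^sub>0 + u * z) - g (x\<^sub>0 + u * z')) = k * padic_norm ((x\<^sub>0 + u * z) - (x\<^sub>0 + u * z'))"
      using memu[of z] memu[of z'] by (intro iso) auto
    also have "(x\<^sub>0 + u * z) - (x\<^sub>0 + u * z') = u * (z - z')"
      by (simp add: algebra_simps)
    finally show ?thesis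
      by (simp add: padic_norm_mult)
  qed
  \<comment> \<open>k is only a real number. Dilating the target takes an element of norm k * |u|,
    and the image of one step of length |u| supplies it.\<close>
  define e where "e = g (x\<^sub>0 + u * 1) - g (x\<^sub>0 + u * 0)"
  have norm_e: "padic_norm e = k * padic_norm u"
    unfolding e_def iso' by simp
  hence "padic_norm e > 0"
    using k u by simp
  hence e: "e \<noteq> 0"
    by auto
  define G where "G z = padic_div (g (x\<^sub>0 + u * z) - g x\<^sub>0) e" for z
  have eG: "e * G z = g (x\<^sub>0 + u * z) - g x\<^sub>0" for z
  proof -
    have "padic_norm (g (x\<^sub>0 + u * z) - g (x\<^sub>0 + u * 0)) \<le> padic_norm e"
      unfolding iso' norm_e using k padic_norm_le_1[of z] by (simp add: mult_left_le)
    hence "e dvd g (x\<^sub>0 + u * z) - g x\<^sub>0"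
      by (simp add: padic_dvd_iff_norm)
    thus ?thesis
      using e by (simp add: G_def)
  qed
  have G: "padic_isometry G"
  proof (rule padic_isometry_iff_norm)
    fix z z'
    have "e * (G z - G z') = g (x\<^sub>0 + u * z) - g (x\<^sub>0 + u * z')"
      unfolding right_diff_distrib eG by simp
    hence "padic_norm e * padic_norm (G z - G z') = padic_norm e * padic_norm (z - z')"
      unfolding padic_norm_mult[symmetric, of e] by (simp add: iso' norm_e padic_norm_mult)
    thus "padic_norm (G z - G z') = padic_norm (z - z')"
      using e by simp
  qed
  define H where "H = inv_into UNIV G"
  have H: "padic_isometry H"
    unfolding H_def by (rule padic_isometry_inv[OF G])
  have [measurable]: "H \<in> borel_measurable borel"
    by (rule borel_measurable_padic_isometry[OF H])
  have GH: "G (H t) = t" for t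
    unfolding H_def by (rule surj_f_inv_f[OF padic_isometry_surj[OF G]])
  have HG: "H (G z) = z" for z
    unfolding H_def by (rule inv_f_f[OF padic_isometry_inj[OF G]])
  define W where "W t = w (x\<^sub>0 + u * H t)" for t
  have W [measurable]: "W \<in> borel_measurable borel"
    unfolding W_def by measurable
  have S1: "?S (g x\<^sub>0 + e * t) = W t" for t
  proof -
    have "{x. padic_residue x N = padic_residue x\<^sub>0 N \<and> g x = g x\<^sub>0 + e * t} = {x\<^sub>0 + u * H t}"
    proof (intro equalityI subsetI)
      fix x
      assume x: "x \<in> {x. padic_residue x N = padic_residue x\<^sub>0 N \<and> g x = g x\<^sub>0 + e * t}"
      hence "u dvd x - x\<^sub>0"
        using mem[of x] by simp
      then obtain z where "x - x\<^sub>0 = u * z" ..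
      hence z: "x = x\<^sub>0 + u * z"
        by (simp add: algebra_simps)
      have "e * G z = e * t"
        unfolding eG z[symmetric] using x by simp
      hence "H t = z"
        using e HG by auto
      thus "x \<in> {x\<^sub>0 + u * H t}"
        using z by simp
    next
      fix x
      assume "x \<in> {x\<^sub>0 + u * H t}"
      thus "x \<in> {x. padic_residue x N = padic_residue x\<^sub>0 N \<and> g x = g x\<^sub>0 + e * t}"
        using eG[of "H t"] memu[of "H t"] by (simp add: GH)
    qed
    thus ?thesis
      by (simp add: W_def)
  qed
  \<comment> \<open>The image of the ball is the whole ball of radius |e| around
    \<open>g x\<^sub>0\<close>, so fibres over points outside it are empty.\<close>
  have S0: "?S y = 0" if "\<not> e dvd y - g x\<^sub>0" for y
  proof -
    have "g x \<noteq> y" if "padic_residue x N = padic_residue x\<^sub>0 N" for x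
    proof
      assume "g x = y"
      have "u dvd x - x\<^sub>0"
        using mem[of x] that by simp
      then obtain z where "x - x\<^sub>0 = u * z" ..
      hence "x = x\<^sub>0 + u * z"
        by (simp add: algebra_simps)
      hence "y - g x\<^sub>0 = e * G z"
        using \<open>g x = y\<close> eG[of z] by simp
      thus False
        using \<open>\<not> e dvd y - g x\<^sub>0\<close> by simp
    qed
    hence empty: "{x. padic_residue x N = padic_residue x\<^sub>0 N \<and> g x = y} = {}"
      by blast
    show ?thesis
      unfolding empty by simp
  qed
  define F where "F y = W (padic_div (y - g x\<^sub>0) e)" for y
  have [measurable]: "F \<in> borel_measurable borel"
    unfolding F_def by measurable
  have S: "?S y = F y * indicator {y. e dvd y - g x\<^sub>0} y" for y
  proof (cases "e dvd y - g x\<^sub>0")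
    case True
    then obtain t where "y - g x\<^sub>0 = e * t" ..
    hence "y = g x\<^sub>0 + e * t"
      by (simp add: algebra_simps)
    thus ?thesis
      using e S1[of t] by (simp add: F_def)
  next
    case False
    thus ?thesis using S0[of y] by simp
  qed
  have [measurable]: "{y. e dvd y - g x\<^sub>0} \<in> sets borel"
  proof -
    have "{y \<in> space borel. e dvd y - g x\<^sub>0} \<in> sets borel"
      by (rule sets_padic_dvd) measurable
    thus ?thesis by simp
  qed
  show "?S \<in> borel_measurable borel"
    unfolding S by measurable
  have "(\<integral>\<^sup>+y. ?S y \<partial>haar_measure) = ennreal (padic_norm e) * (\<integral>\<^sup>+t. F (g x\<^sub>0 + e * t) \<partial>haar_measure)"
    unfolding S by (rule nn_integral_padic_affine) (simp_all add: e)
  also have "(\<lambda>t. F (g x\<^sub>0 + e * t)) = W"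
    using e by (auto simp: F_def)
  also have "(\<integral>\<^sup>+t. W t \<partial>haar_measure) = (\<integral>\<^sup>+z. W (G z) \<partial>haar_measure)"
    by (rule nn_integral_padic_isometry[OF G, symmetric]) measurable
  also have "ennreal (padic_norm e) * \<dots> =
      ennreal k * (ennreal (padic_norm u) * (\<integral>\<^sup>+z. w (x\<^sub>0 + u * z) \<partial>haar_measure))"
    using k by (simp add: W_def HG norm_e ennreal_mult mult.assoc)
  also have "ennreal (padic_norm u) * (\<integral>\<^sup>+z. w (x\<^sub>0 + u * z) \<partial>haar_measure) =
      (\<integral>\<^sup>+x. w x * indicator {x. u dvd x - x\<^sub>0} x \<partial>haar_measure)"
    by (rule nn_integral_padic_affine[symmetric]) (simp_all add: u)
  also have "{x. u dvd x - x\<^sub>0} = ?B"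
    using mem by blast
  also have "ennreal k * (\<integral>\<^sup>+x. w x * indicator ?B x \<partial>haar_measure) =
      (\<integral>\<^sup>+x. ennreal k * w x * indicator ?B x \<partial>haar_measure)"
    by (subst nn_integral_cmult[symmetric])
       (simp_all add: mult.assoc measurable_cong_sets[OF sets_haar_padic refl])
  finally show "(\<integral>\<^sup>+x. ennreal k * w x * indicator ?B x \<partial>haar_measure) =
       (\<integral>\<^sup>+y. ?S y \<partial>haar_measure)" ..
qed

text \<open>\<kappa> plays the role of the absolute value of the derivative. D is exhausted by the
  points that are good at level N. Each stage is a finite disjoint union of balls, where
  \<open>nn_integral_area_ball\<close> applies, and monotone convergence passes to the limit on both
  sides.\<close>

lemma
  fixes g :: "'p::prime_card padic_int \<Rightarrow> 'p padic_int" and w :: "'p padic_int \<Rightarrow> ennreal"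
    and \<kappa> :: "'p padic_int \<Rightarrow> real"
  assumes w [measurable]: "w \<in> borel_measurable borel"
    and pos: "\<And>x. x \<in> D \<Longrightarrow> \<kappa> x > 0"
    and loc: "\<And>x. x \<in> D \<Longrightarrow> \<exists>N. \<forall>y z. padic_residue y N = padic_residue x N \<longrightarrow>
      padic_residue z N = padic_residue x N \<longrightarrow>
      y \<in> D \<and> \<kappa> y = \<kappa> x \<and> padic_norm (g y - g z) = \<kappa> x * padic_norm (y - z)"
    and fin: "\<And>y. finite {x \<in> D. g x = y}"
  shows padic_area_formula:
      "(\<integral>\<^sup>+x. ennreal (\<kappa> x) * w x * indicator D x \<partial>haar_measure) =
       (\<integral>\<^sup>+y. (\<Sum>x | x \<in> D \<and> g x = y. w x) \<partial>haar_measure)"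
    and borel_measurable_padic_fibre_sum:
      "(\<lambda>y. \<Sum>x | x \<in> D \<and> g x = y. w x) \<in> borel_measurable borel"
proof -
  let ?M = "haar_measure :: 'p padic_int measure"
  \<comment> \<open>Goodness at level N depends only on the class modulo p^N and persists at higher
    levels. So the good points form an increasing sequence of finite unions of classes, which also
    settles measurability.\<close>
  define good where "good N x \<longleftrightarrow> (\<forall>y z. padic_residue y N = padic_residue x N \<longrightarrow>
      padic_residue z N = padic_residue x N \<longrightarrow>
      y \<in> D \<and> \<kappa> y = \<kappa> x \<and> padic_norm (g y - g z) = \<kappa> x * padic_norm (y - z))" for N x
  have good_D: "x \<in> D" if "good N x" for N x
    using that unfolding good_def by blast
  have good_cong: "good N y" if "good N x" "padic_residue y N = padic_residue x N" for N x y
    using that unfolding good_def by metis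
  have good_mono: "good m x" if "good n x" "n \<le> m" for n m x
    using that(1) padic_residue_eq_mono[OF _ that(2)] unfolding good_def by metis
  have ex_good: "\<exists>N. good N x" if "x \<in> D" for x
    using loc[OF that] unfolding good_def .
  define R where "R N = {0..<int CARD('p) ^ N}" for N
  define ball where "ball N a = {x :: 'p padic_int. padic_residue x N = padic_residue (of_int a :: 'p padic_int) N}" for N a
  have ball_iff: "x \<in> ball N a \<longleftrightarrow> a = padic_residue x N" if "a \<in> R N" for x N a
    using that unfolding ball_def R_def by (auto simp: padic_residue_of_int)
  have res_R: "padic_residue x N \<in> R N" for x :: "'p padic_int" and N
    unfolding R_def by (simp add: padic_residue_range)
  define A where "A N = {a \<in> R N. good N (of_int a)}" for N
  have A_R: "a \<in> R N" if "a \<in> A N" for a N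
    using that by (simp add: A_def)
  have finA: "finite (A N)" for N
    by (rule finite_subset[of _ "R N"]) (auto simp: A_def R_def)
  have res_idem: "padic_residue (of_int (padic_residue x N) :: 'p padic_int) N = padic_residue x N"
    for N and x :: "'p padic_int"
    by (simp add: padic_residue_of_int padic_residue_compat)
  have good_iff: "good N x \<longleftrightarrow> padic_residue x N \<in> A N" for N and x :: "'p padic_int"
    unfolding A_def mem_Collect_eq using res_R[of x N] good_cong res_idem[of x N] by metis
  have good_ball: "good N x \<longleftrightarrow> (\<exists>a\<in>A N. x \<in> ball N a)" for N x
  proof
    assume "good N x"
    thus "\<exists>a\<in>A N. x \<in> ball N a"
      using good_iff[of N x] ball_iff[OF res_R[of x N], of x] by blast
  next
    assume "\<exists>a\<in>A N. x \<in> ball N a"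
    then obtain a where a: "a \<in> A N" "x \<in> ball N a" ..
    hence "a = padic_residue x N"
      using ball_iff[OF A_R[OF a(1)], of x] by blast
    thus "good N x"
      using a(1) unfolding good_iff by blast
  qed
  define L where "L N x = ennreal (\<kappa> x) * w x * indicator {x. good N x} x" for N x
  define S where "S N y = (\<Sum>x | good N x \<and> g x = y. w x)" for N y
  \<comment> \<open>On a good class \<kappa> is constant, so its value at the integer representative
    may be used.\<close>
  have L_eq: "L N x = (\<Sum>a\<in>A N. ennreal (\<kappa> (of_int a)) * w x * indicator (ball N a) x)" for N and x :: "'p padic_int"
  proof (cases "good N x")
    case True
    hence a: "padic_residue x N \<in> A N"
      by (simp add: good_iff)
    have "(\<Sum>a\<in>A N. ennreal (\<kappa> (of_int a)) * w x * indicator (ball N a) x) =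
      (\<Sum>a\<in>A N. if a = padic_residue x N then ennreal (\<kappa> (of_int a)) * w x else 0)"
      by (intro sum.cong) (auto simp: A_R ball_iff indicator_def)
    also have "\<dots> = ennreal (\<kappa> (of_int (padic_residue x N))) * w x"
      using finA a by simp
    also have "\<kappa> (of_int (padic_residue x N)) = \<kappa> x"
      using True res_idem[of x N] unfolding good_def by blast
    finally show ?thesis
      using True by (simp add: L_def)
  next
    case False
    hence "x \<notin> ball N a" if "a \<in> A N" for a
      using that good_ball[of N x] by blast
    thus ?thesis
      using False by (simp add: L_def)
  qed
  have S_eq: "S N y = (\<Sum>a\<in>A N. \<Sum>x | padic_residue x N = padic_residue (of_int a :: 'p padic_int) N \<and> g x = y. w x)" for N y
  proof -
    have un: "{x. good N x \<and> g x = y} = (\<Union>a\<in>A N. {x. x \<in> ball N a \<and> g x = y})"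
      by (auto simp: good_ball)
    have fi: "finite {x. x \<in> ball N a \<and> g x = y}" if "a \<in> A N" for a
    proof (rule finite_subset[OF _ fin[of y]])
      show "{x. x \<in> ball N a \<and> g x = y} \<subseteq> {x \<in> D. g x = y}"
        using that good_ball[of N] good_D by blast
    qed
    have disj: "a = b" if "a \<in> A N" "b \<in> A N" "x \<in> ball N a" "x \<in> ball N b" for a b x
      using that ball_iff[OF A_R, of a N x] ball_iff[OF A_R, of b N x] by simp
    have "S N y = sum w (\<Union>a\<in>A N. {x. x \<in> ball N a \<and> g x = y})"
      unfolding S_def un ..
    also have "\<dots> = (\<Sum>a\<in>A N. \<Sum>x | x \<in> ball N a \<and> g x = y. w x)"
    proof (rule sum.UNION_disjoint)
      show "\<forall>a\<in>A N. finite {x. x \<in> ball N a \<and> g x = y}"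
        using fi by blast
      show "\<forall>a\<in>A N. \<forall>b\<in>A N. a \<noteq> b \<longrightarrow> {x. x \<in> ball N a \<and> g x = y} \<inter> {x. x \<in> ball N b \<and> g x = y} = {}"
        using disj by blast
    qed (rule finA)
    finally show ?thesis
      by (simp only: ball_def mem_Collect_eq)
  qed
  have ball_eq: "(\<integral>\<^sup>+x. ennreal (\<kappa> (of_int a)) * w x * indicator (ball N a) x \<partial>?M) =
       (\<integral>\<^sup>+y. (\<Sum>x | padic_residue x N = padic_residue (of_int a :: 'p padic_int) N \<and> g x = y. w x) \<partial>?M)"
    and ball_meas: "(\<lambda>y. \<Sum>x | padic_residue x N = padic_residue (of_int a :: 'p padic_int) N \<and> g x = y. w x)
      \<in> borel_measurable borel"
    if "a \<in> A N" for a N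
  proof -
    have good: "good N (of_int a)"
      using that by (simp add: A_def)
    hence "padic_norm (g y - g z) = \<kappa> (of_int a) * padic_norm (y - z)"
      if "padic_residue y N = padic_residue (of_int a :: 'p padic_int) N"
        "padic_residue z N = padic_residue (of_int a :: 'p padic_int) N" for y z
      using that unfolding good_def by blast
    moreover have "\<kappa> (of_int a) > 0"
      using good_D[OF good] by (rule pos)
    ultimately show "(\<integral>\<^sup>+x. ennreal (\<kappa> (of_int a)) * w x * indicator (ball N a) x \<partial>?M) =
       (\<integral>\<^sup>+y. (\<Sum>x | padic_residue x N = padic_residue (of_int a :: 'p padic_int) N \<and> g x = y. w x) \<partial>?M)"
      "(\<lambda>y. \<Sum>x | padic_residue x N = padic_residue (of_int a :: 'p padic_int) N \<and> g x = y. w x)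
      \<in> borel_measurable borel"
      unfolding ball_def
      by (intro nn_integral_area_ball borel_measurable_area_ball w; blast)+
  qed
  have ball_sets: "ball N a \<in> sets borel" for N a
    unfolding ball_def by (rule sets_padic_residue_eq)
  have S_meas: "S N \<in> borel_measurable borel" for N
    unfolding S_eq[abs_def] by (intro borel_measurable_sum ball_meas)
  have term_meas: "(\<lambda>x. ennreal (\<kappa> (of_int a)) * w x * indicator (ball N a) x) \<in> borel_measurable borel" for N a
    using ball_sets[of N a] by measurable
  have L_meas: "L N \<in> borel_measurable borel" for N
    unfolding L_eq[abs_def] by (intro borel_measurable_sum term_meas)
  have LS: "(\<integral>\<^sup>+x. L N x \<partial>?M) = (\<integral>\<^sup>+y. S N y \<partial>?M)" for N
    unfolding L_eq S_eq using term_meas ball_meas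
    by (subst (1 2) nn_integral_sum)
       (simp_all add: ball_eq measurable_cong_sets[OF sets_haar_padic refl])
  have L_inc: "incseq L"
    unfolding incseq_Suc_iff le_fun_def L_def
    using good_mono by (auto intro!: mult_left_mono split: split_indicator)
  have fin_good: "finite {x. good N x \<and> g x = y}" for N y
    by (rule finite_subset[OF _ fin[of y]]) (use good_D in blast)
  have S_inc: "incseq S"
    unfolding incseq_Suc_iff le_fun_def S_def
    using good_mono fin_good by (intro allI sum_mono2) (auto intro: le_SucI)
  have L_sup: "(SUP N. L N x) = ennreal (\<kappa> x) * w x * indicator D x" for x
  proof (cases "x \<in> D")
    case True
    then obtain N where "good N x"
      using ex_good by blast
    show ?thesis
    proof (rule antisym)
      show "(SUP N. L N x) \<le> ennreal (\<kappa> x) * w x * indicator D x"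
        using True by (intro SUP_least) (auto simp: L_def split: split_indicator)
      show "ennreal (\<kappa> x) * w x * indicator D x \<le> (SUP N. L N x)"
        using True \<open>good N x\<close> by (intro SUP_upper2[of N]) (auto simp: L_def)
    qed
  next
    case False
    hence "L N x = 0" for N
      using good_D by (auto simp: L_def split: split_indicator)
    thus ?thesis
      using False by simp
  qed
  have S_sup: "(SUP N. S N y) = (\<Sum>x | x \<in> D \<and> g x = y. w x)" for y
  proof (rule antisym)
    show "(SUP N. S N y) \<le> (\<Sum>x | x \<in> D \<and> g x = y. w x)"
      unfolding S_def using fin good_D by (intro SUP_least sum_mono2) auto
    have "\<exists>f. \<forall>x\<in>D. good (f x) x"
      using ex_good by (intro bchoice) blast
    then obtain f where f: "\<And>x. x \<in> D \<Longrightarrow> good (f x) x"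
      by blast
    \<comment> \<open>Fibres are finite, so one level serves all points of the fibre at once;
      \<open>insert 0\<close> covers the empty fibre.\<close>
    define N where "N = Max (insert 0 (f ` {x \<in> D. g x = y}))"
    have "f x \<le> N" if "x \<in> D" "g x = y" for x
      unfolding N_def using fin[of y] that by (intro Max_ge) auto
    hence "{x \<in> D. g x = y} = {x. good N x \<and> g x = y}"
      using f good_mono good_D by blast
    hence "(\<Sum>x | x \<in> D \<and> g x = y. w x) = S N y"
      unfolding S_def by (rule sum.cong) simp
    thus "(\<Sum>x | x \<in> D \<and> g x = y. w x) \<le> (SUP N. S N y)"
      by (intro SUP_upper2[of N]) auto
  qed
  have "(\<lambda>y. SUP N. S N y) \<in> borel_measurable borel"
    using S_meas by (intro borel_measurable_SUP) auto
  thus "(\<lambda>y. \<Sum>x | x \<in> D \<and> g x = y. w x) \<in> borel_measurable borel"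
    by (simp only: S_sup)
  have "(\<integral>\<^sup>+x. (SUP N. L N x) \<partial>?M) = (SUP N. \<integral>\<^sup>+x. L N x \<partial>?M)"
    using L_meas L_inc
    by (intro nn_integral_monotone_convergence_SUP)
       (simp_all add: measurable_cong_sets[OF sets_haar_padic refl])
  also have "\<dots> = (SUP N. \<integral>\<^sup>+x. S N x \<partial>?M)"
    by (simp only: LS)
  also have "\<dots> = (\<integral>\<^sup>+x. (SUP N. S N x) \<partial>?M)"
    using S_meas S_inc
    by (intro nn_integral_monotone_convergence_SUP[symmetric])
       (simp_all add: measurable_cong_sets[OF sets_haar_padic refl])
  finally show "(\<integral>\<^sup>+x. ennreal (\<kappa> x) * w x * indicator D x \<partial>?M) =
       (\<integral>\<^sup>+y. (\<Sum>x | x \<in> D \<and> g x = y. w x) \<partial>?M)"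
    by (simp only: L_sup S_sup)
qed

section \<open>Flexes of \<open>y\<^sup>2 = x\<^sup>3 + a\<^sub>2 x\<^sup>2 + a\<^sub>4 x + a\<^sub>6\<close>\<close>

text \<open>Comparison of coefficients in x^3 + a2 x^2 + a4 x + a6 = (\<alpha> x + \<beta>)^2 + (x -
  r)^3.\<close>

definition flex_eqs :: "'a::comm_ring_1 \<Rightarrow> 'a \<Rightarrow> 'a \<Rightarrow> 'a \<Rightarrow> 'a \<Rightarrow> 'a \<Rightarrow> bool" where
  "flex_eqs a2 a4 a6 \<alpha> \<beta> r \<longleftrightarrow>
     a2 = \<alpha>\<^sup>2 - 3 * r \<and> a4 = 2 * \<alpha> * \<beta> + 3 * r\<^sup>2 \<and> a6 = \<beta>\<^sup>2 - r ^ 3"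

definition cubic_disc :: "'a::comm_ring_1 \<Rightarrow> 'a \<Rightarrow> 'a \<Rightarrow> 'a" where
  "cubic_disc a2 a4 a6 = a2\<^sup>2 * a4\<^sup>2 - 4 * a2 ^ 3 * a6 + 18 * a2 * a4 * a6 - 4 * a4 ^ 3 - 27 * a6\<^sup>2"

text \<open>In X = x - r the cubic becomes X^3 + (\<alpha> X + b)^2 with b = \<alpha> r + \<beta>,
  so its discriminant involves only \<alpha> and b.\<close>

lemma cubic_disc_flex:
  fixes \<alpha> :: "'a::idom"
  assumes "flex_eqs a2 a4 a6 \<alpha> \<beta> r"
  shows "cubic_disc a2 a4 a6 = (\<alpha> * r + \<beta>) ^ 3 * (4 * \<alpha> ^ 3 - 27 * (\<alpha> * r + \<beta>))"
proof -
  have a: "a2 = \<alpha>\<^sup>2 - 3 * r" "a4 = 2 * \<alpha> * \<beta> + 3 * r\<^sup>2" "a6 = \<beta>\<^sup>2 - r ^ 3"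
    using assms by (auto simp: flex_eqs_def)
  show ?thesis
    unfolding cubic_disc_def a by Groebner_Basis.algebra
qed

section \<open>Perturbing the slope while a2 and a4 stay fixed\<close>

lemma flex_pair_rho:
  fixes \<alpha> :: "'a::idom"
  assumes "\<alpha>\<^sup>2 - 3 * r = \<alpha>'\<^sup>2 - 3 * r'"
  shows "3 * (r' - r) = (\<alpha>' - \<alpha>) * (\<alpha> + \<alpha>')"
  using assms by Groebner_Basis.algebra

lemma flex_pair_delta:
  fixes \<alpha> :: "'a::idom"
  assumes "\<alpha>\<^sup>2 - 3 * r = \<alpha>'\<^sup>2 - 3 * r'" "2 * \<alpha> * \<beta> + 3 * r\<^sup>2 = 2 * \<alpha>' * \<beta>' + 3 * r'\<^sup>2"
  shows "2 * \<alpha>' * ((\<alpha>' * r + \<beta>') - (\<alpha> * r + \<beta>)) = - (2 * (\<alpha>' - \<alpha>) * (\<alpha> * r + \<beta>) + 3 * (r' - r)\<^sup>2)"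
  using assms by Groebner_Basis.algebra

text \<open>Linearization of a6 in the slope: the leading term -4 h b^2 divided by 2 \<alpha>' gives
  the derivative -2 b^2 / \<alpha>, hence the scaling factor |b^2 / \<alpha>|. The last bracket
  collects the error terms.\<close>

lemma flex_pair_a6:
  fixes \<alpha> :: "'a::idom"
  assumes "\<alpha>\<^sup>2 - 3 * r = \<alpha>'\<^sup>2 - 3 * r'" "2 * \<alpha> * \<beta> + 3 * r\<^sup>2 = 2 * \<alpha>' * \<beta>' + 3 * r'\<^sup>2"
    "h = \<alpha>' - \<alpha>" "b = \<alpha> * r + \<beta>" "\<delta> = (\<alpha>' * r + \<beta>') - b" "\<rho> = r' - r"
  shows "2 * \<alpha>' * ((\<beta>'\<^sup>2 - r' ^ 3) - (\<beta>\<^sup>2 - r ^ 3)) =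
    - 4 * (h * b\<^sup>2) - (2 * (h * b * \<delta>) + 3 * \<rho>\<^sup>2 * (\<delta> + 2 * b) + 2 * \<alpha>' * \<rho> ^ 3)"
  using assms by Groebner_Basis.algebra

text \<open>\<open>\<rho>\<close>, \<open>e\<close> describe the second flex relative to the first: the two flexes are at \<open>r\<close> and
  \<open>r + \<rho>\<close>, and \<open>e\<close> is the value at \<open>r\<close> of the second tangent line.\<close>

lemma flex_pair_iff:
  fixes \<alpha> :: "'a::{idom, ring_char_0}"
  assumes "flex_eqs a2 a4 a6 \<alpha> \<beta> r" "b = \<alpha> * r + \<beta>"
  shows "flex_eqs a2 a4 a6 \<alpha>' (e - \<alpha>' * r) (r + \<rho>) \<longleftrightarrow>
    \<alpha>'\<^sup>2 - \<alpha>\<^sup>2 = 3 * \<rho> \<and> 2 * \<alpha> * b - 2 * \<alpha>' * e = 3 * \<rho>\<^sup>2 \<and> e\<^sup>2 - b\<^sup>2 = \<rho> ^ 3"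
proof -
  have "2 * \<alpha> * \<beta> + 3 * r\<^sup>2 - (2 * \<alpha>' * (e - \<alpha>' * r) + 3 * (r + \<rho>)\<^sup>2) =
    (2 * \<alpha> * b - 2 * \<alpha>' * e - 3 * \<rho>\<^sup>2) + 2 * r * (\<alpha>'\<^sup>2 - \<alpha>\<^sup>2 - 3 * \<rho>)"
    unfolding assms(2) by (simp add: algebra_simps power2_eq_square)
  moreover have "\<beta>\<^sup>2 - r ^ 3 - ((e - \<alpha>' * r)\<^sup>2 - (r + \<rho>) ^ 3) =
    \<rho> ^ 3 - (e\<^sup>2 - b\<^sup>2) - r * (2 * \<alpha> * b - 2 * \<alpha>' * e - 3 * \<rho>\<^sup>2) - r\<^sup>2 * (\<alpha>'\<^sup>2 - \<alpha>\<^sup>2 - 3 * \<rho>)"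
    unfolding assms(2) by (simp add: algebra_simps power2_eq_square power3_eq_cube)
  ultimately show ?thesis
    using assms(1) unfolding flex_eqs_def by Groebner_Basis.algebra
qed

text \<open>If \<rho> is nonzero, dividing by \<rho>^2 produces a square root of -3. This is the
  trace of the Weil pairing: two independent rational points of order three force the cube roots of
  unity into the field.\<close>

lemma flex_pair_sqrt:
  fixes \<alpha> :: "'a::idom"
  assumes "\<alpha>'\<^sup>2 - \<alpha>\<^sup>2 = 3 * \<rho>" "2 * \<alpha> * b - 2 * \<alpha>' * e = 3 * \<rho>\<^sup>2" "e\<^sup>2 - b\<^sup>2 = \<rho> ^ 3"
  shows "(2 * (\<alpha> * e - \<alpha>' * b))\<^sup>2 = - 3 * (\<rho>\<^sup>2)\<^sup>2"
  using assms by Groebner_Basis.algebra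

text \<open>With \<omega> given, the second and third relations are linear in b and e. Eliminating e
  yields 6 b = - \<rho> (3 \<alpha> + \<omega> \<alpha>'), and inserting this exhibits 8 \<alpha>^3
  - 54 b as a cube.\<close>

lemma flex_pair_cube:
  fixes \<alpha> :: "'a::{idom, ring_char_0}"
  assumes "\<alpha>'\<^sup>2 - \<alpha>\<^sup>2 = 3 * \<rho>" "2 * \<alpha> * b - 2 * \<alpha>' * e = 3 * \<rho>\<^sup>2" "2 * (\<alpha> * e - \<alpha>' * b) = \<omega> * \<rho>\<^sup>2"
    and \<omega>: "\<omega>\<^sup>2 = -3" and "\<rho> \<noteq> 0"
  shows "(- (\<omega> * \<alpha>' + \<alpha>)) ^ 3 = 8 * \<alpha> ^ 3 - 54 * b"
proof -
  have "\<rho> * (6 * b + \<rho> * (3 * \<alpha> + \<omega> * \<alpha>')) = 0"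
    using assms(1-3) by Groebner_Basis.algebra
  hence "6 * b + \<rho> * (3 * \<alpha> + \<omega> * \<alpha>') = 0"
    using assms by simp
  thus ?thesis
    using assms(1) \<omega> by Groebner_Basis.algebra
qed

text \<open>Inverse of \<open>flex_pair_cube\<close>: there c = -(\<omega> \<alpha>' + \<alpha>),
  and multiplying by \<omega> solves for \<alpha>'. Then \<rho> comes from the first relation and e
  from eliminating b in the linear system; t2 and t3 are 1/2 and 1/3.\<close>

lemma flex_pair_of_cube:
  fixes \<alpha> :: "'a::{idom, ring_char_0}"
  assumes c: "c ^ 3 = 8 * \<alpha> ^ 3 - 54 * b" and \<omega>: "\<omega>\<^sup>2 = -3" and inv: "2 * t2 = 1" "3 * t3 = 1"
    and \<alpha>': "\<alpha>' = (c + \<alpha>) * \<omega> * t3" and \<rho>: "\<rho> = (\<alpha>'\<^sup>2 - \<alpha>\<^sup>2) * t3" and e: "e = - (\<rho> * (3 * \<alpha>' + \<omega> * \<alpha>) * t3 * t2)"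
  shows "\<alpha>'\<^sup>2 - \<alpha>\<^sup>2 = 3 * \<rho>" "2 * \<alpha> * b - 2 * \<alpha>' * e = 3 * \<rho>\<^sup>2" "e\<^sup>2 - b\<^sup>2 = \<rho> ^ 3"
    "6 * b = - (\<rho> * (3 * \<alpha> + \<omega> * \<alpha>'))"
proof -
  show 1: "\<alpha>'\<^sup>2 - \<alpha>\<^sup>2 = 3 * \<rho>"
    using inv \<rho> by Groebner_Basis.algebra
  have "\<omega> * \<alpha>' = - (c + \<alpha>)"
    using inv \<alpha>' \<omega> by Groebner_Basis.algebra
  hence "9 * (6 * b) = 9 * (- (\<rho> * (3 * \<alpha> + \<omega> * \<alpha>')))"
    using c 1 \<omega> by Groebner_Basis.algebra
  thus b: "6 * b = - (\<rho> * (3 * \<alpha> + \<omega> * \<alpha>'))"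
    by (subst (asm) mult_cancel_left) simp
  have e': "6 * e = - (\<rho> * (3 * \<alpha>' + \<omega> * \<alpha>))"
    using e inv by Groebner_Basis.algebra
  have "3 * (2 * \<alpha> * b - 2 * \<alpha>' * e) = 3 * (3 * \<rho>\<^sup>2)"
    using b e' 1 by Groebner_Basis.algebra
  thus "2 * \<alpha> * b - 2 * \<alpha>' * e = 3 * \<rho>\<^sup>2"
    by (subst (asm) mult_cancel_left) simp
  have "36 * (e\<^sup>2 - b\<^sup>2) = 36 * \<rho> ^ 3"
    using b e' 1 \<omega> by Groebner_Basis.algebra
  thus "e\<^sup>2 - b\<^sup>2 = \<rho> ^ 3"
    by (subst (asm) mult_cancel_left) simp
qed

text \<open>A, B, T, H, R are the norms of \<alpha>, b, 3, \<alpha>' - \<alpha> and r' - r. The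
  threshold T^2 A B^2 is chosen to force R < T B: a mere R < B would leave a factor 1 / T in the
  bound for the cubic error term.\<close>

lemma flex_real_estimates:
  fixes A B T H R :: real
  assumes A: "0 < A" "A \<le> 1" and B: "0 < B" "B \<le> 1" and T: "0 < T" "T \<le> 1" and H: "0 \<le> H" and R: "0 \<le> R"
    and TR: "T * R \<le> H * A" and HT: "H < T\<^sup>2 * A * B\<^sup>2"
  shows "R < B" "T * R\<^sup>2 \<le> H * B" "0 < H \<Longrightarrow> A * R ^ 3 < H * B\<^sup>2" "T * R \<le> H" "H * B < A * B"
proof -
  have HA: "H * A \<le> H"
    using A H by (simp add: mult_left_le)
  thus TRH: "T * R \<le> H"
    using TR by simp
  have "T\<^sup>2 * A * B\<^sup>2 \<le> T\<^sup>2 * 1 * B\<^sup>2"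
    using A by (intro mult_right_mono mult_left_mono) auto
  hence "T * R < T * (T * B\<^sup>2)"
    using TRH HT by (simp add: power2_eq_square)
  hence "R < T * B\<^sup>2"
    using T by simp
  also have "T * B\<^sup>2 \<le> T * B"
    using B T by (simp add: power2_eq_square)
  finally have RTB: "R < T * B" .
  also have "T * B \<le> B"
    using B T by simp
  finally show RB: "R < B" .
  have "T * R\<^sup>2 = (T * R) * R"
    by (simp add: power2_eq_square)
  also have "\<dots> \<le> H * B"
    using TRH RB H R by (intro mult_mono) auto
  finally show "T * R\<^sup>2 \<le> H * B" .
  show "A * R ^ 3 < H * B\<^sup>2" if "0 < H"
  proof -
    have "T * (A * R ^ 3) = A * ((T * R) * R\<^sup>2)"
      by (simp add: power2_eq_square power3_eq_cube)
    also have "\<dots> \<le> 1 * ((T * R) * R\<^sup>2)"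
      using A T R by (intro mult_right_mono) auto
    also have "\<dots> \<le> H * R\<^sup>2"
      using TRH by (simp add: mult_right_mono)
    also have "\<dots> < H * (T * B)\<^sup>2"
      using RTB R that by (intro mult_strict_left_mono power_strict_mono) auto
    also have "\<dots> = (T * T) * (H * B\<^sup>2)"
      by (simp add: power2_eq_square)
    also have "\<dots> \<le> T * (H * B\<^sup>2)"
      using T H by (intro mult_right_mono mult_left_le) auto
    finally show ?thesis
      using T by simp
  qed
  have "T\<^sup>2 * A * B\<^sup>2 \<le> 1 * A * 1"
    using A B T by (intro mult_mono power_le_one) auto
  thus "H * B < A * B"
    using HT B by simp
qed

text \<open>Slopes near \<alpha> still belong to integral data: the bound makes \<alpha>' - \<alpha>
  divisible by 3, which gives r', and makes |\<alpha>'| = |\<alpha>|, so that 2 \<alpha>' divides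
  the number that has to be 2 \<alpha>' \<beta>'.\<close>

lemma flex_pair_exists:
  fixes \<alpha> \<beta> r \<alpha>' :: "'p::prime_card padic_int"
  assumes n2: "padic_norm (2 :: 'p padic_int) = 1" and \<alpha>: "\<alpha> \<noteq> 0"
    and h: "padic_norm (\<alpha>' - \<alpha>) < padic_norm (3 :: 'p padic_int) * padic_norm \<alpha>"
  obtains \<beta>' r' where "\<alpha>\<^sup>2 - 3 * r = \<alpha>'\<^sup>2 - 3 * r'" "2 * \<alpha> * \<beta> + 3 * r\<^sup>2 = 2 * \<alpha>' * \<beta>' + 3 * r'\<^sup>2"
proof -
  have n3: "padic_norm (3 :: 'p padic_int) \<le> 1"
    by (rule padic_norm_le_1)
  have "padic_norm (3 :: 'p padic_int) * padic_norm \<alpha> \<le> 1 * padic_norm \<alpha>"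
    by (intro mult_right_mono n3) simp
  hence h\<alpha>: "padic_norm (\<alpha>' - \<alpha>) < padic_norm \<alpha>"
    using h by linarith
  hence n\<alpha>': "padic_norm \<alpha>' = padic_norm \<alpha>"
    by (intro padic_norm_eq_of_close) (simp add: padic_norm_diff_commute)
  have "padic_norm (3 :: 'p padic_int) * padic_norm \<alpha> \<le> padic_norm (3 :: 'p padic_int) * 1"
    by (intro mult_left_mono padic_norm_le_1) simp
  hence "padic_norm (\<alpha>' - \<alpha>) \<le> padic_norm (3 :: 'p padic_int)"
    using h by linarith
  hence "3 dvd (\<alpha>' - \<alpha>)"
    by (simp add: padic_dvd_iff_norm)
  hence "3 dvd (\<alpha>' - \<alpha>) * (\<alpha> + \<alpha>')"
    by simp
  then obtain \<rho> where \<rho>: "(\<alpha>' - \<alpha>) * (\<alpha> + \<alpha>') = 3 * \<rho>" ..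
  define q where "q = 2 * \<alpha> * \<beta> + 3 * r\<^sup>2 - 3 * (r + \<rho>)\<^sup>2"
  have "q = \<alpha> * (2 * \<beta>) - (\<alpha>' - \<alpha>) * ((\<alpha> + \<alpha>') * (2 * r + \<rho>))"
    using \<rho> unfolding q_def by Groebner_Basis.algebra
  moreover have "padic_norm (\<alpha> * (2 * \<beta>)) \<le> padic_norm \<alpha>"
    by (simp add: padic_norm_mult n2 mult_left_le padic_norm_le_1)
  moreover have "padic_norm ((\<alpha>' - \<alpha>) * ((\<alpha> + \<alpha>') * (2 * r + \<rho>))) \<le> padic_norm \<alpha>"
    unfolding padic_norm_mult[of "\<alpha>' - \<alpha>"]
    by (rule order_trans[OF mult_left_le[OF padic_norm_le_1]]) (use h\<alpha> in simp_all)
  ultimately have "padic_norm q \<le> padic_norm (2 * \<alpha>')"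
    by (simp add: padic_norm_diff_le' padic_norm_mult n2 n\<alpha>')
  hence "2 * \<alpha>' dvd q"
    by (simp add: padic_dvd_iff_norm)
  then obtain \<beta>' where \<beta>': "q = 2 * \<alpha>' * \<beta>'" ..
  show ?thesis
  proof (rule that)
    show "\<alpha>\<^sup>2 - 3 * r = \<alpha>'\<^sup>2 - 3 * (r + \<rho>)"
      using \<rho> by Groebner_Basis.algebra
    show "2 * \<alpha> * \<beta> + 3 * r\<^sup>2 = 2 * \<alpha>' * \<beta>' + 3 * (r + \<rho>)\<^sup>2"
      using \<beta>' unfolding q_def by (simp add: algebra_simps)
  qed
qed

text \<open>The last conclusion is the exact scaling that the area formula asks for; the first two
  keep its factor |b|^2 / |\<alpha>| constant. The third bounds the motion of b, in order to keep 4
  \<alpha>^3 - 27 b away from 0.\<close>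

lemma flex_pair_estimates:
  fixes \<alpha> \<beta> r \<alpha>' \<beta>' r' b b' :: "'p::prime_card padic_int"
  assumes n2: "padic_norm (2 :: 'p padic_int) = 1" and \<alpha>: "\<alpha> \<noteq> 0"
    and b: "b = \<alpha> * r + \<beta>" and b': "b' = \<alpha>' * r' + \<beta>'" and b0: "b \<noteq> 0"
    and h: "padic_norm (\<alpha>' - \<alpha>) < (padic_norm (3 :: 'p padic_int))\<^sup>2 * padic_norm \<alpha> * (padic_norm b)\<^sup>2"
    and eq: "\<alpha>\<^sup>2 - 3 * r = \<alpha>'\<^sup>2 - 3 * r'" "2 * \<alpha> * \<beta> + 3 * r\<^sup>2 = 2 * \<alpha>' * \<beta>' + 3 * r'\<^sup>2"
  shows "padic_norm \<alpha>' = padic_norm \<alpha>" "padic_norm b' = padic_norm b"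
    and "padic_norm (3 :: 'p padic_int) * padic_norm \<alpha> * padic_norm (b' - b) \<le> padic_norm (\<alpha>' - \<alpha>)"
    and "padic_norm \<alpha> * padic_norm ((\<beta>'\<^sup>2 - r' ^ 3) - (\<beta>\<^sup>2 - r ^ 3)) = padic_norm (\<alpha>' - \<alpha>) * (padic_norm b)\<^sup>2"
proof -
  define h where "h = \<alpha>' - \<alpha>"
  define \<rho> where "\<rho> = r' - r"
  define \<delta> where "\<delta> = (\<alpha>' * r + \<beta>') - b"
  define A where "A = padic_norm \<alpha>"
  define B where "B = padic_norm b"
  define T where "T = padic_norm (3 :: 'p padic_int)"
  define H where "H = padic_norm h"
  define R where "R = padic_norm \<rho>"
  have bounds: "0 < A" "A \<le> 1" "0 < B" "B \<le> 1" "0 < T" "T \<le> 1" "0 \<le> H" "0 \<le> R"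
    using \<alpha> b0 by (auto simp: A_def B_def T_def H_def R_def padic_norm_le_1)
  have HT: "H < T\<^sup>2 * A * B\<^sup>2"
    using \<open>padic_norm (\<alpha>' - \<alpha>) < _\<close> by (simp add: A_def B_def T_def H_def h_def)
  have "T\<^sup>2 * A * B\<^sup>2 \<le> 1 * A * 1"
    using bounds by (intro mult_mono power_le_one) auto
  hence "H < A"
    using HT by linarith
  hence n\<alpha>: "padic_norm \<alpha>' = A"
    unfolding A_def H_def h_def
    by (intro padic_norm_eq_of_close) (simp add: padic_norm_diff_commute)
  thus "padic_norm \<alpha>' = padic_norm \<alpha>"
    by (simp add: A_def)
  have "3 * \<rho> = h * (\<alpha> + \<alpha>')"
    unfolding \<rho>_def h_def by (rule flex_pair_rho[OF eq(1)])
  hence "T * R = H * padic_norm (\<alpha> + \<alpha>')"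
    unfolding T_def R_def H_def by (metis padic_norm_mult)
  also have "\<dots> \<le> H * A"
    using padic_norm_add_le'[of \<alpha> A \<alpha>'] n\<alpha> bounds by (intro mult_left_mono) (auto simp: A_def)
  finally have TR: "T * R \<le> H * A" .
  note est = flex_real_estimates[OF bounds TR HT]
  have "2 * \<alpha>' * \<delta> = - (2 * h * b + 3 * \<rho>\<^sup>2)"
    unfolding \<delta>_def h_def b \<rho>_def by (rule flex_pair_delta[OF eq])
  hence "A * padic_norm \<delta> = padic_norm (2 * h * b + 3 * \<rho>\<^sup>2)"
    by (metis n2 n\<alpha> padic_norm_minus padic_norm_mult mult_1)
  also have "\<dots> \<le> H * B"
    using est(2) by (intro padic_norm_add_le') (simp_all add: padic_norm_mult padic_norm_power n2 H_def B_def T_def R_def)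
  finally have A\<delta>: "A * padic_norm \<delta> \<le> H * B" .
  hence "A * padic_norm \<delta> < A * B"
    using est(5) by simp
  hence \<delta>B: "padic_norm \<delta> < B"
    using bounds by simp
  have b'b: "b' - b = \<delta> + \<alpha>' * \<rho>"
    unfolding b' \<delta>_def \<rho>_def by (simp add: algebra_simps)
  have \<alpha>\<rho>: "padic_norm (\<alpha>' * \<rho>) = A * R"
    by (simp add: padic_norm_mult n\<alpha> R_def)
  have "A * R \<le> R"
    using mult_right_mono[of A 1 R] bounds by simp
  hence "padic_norm (b' - b) < B"
    unfolding b'b using \<delta>B est(1) by (intro padic_norm_add_less) (simp_all add: \<alpha>\<rho>)
  thus "padic_norm b' = padic_norm b"
    unfolding B_def by (intro padic_norm_eq_of_close) (simp add: padic_norm_diff_commute)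
  have "H * B \<le> H"
    using bounds by (simp add: mult_left_le)
  hence 1: "T * A * padic_norm \<delta> \<le> H"
    using mult_mono[OF bounds(6) A\<delta>] bounds by (simp add: mult.assoc)
  have "T * A * (A * R) = (T * R) * (A * A)"
    by simp
  also have "\<dots> \<le> H * 1"
    using est(4) bounds by (intro mult_mono) (auto simp: mult_le_one)
  finally have 2: "T * A * (A * R) \<le> H"
    by simp
  have "padic_norm (b' - b) \<le> max (padic_norm \<delta>) (A * R)"
    unfolding b'b \<alpha>\<rho>[symmetric] by (rule padic_norm_add_le)
  hence "T * A * padic_norm (b' - b) \<le> T * A * max (padic_norm \<delta>) (A * R)"
    using bounds by (intro mult_left_mono) auto
  also have "\<dots> \<le> H"
    using 1 2 by (simp add: max_def)
  finally show "padic_norm (3 :: 'p padic_int) * padic_norm \<alpha> * padic_norm (b' - b) \<le> padic_norm (\<alpha>' - \<alpha>)"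
    by (simp add: T_def A_def H_def h_def)
  let ?E = "2 * (h * b * \<delta>) + 3 * \<rho>\<^sup>2 * (\<delta> + 2 * b) + 2 * \<alpha>' * \<rho> ^ 3"
  let ?\<Delta> = "(\<beta>'\<^sup>2 - r' ^ 3) - (\<beta>\<^sup>2 - r ^ 3)"
  have eqE: "2 * \<alpha>' * ?\<Delta> = - (2 * 2) * (h * b\<^sup>2) - ?E"
    using flex_pair_a6[OF eq h_def b \<delta>_def \<rho>_def] by simp
  show "padic_norm \<alpha> * padic_norm ?\<Delta> = padic_norm (\<alpha>' - \<alpha>) * (padic_norm b)\<^sup>2"
  proof (cases "h = 0")
    case True
    hence "T * R \<le> 0"
      using est(4) by (simp add: H_def)
    hence "R = 0"
      using bounds by (auto simp: mult_le_0_iff)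
    hence "\<rho> = 0"
      by (simp add: R_def)
    hence "2 * \<alpha>' * ?\<Delta> = 0"
      unfolding eqE True by simp
    moreover have "\<alpha>' \<noteq> 0"
      using n\<alpha> bounds by auto
    ultimately have "?\<Delta> = 0"
      by simp
    thus ?thesis
      using True unfolding h_def by simp
  next
    case False
    hence H0: "0 < H"
      by (simp add: H_def)
    \<comment> \<open>All error terms are strictly below |h b^2|, so the ultrametric inequality
      turns the linearization into an equality of norms.\<close>
    have "padic_norm ?E < H * B\<^sup>2"
    proof (intro padic_norm_add_less)
      have "H * B * padic_norm \<delta> < H * B * B"
        using H0 bounds \<delta>B by (intro mult_strict_left_mono) auto
      thus "padic_norm (2 * (h * b * \<delta>)) < H * B\<^sup>2"
        by (simp add: padic_norm_mult n2 H_def B_def power2_eq_square mult.assoc)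
      have "padic_norm (\<delta> + 2 * b) \<le> B"
        using \<delta>B by (intro padic_norm_add_le') (simp_all add: padic_norm_mult n2 B_def)
      hence "T * R\<^sup>2 * padic_norm (\<delta> + 2 * b) \<le> T * R\<^sup>2 * B"
        using bounds by (intro mult_left_mono) auto
      also have "T * R\<^sup>2 * B = (T * R) * (R * B)"
        by (simp add: power2_eq_square)
      also have "\<dots> \<le> H * (R * B)"
        using est(4) bounds by (intro mult_right_mono) auto
      also have "\<dots> < H * (B * B)"
        using H0 est(1) bounds by (intro mult_strict_left_mono mult_strict_right_mono) auto
      finally show "padic_norm (3 * \<rho>\<^sup>2 * (\<delta> + 2 * b)) < H * B\<^sup>2"
        by (simp add: padic_norm_mult padic_norm_power T_def R_def power2_eq_square)
      show "padic_norm (2 * \<alpha>' * \<rho> ^ 3) < H * B\<^sup>2"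
        using est(3)[OF H0] by (simp add: padic_norm_mult padic_norm_power n2 n\<alpha> R_def)
    qed
    hence "padic_norm (- ?E) < padic_norm (- (2 * 2) * (h * b\<^sup>2))"
      unfolding padic_norm_minus by (simp only: padic_norm_mult padic_norm_power n2 padic_norm_minus H_def B_def mult_1)
    from padic_norm_add_eq[OF this]
    have "padic_norm (2 * \<alpha>' * ?\<Delta>) = H * B\<^sup>2"
      unfolding eqE
      by (simp only: diff_conv_add_uminus padic_norm_mult padic_norm_power n2 padic_norm_minus H_def B_def mult_1)
    thus ?thesis
      by (simp add: padic_norm_mult n2 n\<alpha> A_def H_def h_def B_def)
  qed
qed

text \<open>For \<open>\<alpha> \<noteq> 0\<close> the coefficients \<open>a\<^sub>2\<close> and \<open>a\<^sub>4\<close> determine the flex with slope \<open>\<alpha>\<close>, and then \<open>a\<^sub>6\<close>.\<close>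

definition flex_r :: "'p::prime_card padic_int \<Rightarrow> 'p padic_int \<Rightarrow> 'p padic_int" where
  "flex_r a2 \<alpha> = padic_div (\<alpha>\<^sup>2 - a2) 3"

definition flex_\<beta> :: "'p::prime_card padic_int \<Rightarrow> 'p padic_int \<Rightarrow> 'p padic_int \<Rightarrow> 'p padic_int" where
  "flex_\<beta> a2 a4 \<alpha> = padic_div (a4 - 3 * (flex_r a2 \<alpha>)\<^sup>2) (2 * \<alpha>)"

definition flex_b :: "'p::prime_card padic_int \<Rightarrow> 'p padic_int \<Rightarrow> 'p padic_int \<Rightarrow> 'p padic_int" where
  "flex_b a2 a4 \<alpha> = \<alpha> * flex_r a2 \<alpha> + flex_\<beta> a2 a4 \<alpha>"

definition flex_a6 :: "'p::prime_card padic_int \<Rightarrow> 'p padic_int \<Rightarrow> 'p padic_int \<Rightarrow> 'p padic_int" where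
  "flex_a6 a2 a4 \<alpha> = (flex_\<beta> a2 a4 \<alpha>)\<^sup>2 - flex_r a2 \<alpha> ^ 3"

definition flex_dom :: "'p::prime_card padic_int \<Rightarrow> 'p padic_int \<Rightarrow> 'p padic_int set" where
  "flex_dom a2 a4 = {\<alpha>. \<alpha> \<noteq> 0 \<and> 3 dvd \<alpha>\<^sup>2 - a2 \<and> 2 * \<alpha> dvd a4 - 3 * (flex_r a2 \<alpha>)\<^sup>2 \<and>
     flex_b a2 a4 \<alpha> \<noteq> 0 \<and> 4 * \<alpha> ^ 3 - 27 * flex_b a2 a4 \<alpha> \<noteq> 0}"

lemma flex_r_eq: "a2 = \<alpha>\<^sup>2 - 3 * r \<Longrightarrow> flex_r a2 \<alpha> = r"
  for r :: "'p::prime_card padic_int"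
  by (simp add: flex_r_def)

lemma flex_\<beta>_eq: "\<alpha> \<noteq> 0 \<Longrightarrow> a2 = \<alpha>\<^sup>2 - 3 * r \<Longrightarrow> a4 = 2 * \<alpha> * \<beta> + 3 * r\<^sup>2 \<Longrightarrow> flex_\<beta> a2 a4 \<alpha> = \<beta>"
  for r :: "'p::prime_card padic_int"
  by (simp add: flex_\<beta>_def flex_r_eq)

lemma flex_r_\<beta>_eqs:
  assumes "\<alpha> \<in> flex_dom a2 a4"
  shows "a2 = \<alpha>\<^sup>2 - 3 * flex_r a2 \<alpha>" "a4 = 2 * \<alpha> * flex_\<beta> a2 a4 \<alpha> + 3 * (flex_r a2 \<alpha>)\<^sup>2"
proof -
  have *: "\<alpha> \<noteq> 0" "3 dvd \<alpha>\<^sup>2 - a2" "2 * \<alpha> dvd a4 - 3 * (flex_r a2 \<alpha>)\<^sup>2"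
    using assms by (auto simp: flex_dom_def)
  have "3 * flex_r a2 \<alpha> = \<alpha>\<^sup>2 - a2"
    unfolding flex_r_def using *(2) by (intro mult_padic_div) auto
  thus "a2 = \<alpha>\<^sup>2 - 3 * flex_r a2 \<alpha>"
    by simp
  have "2 * \<alpha> * flex_\<beta> a2 a4 \<alpha> = a4 - 3 * (flex_r a2 \<alpha>)\<^sup>2"
    unfolding flex_\<beta>_def using *(1,3) by (intro mult_padic_div) auto
  thus "a4 = 2 * \<alpha> * flex_\<beta> a2 a4 \<alpha> + 3 * (flex_r a2 \<alpha>)\<^sup>2"
    by simp
qed

lemma flex_domI:
  assumes "\<alpha> \<noteq> 0" "a2 = \<alpha>\<^sup>2 - 3 * r" "a4 = 2 * \<alpha> * \<beta> + 3 * r\<^sup>2"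
    "\<alpha> * r + \<beta> \<noteq> 0" "4 * \<alpha> ^ 3 - 27 * (\<alpha> * r + \<beta>) \<noteq> 0"
  shows "\<alpha> \<in> flex_dom a2 a4"
  unfolding flex_dom_def flex_b_def using assms flex_r_eq[OF assms(2)] flex_\<beta>_eq[OF assms(1-3)]
  by simp

text \<open>The two inequations in \<open>flex_dom\<close> say together that the discriminant b^3 (4
  \<alpha>^3 - 27 b) is nonzero.\<close>

lemma flex_dom_a6_iff:
  "\<alpha> \<in> flex_dom a2 a4 \<and> flex_a6 a2 a4 \<alpha> = a6 \<longleftrightarrow>
     \<alpha> \<noteq> 0 \<and> cubic_disc a2 a4 a6 \<noteq> 0 \<and> (\<exists>\<beta> r. flex_eqs a2 a4 a6 \<alpha> \<beta> r)"
  (is "?L \<longleftrightarrow> ?R")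
proof
  assume L: ?L
  have "flex_eqs a2 a4 a6 \<alpha> (flex_\<beta> a2 a4 \<alpha>) (flex_r a2 \<alpha>)"
    unfolding flex_eqs_def using L flex_r_\<beta>_eqs[of \<alpha> a2 a4] by (simp add: flex_a6_def)
  thus ?R
    using L cubic_disc_flex[of a2 a4 a6 \<alpha> "flex_\<beta> a2 a4 \<alpha>" "flex_r a2 \<alpha>"]
    by (auto simp: flex_dom_def flex_b_def)
next
  assume ?R
  then obtain \<beta> r where *: "\<alpha> \<noteq> 0" "cubic_disc a2 a4 a6 \<noteq> 0" "flex_eqs a2 a4 a6 \<alpha> \<beta> r"
    by blast
  hence "a2 = \<alpha>\<^sup>2 - 3 * r" "a4 = 2 * \<alpha> * \<beta> + 3 * r\<^sup>2" "a6 = \<beta>\<^sup>2 - r ^ 3"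
    by (auto simp: flex_eqs_def)
  moreover have "\<alpha> * r + \<beta> \<noteq> 0" "4 * \<alpha> ^ 3 - 27 * (\<alpha> * r + \<beta>) \<noteq> 0"
    using * cubic_disc_flex[of a2 a4 a6 \<alpha> \<beta> r] by auto
  ultimately show ?L
    using * flex_domI flex_r_eq flex_\<beta>_eq unfolding flex_a6_def by metis
qed

lemma flex_dom_locally_scaling:
  fixes a2 a4 x :: "'p::prime_card padic_int"
  assumes n2: "padic_norm (2 :: 'p padic_int) = 1" and x: "x \<in> flex_dom a2 a4"
  shows "\<exists>N. \<forall>y z. padic_residue y N = padic_residue x N \<longrightarrow> padic_residue z N = padic_residue x N \<longrightarrow>
    y \<in> flex_dom a2 a4 \<and>
    (padic_norm (flex_b a2 a4 y))\<^sup>2 / padic_norm y = (padic_norm (flex_b a2 a4 x))\<^sup>2 / padic_norm x \<and>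
    padic_norm (flex_a6 a2 a4 y - flex_a6 a2 a4 z) =
      (padic_norm (flex_b a2 a4 x))\<^sup>2 / padic_norm x * padic_norm (y - z)"
proof -
  let ?T = "padic_norm (3 :: 'p padic_int)"
  define b where "b = flex_b a2 a4 x"
  define q where "q = 4 * x ^ 3 - 27 * b"
  have nz: "x \<noteq> 0" "b \<noteq> 0" "q \<noteq> 0"
    using x by (auto simp: flex_dom_def b_def q_def)
  have T: "0 < ?T" "?T \<le> 1"
    by (auto simp: padic_norm_le_1)
  \<comment> \<open>The first bound is the one of the pair estimates. The second keeps q = 4 x^3 -
    27 b from being cancelled by the motion of x and b.\<close>
  define \<epsilon> where "\<epsilon> = min (?T\<^sup>2 * padic_norm x * (padic_norm b)\<^sup>2) (?T * padic_norm x * padic_norm q)"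
  have "0 < \<epsilon>"
    using nz by (simp add: \<epsilon>_def)
  then obtain N where N: "1 / real CARD('p) ^ N < \<epsilon>"
    using ex_inverse_CARD_power_less[where 'p = 'p] by blast
  have near: "\<exists>\<beta>' r'. a2 = y\<^sup>2 - 3 * r' \<and> a4 = 2 * y * \<beta>' + 3 * r'\<^sup>2"
    if u: "u \<in> flex_dom a2 a4" and "padic_norm (y - u) < ?T\<^sup>2 * padic_norm u * (padic_norm (flex_b a2 a4 u))\<^sup>2" for u y
  proof -
    have "?T\<^sup>2 * padic_norm u * (padic_norm (flex_b a2 a4 u))\<^sup>2 \<le> ?T\<^sup>2 * padic_norm u * 1"
      by (intro mult_left_mono power_le_one padic_norm_le_1) auto
    also have "\<dots> = ?T * (?T * padic_norm u)"
      by (simp add: power2_eq_square)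
    also have "\<dots> \<le> 1 * (?T * padic_norm u)"
      by (intro mult_right_mono T) auto
    finally have d: "padic_norm (y - u) < ?T * padic_norm u"
      using that by linarith
    have "u \<noteq> 0"
      using u by (simp add: flex_dom_def)
    then obtain \<beta>' r' where *: "u\<^sup>2 - 3 * flex_r a2 u = y\<^sup>2 - 3 * r'"
      "2 * u * flex_\<beta> a2 a4 u + 3 * (flex_r a2 u)\<^sup>2 = 2 * y * \<beta>' + 3 * r'\<^sup>2"
      by (rule flex_pair_exists[OF n2 _ d])
    show ?thesis
      using trans[OF flex_r_\<beta>_eqs(1)[OF u] *(1)] trans[OF flex_r_\<beta>_eqs(2)[OF u] *(2)] by blast
  qed
  have dom: "y \<in> flex_dom a2 a4 \<and> padic_norm y = padic_norm x \<and> padic_norm (flex_b a2 a4 y) = padic_norm b"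
    if y: "padic_residue y N = padic_residue x N" for y
  proof -
    have d: "padic_norm (y - x) < \<epsilon>"
      using y N unfolding padic_residue_eq_iff_norm by linarith
    hence d1: "padic_norm (y - x) < ?T\<^sup>2 * padic_norm x * (padic_norm b)\<^sup>2"
      and d2: "padic_norm (y - x) < ?T * padic_norm x * padic_norm q"
      by (auto simp: \<epsilon>_def)
    obtain \<beta>' r' where e: "a2 = y\<^sup>2 - 3 * r'" "a4 = 2 * y * \<beta>' + 3 * r'\<^sup>2"
      using near[OF x] d1 unfolding b_def by blast
    define b' where "b' = y * r' + \<beta>'"
    note est = flex_pair_estimates[OF n2 nz(1) b_def[unfolded flex_b_def] b'_def nz(2) d1
        trans[OF flex_r_\<beta>_eqs(1)[OF x, symmetric] e(1)] trans[OF flex_r_\<beta>_eqs(2)[OF x, symmetric] e(2)]]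
    have y0: "y \<noteq> 0"
      using est(1) nz by auto
    have b0: "b' \<noteq> 0"
      using est(2) nz by auto
    have "4 * y ^ 3 - 27 * b' \<noteq> 0"
    proof
      assume 0: "4 * y ^ 3 - 27 * b' = 0"
      \<comment> \<open>If the new value vanished, q would be the difference of the two values,
        whose norm times |3 x| is at most |y - x|.\<close>
      have "q = 4 * (x\<^sup>2 + x * y + y\<^sup>2) * (x - y) + 27 * (b' - b)"
        using 0 unfolding q_def by Groebner_Basis.algebra
      moreover have "?T * padic_norm x * padic_norm (4 * (x\<^sup>2 + x * y + y\<^sup>2) * (x - y)) \<le> padic_norm (y - x)"
      proof -
        have "?T * padic_norm x * padic_norm (4 * (x\<^sup>2 + x * y + y\<^sup>2)) \<le> 1 * 1 * 1"
          using T by (intro mult_mono) (auto simp: padic_norm_le_1)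
        hence "?T * padic_norm x * padic_norm (4 * (x\<^sup>2 + x * y + y\<^sup>2)) * padic_norm (x - y) \<le> 1 * padic_norm (x - y)"
          by (intro mult_right_mono) auto
        thus ?thesis
          by (simp add: padic_norm_mult padic_norm_diff_commute mult.assoc)
      qed
      moreover have "?T * padic_norm x * padic_norm (27 * (b' - b)) \<le> padic_norm (y - x)"
      proof -
        have "padic_norm (27 * (b' - b)) \<le> padic_norm (b' - b)"
          unfolding padic_norm_mult using mult_right_mono[OF padic_norm_le_1, of "padic_norm (b' - b)" 27] by simp
        hence "?T * padic_norm x * padic_norm (27 * (b' - b)) \<le> ?T * padic_norm x * padic_norm (b' - b)"
          using T by (intro mult_left_mono) auto
        thus ?thesis using est(3) by linarith
      qed
      ultimately have "?T * padic_norm x * padic_norm q \<le> padic_norm (y - x)"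
        using padic_norm_add_le[of "4 * (x\<^sup>2 + x * y + y\<^sup>2) * (x - y)" "27 * (b' - b)"]
        by (smt (verit) max_def mult_left_mono mult_nonneg_nonneg padic_norm_nonneg)
      thus False
        using d2 by linarith
    qed
    hence "y \<in> flex_dom a2 a4"
      using flex_domI[OF y0 e] b0 unfolding b'_def by blast
    moreover have "flex_b a2 a4 y = b'"
      unfolding flex_b_def b'_def flex_r_eq[OF e(1)] flex_\<beta>_eq[OF y0 e] ..
    ultimately show ?thesis
      using est by simp
  qed
  have iso: "padic_norm (flex_a6 a2 a4 y - flex_a6 a2 a4 z) = (padic_norm b)\<^sup>2 / padic_norm x * padic_norm (y - z)"
    if y: "padic_residue y N = padic_residue x N" and z: "padic_residue z N = padic_residue x N" for y z
  proof -
    have "padic_residue z N = padic_residue y N"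
      using y z by simp
    hence "padic_norm (z - y) < \<epsilon>"
      using N unfolding padic_residue_eq_iff_norm by linarith
    hence d1: "padic_norm (z - y) < ?T\<^sup>2 * padic_norm y * (padic_norm (flex_b a2 a4 y))\<^sup>2"
      using dom[OF y] by (simp add: \<epsilon>_def)
    have yD: "y \<in> flex_dom a2 a4" and zD: "z \<in> flex_dom a2 a4"
      using dom[OF y] dom[OF z] by auto
    hence nzy: "y \<noteq> 0" "flex_b a2 a4 y \<noteq> 0"
      by (auto simp: flex_dom_def)
    have "padic_norm y * padic_norm (flex_a6 a2 a4 z - flex_a6 a2 a4 y) =
      padic_norm (z - y) * (padic_norm (flex_b a2 a4 y))\<^sup>2"
      unfolding flex_a6_def
      by (rule flex_pair_estimates(4)[OF n2 nzy(1) flex_b_def refl nzy(2) d1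
        trans[OF flex_r_\<beta>_eqs(1)[OF yD, symmetric] flex_r_\<beta>_eqs(1)[OF zD]]
        trans[OF flex_r_\<beta>_eqs(2)[OF yD, symmetric] flex_r_\<beta>_eqs(2)[OF zD]]])
    thus ?thesis
      using dom[OF y] nz padic_norm_diff_commute[of z y] padic_norm_diff_commute[of "flex_a6 a2 a4 z"]
      by (simp add: field_simps)
  qed
  show ?thesis
  proof (intro exI[of _ N] allI impI conjI)
    fix y z :: "'p padic_int"
    assume y: "padic_residue y N = padic_residue x N" and z: "padic_residue z N = padic_residue x N"
    show "y \<in> flex_dom a2 a4"
      using dom[OF y] ..
    show "(padic_norm (flex_b a2 a4 y))\<^sup>2 / padic_norm y = (padic_norm (flex_b a2 a4 x))\<^sup>2 / padic_norm x"
      using dom[OF y] unfolding b_def by presburger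
    show "padic_norm (flex_a6 a2 a4 y - flex_a6 a2 a4 z) =
      (padic_norm (flex_b a2 a4 x))\<^sup>2 / padic_norm x * padic_norm (y - z)"
      using iso[OF y z] unfolding b_def .
  qed
qed

section \<open>Counting the flexes of a cubic\<close>

lemma padic_norm_3: "padic_norm (3 :: 'p::prime_card padic_int) = (if CARD('p) = 3 then 1 / 3 else 1)"
proof (cases "CARD('p) = 3")
  case True
  hence "(3 :: 'p padic_int) = unif"
    by (simp add: unif_def)
  thus ?thesis
    using True padic_norm_unif[where 'p = 'p] by simp
next
  case False
  have "Factorial_Ring.prime (3 :: nat)" "Factorial_Ring.prime CARD('p)"
    using prime_card[where 'a = 'p] by simp_all
  hence "coprime 3 CARD('p)"
    using False by (metis primes_coprime)
  thus ?thesis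
    using False padic_norm_numeral_eq_1[of "num.Bit1 num.One", where 'p = 'p] by simp
qed

lemma padic_norm_2:
  assumes "CARD('p::prime_card) \<ge> 3"
  shows "padic_norm (2 :: 'p padic_int) = 1"
proof -
  have "Factorial_Ring.prime (2 :: nat)" "Factorial_Ring.prime CARD('p)" "CARD('p) \<noteq> 2"
    using prime_card[where 'a = 'p] assms by simp_all
  hence "coprime 2 CARD('p)"
    by (metis primes_coprime)
  thus ?thesis
    using padic_norm_numeral_eq_1[of "num.Bit0 num.One", where 'p = 'p] by simp
qed

text \<open>Squares have even valuation. At p = 3 this excludes a square root of -3, and later a
  flex with non-integral r.\<close>

lemma padic_norm_power2_neq: "(padic_norm x)\<^sup>2 \<noteq> 1 / real CARD('p)" for x :: "'p::prime_card padic_int"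
proof
  assume *: "(padic_norm x)\<^sup>2 = 1 / real CARD('p)"
  have q: "1 < real CARD('p)"
    using CARD_prime_gt_1[where 'p = 'p] by simp
  hence "x \<noteq> 0"
    using * by auto
  then obtain n where n: "padic_norm x = 1 / real CARD('p) ^ n"
    by (auto intro: unif_unit_factorE)
  have "real CARD('p) ^ (2 * n) = real CARD('p) ^ 1"
    using * q unfolding n by (simp add: power_mult[symmetric] power_one_over field_simps)
  hence "2 * n = 1"
    using q by (subst (asm) power_inject_exp) auto
  thus False
    by presburger
qed

lemma CARD_neq_3_of_sqrt_minus_3:
  fixes \<omega> :: "'p::prime_card padic_int"
  assumes "\<omega>\<^sup>2 = -3"
  shows "CARD('p) \<noteq> 3"
proof
  assume 3: "CARD('p) = 3"
  have "(padic_norm \<omega>)\<^sup>2 = 1 / 3"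
    using assms padic_norm_3[where 'p = 'p] 3 by (metis padic_norm_minus padic_norm_power)
  thus False
    using padic_norm_power2_neq[of \<omega>] 3 by simp
qed

text \<open>Criterion, in terms of a single flex, for all eight nonzero points of order three to be
  rational; see \<open>card_flexes\<close>.\<close>

definition flex_special :: "'p::prime_card padic_int \<Rightarrow> 'p padic_int \<Rightarrow> bool" where
  "flex_special \<alpha> b \<longleftrightarrow> (\<exists>\<omega> :: 'p padic_int. \<omega>\<^sup>2 = -3) \<and> (\<exists>c. c ^ 3 = 8 * \<alpha> ^ 3 - 54 * b)"

lemma flex_eqs_uminus: "flex_eqs a2 a4 a6 \<alpha> \<beta> r \<Longrightarrow> flex_eqs a2 a4 a6 (- \<alpha>) (- \<beta>) r"
  by (simp add: flex_eqs_def)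

lemma flex_eqs_cases:
  fixes \<alpha> :: "'p::prime_card padic_int"
  assumes "flex_eqs a2 a4 a6 \<alpha> \<beta> r" "flex_eqs a2 a4 a6 \<alpha>' \<beta>' r'"
  shows "\<alpha>' = \<alpha> \<or> \<alpha>' = - \<alpha> \<or>
    (\<exists>c \<omega>. \<omega>\<^sup>2 = -3 \<and> c ^ 3 = 8 * \<alpha> ^ 3 - 54 * (\<alpha> * r + \<beta>) \<and> 3 * \<alpha>' = (c + \<alpha>) * \<omega>)"
proof -
  define b where "b = \<alpha> * r + \<beta>"
  define \<rho> where "\<rho> = r' - r"
  define e where "e = \<beta>' + \<alpha>' * r"
  have "flex_eqs a2 a4 a6 \<alpha>' (e - \<alpha>' * r) (r + \<rho>)"
    using assms(2) by (simp add: e_def \<rho>_def)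
  hence eqs: "\<alpha>'\<^sup>2 - \<alpha>\<^sup>2 = 3 * \<rho>" "2 * \<alpha> * b - 2 * \<alpha>' * e = 3 * \<rho>\<^sup>2" "e\<^sup>2 - b\<^sup>2 = \<rho> ^ 3"
    using flex_pair_iff[OF assms(1) b_def] by auto
  show ?thesis
  proof (cases "\<rho> = 0")
    case True
    hence "\<alpha>'\<^sup>2 = \<alpha>\<^sup>2"
      using eqs(1) by simp
    thus ?thesis
      by (auto simp: power2_eq_iff)
  next
    case False
    define x where "x = 2 * (\<alpha> * e - \<alpha>' * b)"
    have x: "x\<^sup>2 = -3 * (\<rho>\<^sup>2)\<^sup>2"
      unfolding x_def by (rule flex_pair_sqrt[OF eqs])
    \<comment> \<open>From x^2 = -3 \<rho>^4 follows |x| \<le> |\<rho>^2|, so the quotient x /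
      \<rho>^2 is an integral square root of -3.\<close>
    have "(padic_norm x)\<^sup>2 = padic_norm (3 :: 'p padic_int) * (padic_norm (\<rho>\<^sup>2))\<^sup>2"
      unfolding padic_norm_power[symmetric] x padic_norm_mult padic_norm_minus ..
    also have "\<dots> \<le> (padic_norm (\<rho>\<^sup>2))\<^sup>2"
      by (simp add: mult_left_le_one_le padic_norm_le_1)
    finally have "\<rho>\<^sup>2 dvd x"
      unfolding padic_dvd_iff_norm by (rule power2_le_imp_le) simp
    then obtain \<omega> where \<omega>: "x = \<omega> * \<rho>\<^sup>2"
      by (metis dvdE mult.commute)
    have "\<omega>\<^sup>2 * (\<rho>\<^sup>2)\<^sup>2 = -3 * (\<rho>\<^sup>2)\<^sup>2"
      using x unfolding \<omega> by (simp add: power_mult_distrib)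
    hence \<omega>2: "\<omega>\<^sup>2 = -3"
      using False by (subst (asm) mult_cancel_right) simp
    have "(- (\<omega> * \<alpha>' + \<alpha>)) ^ 3 = 8 * \<alpha> ^ 3 - 54 * b"
      by (rule flex_pair_cube[OF eqs(1,2) \<omega>[unfolded x_def] \<omega>2 False])
    moreover have "3 * \<alpha>' = (- (\<omega> * \<alpha>' + \<alpha>) + \<alpha>) * \<omega>"
      using \<omega>2 by Groebner_Basis.algebra
    ultimately show ?thesis
      using \<omega>2 unfolding b_def by blast
  qed
qed

lemma ex_padic_inverse:
  fixes x :: "'p::prime_card padic_int"
  assumes "padic_norm x = 1"
  obtains y where "x * y = 1"
  using assms by (metis dvdE padic_unit_iff_norm)

lemma cube_roots:
  fixes c \<omega> t2 :: "'a::{idom, ring_char_0}"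
  assumes \<omega>: "\<omega>\<^sup>2 = -3" and t2: "2 * t2 = 1" and c: "c \<noteq> 0"
  shows "finite {x. x ^ 3 = c ^ 3}" "card {x. x ^ 3 = c ^ 3} = 3"
proof -
  \<comment> \<open>A primitive cube root of unity, as t2 is 1/2.\<close>
  define \<zeta> where "\<zeta> = (\<omega> - 1) * t2"
  have \<zeta>: "\<zeta>\<^sup>2 + \<zeta> + 1 = 0"
    using \<omega> t2 unfolding \<zeta>_def by Groebner_Basis.algebra
  have \<zeta>3: "\<zeta> ^ 3 = 1"
    using \<zeta> by Groebner_Basis.algebra
  have \<zeta>1: "\<zeta> \<noteq> 1" and \<zeta>0: "\<zeta> \<noteq> 0"
    using \<zeta> by auto
  have "\<zeta>\<^sup>2 \<noteq> 1"
    using \<zeta>3 \<zeta>1 by (metis mult_1 power2_eq_square power3_eq_cube)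
  moreover have "\<zeta>\<^sup>2 \<noteq> \<zeta>"
    using \<zeta>0 \<zeta>1 by (simp add: power2_eq_square)
  ultimately have card: "card {c, c * \<zeta>, c * \<zeta>\<^sup>2} = 3"
    using c \<zeta>1 by auto
  have "x ^ 3 = c ^ 3 \<longleftrightarrow> x \<in> {c, c * \<zeta>, c * \<zeta>\<^sup>2}" for x
  proof -
    have "x ^ 3 - c ^ 3 = (x - c) * (x - c * \<zeta>) * (x - c * \<zeta>\<^sup>2)"
      using \<zeta> by Groebner_Basis.algebra
    thus ?thesis
      by (metis (no_types, lifting) eq_iff_diff_eq_0 insert_iff mult_eq_0_iff singletonD)
  qed
  hence "{x. x ^ 3 = c ^ 3} = {c, c * \<zeta>, c * \<zeta>\<^sup>2}"
    by blast
  thus "finite {x. x ^ 3 = c ^ 3}" "card {x. x ^ 3 = c ^ 3} = 3"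
    using card by simp_all
qed

text \<open>The slopes \<alpha> and -\<alpha> are always present. Any other one is (c + \<alpha>) s
  / 3 with c one of three cube roots and s one of two square roots of -3, which makes none or six
  more.\<close>

lemma card_flexes:
  fixes a2 a4 a6 \<alpha> \<beta> r :: "'p::prime_card padic_int"
  defines "F \<equiv> {\<alpha>. \<exists>\<beta> r. flex_eqs a2 a4 a6 \<alpha> \<beta> r}"
  assumes n2: "padic_norm (2 :: 'p padic_int) = 1" and disc: "cubic_disc a2 a4 a6 \<noteq> 0" and z: "0 \<notin> F"
    and eqs: "flex_eqs a2 a4 a6 \<alpha> \<beta> r"
  shows "finite F" "card F = (if flex_special \<alpha> (\<alpha> * r + \<beta>) then 8 else 2)"
proof -
  define b where "b = \<alpha> * r + \<beta>"
  have b0: "b \<noteq> 0" and C0: "4 * \<alpha> ^ 3 - 27 * b \<noteq> 0"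
    using disc cubic_disc_flex[OF eqs] unfolding b_def by auto
  have \<alpha>F: "\<alpha> \<in> F" "- \<alpha> \<in> F"
    using eqs flex_eqs_uminus[OF eqs] unfolding F_def by blast+
  have "\<alpha> \<noteq> 0"
    using \<alpha>F z by auto
  hence \<alpha>\<alpha>: "\<alpha> \<noteq> - \<alpha>"
    by (simp add: eq_neg_iff_add_eq_0 flip: mult_2)
  have F_cases: "\<alpha>' = \<alpha> \<or> \<alpha>' = - \<alpha> \<or> (\<exists>c \<omega>. \<omega>\<^sup>2 = -3 \<and> c ^ 3 = 8 * \<alpha> ^ 3 - 54 * b \<and> 3 * \<alpha>' = (c + \<alpha>) * \<omega>)"
    if "\<alpha>' \<in> F" for \<alpha>'
    using that flex_eqs_cases[OF eqs] unfolding F_def b_def by blast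
  have "finite F \<and> card F = (if flex_special \<alpha> b then 8 else 2)"
  proof (cases "flex_special \<alpha> b")
    case False
    hence "F = {\<alpha>, - \<alpha>}"
      using F_cases \<alpha>F unfolding flex_special_def by blast
    thus ?thesis
      using False \<alpha>\<alpha> by simp
  next
    case True
    then obtain c \<omega> where \<omega>: "\<omega>\<^sup>2 = (-3 :: 'p padic_int)" and c: "c ^ 3 = 8 * \<alpha> ^ 3 - 54 * b"
      unfolding flex_special_def by blast
    obtain t2 :: "'p padic_int" where t2: "2 * t2 = 1"
      using n2 by (rule ex_padic_inverse)
    have "padic_norm (3 :: 'p padic_int) = 1"
      using CARD_neq_3_of_sqrt_minus_3[OF \<omega>] by (simp add: padic_norm_3)
    then obtain t3 :: "'p padic_int" where t3: "3 * t3 = 1"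
      by (rule ex_padic_inverse)
    have \<omega>0: "\<omega> \<noteq> 0"
      using \<omega> by auto
    have t30: "t3 \<noteq> 0"
      using t3 by auto
    have "c ^ 3 = 2 * (4 * \<alpha> ^ 3 - 27 * b)"
      unfolding c by (simp add: algebra_simps)
    hence "c ^ 3 \<noteq> 0"
      using C0 by simp
    hence c0: "c \<noteq> 0"
      by auto
    define K where "K = {c'. c' ^ 3 = 8 * \<alpha> ^ 3 - 54 * b}"
    have "finite K" and cardK: "card K = 3"
      using cube_roots[OF \<omega> t2 c0] unfolding K_def c by auto
    have K_iff: "c' \<in> K \<longleftrightarrow> c' ^ 3 = 8 * \<alpha> ^ 3 - 54 * b" for c'
      by (simp add: K_def)
    have s_iff: "s \<in> {\<omega>, - \<omega>} \<longleftrightarrow> s\<^sup>2 = -3" for s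
      unfolding \<omega>[symmetric] power2_eq_iff by simp
    define h where "h = (\<lambda>(c, s). (c + \<alpha>) * s * t3)"
    have h: "\<exists>\<rho>. h (c', s) \<in> F \<and> (h (c', s))\<^sup>2 - \<alpha>\<^sup>2 = 3 * \<rho> \<and> 6 * b = - (\<rho> * (3 * \<alpha> + s * h (c', s)))"
      if "c' \<in> K" "s \<in> {\<omega>, - \<omega>}" for c' s
    proof -
      define \<alpha>' where "\<alpha>' = (c' + \<alpha>) * s * t3"
      define \<rho> where "\<rho> = (\<alpha>'\<^sup>2 - \<alpha>\<^sup>2) * t3"
      define e where "e = - (\<rho> * (3 * \<alpha>' + s * \<alpha>) * t3 * t2)"
      have c': "c' ^ 3 = 8 * \<alpha> ^ 3 - 54 * b"
        using that K_iff by blast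
      have s: "s\<^sup>2 = -3"
        using that s_iff by blast
      note sol = flex_pair_of_cube[OF c' s t2 t3 \<alpha>'_def \<rho>_def e_def]
      have "flex_eqs a2 a4 a6 \<alpha>' (e - \<alpha>' * r) (r + \<rho>)"
        unfolding flex_pair_iff[OF eqs b_def] using sol by blast
      hence "\<alpha>' \<in> F"
        unfolding F_def by blast
      moreover have "h (c', s) = \<alpha>'"
        by (simp add: h_def \<alpha>'_def)
      ultimately show ?thesis
        using sol(1,4) by blast
    qed
    have inj: "inj_on h (K \<times> {\<omega>, - \<omega>})"
    proof (rule inj_onI, clarify)
      fix c1 s1 c2 s2
      assume *: "c1 \<in> K" "c2 \<in> K" "s1 \<in> {\<omega>, - \<omega>}" "s2 \<in> {\<omega>, - \<omega>}" and eq: "h (c1, s1) = h (c2, s2)"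
      have s0: "s1 \<noteq> 0"
        using *(3) \<omega>0 by auto
      \<comment> \<open>Equal slopes \<alpha>' with opposite square roots s would share \<rho>;
        comparing the two formulas for 6 b gives 2 \<rho> s \<alpha>' = 0. But \<rho> is nonzero
        because b is, and 0 is not a slope.\<close>
      have "s1 = s2"
      proof (rule ccontr)
        assume "s1 \<noteq> s2"
        hence s2: "s2 = - s1"
          using * by auto
        obtain \<rho>1 where \<rho>1: "h (c1, s1) \<in> F" "(h (c1, s1))\<^sup>2 - \<alpha>\<^sup>2 = 3 * \<rho>1"
            "6 * b = - (\<rho>1 * (3 * \<alpha> + s1 * h (c1, s1)))"
          using h[OF *(1,3)] by blast
        obtain \<rho>2 where \<rho>2: "(h (c2, s2))\<^sup>2 - \<alpha>\<^sup>2 = 3 * \<rho>2"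
            "6 * b = - (\<rho>2 * (3 * \<alpha> + s2 * h (c2, s2)))"
          using h[OF *(2,4)] by blast
        have "3 * \<rho>1 = 3 * \<rho>2"
          using \<rho>1(2) \<rho>2(1) eq by simp
        hence "\<rho>2 = \<rho>1"
          by simp
        moreover have "2 * (\<rho> * (s * y)) = 0"
          if "6 * b = - (\<rho> * (3 * \<alpha> + s * y))" "6 * b = - (\<rho> * (3 * \<alpha> + - s * y))" for \<rho> s y
          using that by Groebner_Basis.algebra
        ultimately have "2 * (\<rho>1 * (s1 * h (c1, s1))) = 0"
          using \<rho>1(3) \<rho>2(2)[folded eq] unfolding s2 by metis
        moreover have "\<rho>1 \<noteq> 0"
          using \<rho>1(3) b0 by auto
        moreover have "h (c1, s1) \<noteq> 0"
          using \<rho>1(1) z by metis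
        ultimately show False
          using s0 by simp
      qed
      moreover from this have "c1 = c2"
        using eq s0 t30 by (simp add: h_def)
      ultimately show "c1 = c2 \<and> s1 = s2"
        by simp
    qed
    \<comment> \<open>A new slope equal to \<alpha> or -\<alpha> would mean \<rho> = 0, and then b =
      0.\<close>
    have not_pm: "h x \<notin> {\<alpha>, - \<alpha>}" if x: "x \<in> K \<times> {\<omega>, - \<omega>}" for x
    proof
      assume *: "h x \<in> {\<alpha>, - \<alpha>}"
      obtain c' s where x': "x = (c', s)" "c' \<in> K" "s \<in> {\<omega>, - \<omega>}"
        using x by blast
      obtain \<rho> where \<rho>: "(h x)\<^sup>2 - \<alpha>\<^sup>2 = 3 * \<rho>" "6 * b = - (\<rho> * (3 * \<alpha> + s * h x))"
        using h[OF x'(2,3)] unfolding x'(1) by blast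
      have "(h x)\<^sup>2 = \<alpha>\<^sup>2"
        using * unfolding power2_eq_iff by blast
      hence "\<rho> = 0"
        using \<rho>(1) by simp
      thus False
        using \<rho>(2) b0 by simp
    qed
    have "h ` (K \<times> {\<omega>, - \<omega>}) \<subseteq> - {\<alpha>, - \<alpha>}"
    proof (rule image_subsetI)
      fix x
      assume "x \<in> K \<times> {\<omega>, - \<omega>}"
      thus "h x \<in> - {\<alpha>, - \<alpha>}"
        unfolding Compl_iff by (rule not_pm)
    qed
    hence disj: "h ` (K \<times> {\<omega>, - \<omega>}) \<inter> {\<alpha>, - \<alpha>} = {}"
      by (simp only: disjoint_eq_subset_Compl)
    have F: "F = h ` (K \<times> {\<omega>, - \<omega>}) \<union> {\<alpha>, - \<alpha>}"
    proof (intro equalityI subsetI)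
      fix \<alpha>'
      assume "\<alpha>' \<in> F"
      from F_cases[OF this] consider "\<alpha>' \<in> {\<alpha>, - \<alpha>}" |
          c' s where "s\<^sup>2 = -3" "c' ^ 3 = 8 * \<alpha> ^ 3 - 54 * b" "3 * \<alpha>' = (c' + \<alpha>) * s"
        by blast
      thus "\<alpha>' \<in> h ` (K \<times> {\<omega>, - \<omega>}) \<union> {\<alpha>, - \<alpha>}"
      proof cases
        case 2
        have "\<alpha>' = (c' + \<alpha>) * s * t3"
          using 2(3) t3 by Groebner_Basis.algebra
        hence "\<alpha>' = h (c', s)"
          by (simp add: h_def)
        moreover have "(c', s) \<in> K \<times> {\<omega>, - \<omega>}"
          using 2 K_iff s_iff by blast
        ultimately show ?thesis
          by blast
      qed blast
    next
      fix \<alpha>'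
      assume "\<alpha>' \<in> h ` (K \<times> {\<omega>, - \<omega>}) \<union> {\<alpha>, - \<alpha>}"
      thus "\<alpha>' \<in> F"
        using \<alpha>F h by blast
    qed
    have "\<omega> \<noteq> - \<omega>"
      using \<omega>0 by (simp add: eq_neg_iff_add_eq_0 flip: mult_2)
    hence "card {\<omega>, - \<omega>} = 2"
      by simp
    hence fin: "finite (K \<times> {\<omega>, - \<omega>})" and card: "card (K \<times> {\<omega>, - \<omega>}) = 6"
      using cardK \<open>finite K\<close> by (simp_all add: card_cartesian_product)
    have "card F = card (h ` (K \<times> {\<omega>, - \<omega>})) + card {\<alpha>, - \<alpha>}"
      unfolding F using fin disj by (intro card_Un_disjoint) auto
    also have "\<dots> = 6 + 2"
      using \<alpha>\<alpha> by (simp add: card_image[OF inj] card)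
    finally show ?thesis
      unfolding F using fin True by simp
  qed
  thus "finite F" "card F = (if flex_special \<alpha> (\<alpha> * r + \<beta>) then 8 else 2)"
    unfolding b_def by auto
qed

section \<open>Compactness and Borel measurability\<close>

instance padic_int :: (prime_card) topological_semigroup_mult
proof
  fix a b :: "'a padic_int"
  show "((\<lambda>z. fst z * snd z) \<longlongrightarrow> a * b) (nhds a \<times>\<^sub>F nhds b)"
  proof (rule tendsto_padic_intI)
    fix n
    show "eventually (\<lambda>z. padic_residue (fst z * snd z) n = padic_residue (a * b) n)
            (nhds a \<times>\<^sub>F nhds b)"
      using eventually_prodI[OF eventually_padic_residue_eq[of n a] eventually_padic_residue_eq[of n b]]
      by (rule eventually_mono) (simp add: times_padic_int.rep_eq)
  qed
qed

text \<open>Koenig's lemma: without a finite subcover there would be nested residue classes, one of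
  each level, none of them finitely covered. But the member of the cover around their common point
  contains one of them.\<close>

lemma compact_padic_UNIV: "compact (UNIV :: 'p::prime_card padic_int set)"
  unfolding compact_eq_Heine_Borel
proof (intro allI impI, elim conjE)
  fix C :: "'p padic_int set set"
  assume op: "\<forall>S\<in>C. open S" and cover: "UNIV \<subseteq> \<Union>C"
  define fin where "fin S \<longleftrightarrow> (\<exists>D. D \<subseteq> C \<and> finite D \<and> S \<subseteq> \<Union>D)" for S
  let ?B = "\<lambda>n a. {x :: 'p padic_int. padic_residue x n = a}"
  have "fin UNIV"
  proof (rule ccontr)
    assume "\<not> fin UNIV"
    moreover have "UNIV = ?B 0 0"
      by (auto simp: padic_residue_0_index)
    ultimately have start: "\<not> fin (?B 0 0)"
      by simp
    have step: "\<exists>b. \<not> fin (?B (Suc n) b) \<and> b mod int CARD('p) ^ n = a" if bad: "\<not> fin (?B n a)" for n a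
    proof (rule ccontr)
      assume "\<nexists>b. \<not> fin (?B (Suc n) b) \<and> b mod int CARD('p) ^ n = a"
      hence "\<forall>b\<in>{b. b mod int CARD('p) ^ n = a}. fin (?B (Suc n) b)"
        by fastforce
      hence "\<forall>b\<in>{b. b mod int CARD('p) ^ n = a}. \<exists>D. D \<subseteq> C \<and> finite D \<and> ?B (Suc n) b \<subseteq> \<Union>D"
        unfolding fin_def .
      from bchoice[OF this] obtain D where D':
        "\<forall>b\<in>{b. b mod int CARD('p) ^ n = a}. D b \<subseteq> C \<and> finite (D b) \<and> ?B (Suc n) b \<subseteq> \<Union>(D b)" ..
      note D = D'[THEN bspec, OF CollectI]
      define E where "E = (\<Union>b\<in>{b\<in>{0..<int CARD('p) ^ Suc n}. b mod int CARD('p) ^ n = a}. D b)"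
      have "E \<subseteq> C"
        using D unfolding E_def by blast
      moreover have "finite {b\<in>{0..<int CARD('p) ^ Suc n}. b mod int CARD('p) ^ n = a}"
        by (rule finite_subset[of _ "{0..<int CARD('p) ^ Suc n}"]) auto
      hence "finite E"
        unfolding E_def by (rule finite_UN_I) (use D in simp)
      moreover have "?B n a \<subseteq> \<Union>E"
      proof
        fix x
        assume "x \<in> ?B n a"
        hence *: "padic_residue x (Suc n) mod int CARD('p) ^ n = a"
          by (simp add: padic_residue_compat)
        have "x \<in> ?B (Suc n) (padic_residue x (Suc n))"
          by simp
        moreover have "?B (Suc n) (padic_residue x (Suc n)) \<subseteq> \<Union>(D (padic_residue x (Suc n)))"
          using D[OF *] by simp
        moreover have "D (padic_residue x (Suc n)) \<subseteq> E"
          unfolding E_def using * padic_residue_range[of x "Suc n"] by (intro UN_upper) simp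
        ultimately show "x \<in> \<Union>E"
          by (meson Union_mono subsetD)
      qed
      ultimately have "fin (?B n a)"
        unfolding fin_def by blast
      thus False
        using bad by contradiction
    qed
    have "\<exists>f. \<forall>n. \<not> fin (?B n (f n)) \<and> f (Suc n) mod int CARD('p) ^ n = f n"
      by (rule dependent_nat_choice) (use start step in blast)+
    then obtain f where f: "\<And>n. \<not> fin (?B n (f n))" "\<And>n. f (Suc n) mod int CARD('p) ^ n = f n"
      by blast
    have "\<exists>x :: 'p padic_int. \<forall>n. padic_residue x n = f n"
      by (rule ex_padic_residue_seq) (rule f(2)[symmetric])
    then obtain x :: "'p padic_int" where x: "\<And>n. padic_residue x n = f n"
      by blast
    obtain S where S: "S \<in> C" "x \<in> S"
      using cover by blast
    then obtain n where "\<forall>y. padic_residue y n = padic_residue x n \<longrightarrow> y \<in> S"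
      using op unfolding open_padic_int_def by blast
    hence "?B n (f n) \<subseteq> \<Union>{S}"
      unfolding x by blast
    hence "fin (?B n (f n))"
      unfolding fin_def using S(1) by (intro exI[of _ "{S}"]) auto
    thus False
      using f(1) by blast
  qed
  thus "\<exists>D\<subseteq>C. finite D \<and> UNIV \<subseteq> \<Union>D"
    unfolding fin_def by blast
qed

definition flex_set :: "('p::prime_card padic_int \<times> 'p padic_int \<times> 'p padic_int) set" where
  "flex_set = {(a2, a4, a6). cubic_disc a2 a4 a6 \<noteq> 0 \<and> (\<exists>\<alpha> \<beta> r. flex_eqs a2 a4 a6 \<alpha> \<beta> r)}"

text \<open>The defining condition quantifies existentially over a continuum; compactness makes it
  Borel, as a compact image minus the zero set of a polynomial.\<close>

lemma sets_flex_set [measurable]: "(flex_set :: ('p::prime_card padic_int \<times> 'p padic_int \<times> 'p padic_int) set) \<in> sets borel"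
proof -
  let ?f = "\<lambda>(\<alpha> :: 'p padic_int, \<beta>, r). (\<alpha> * \<alpha> - 3 * r, 2 * \<alpha> * \<beta> + 3 * (r * r), \<beta> * \<beta> - r * r * r)"
  have "compact (range ?f)"
  proof (rule compact_continuous_image)
    show "continuous_on UNIV ?f"
      unfolding case_prod_unfold by (intro continuous_intros)
    show "compact (UNIV :: ('p padic_int \<times> 'p padic_int \<times> 'p padic_int) set)"
      using compact_Times[OF compact_padic_UNIV compact_Times[OF compact_padic_UNIV compact_padic_UNIV]]
      by simp
  qed
  hence "closed (range ?f)"
    by (rule compact_imp_closed)
  moreover have "closed {(a2, a4, a6). cubic_disc a2 a4 (a6 :: 'p padic_int) = 0}"
  proof -
    have "closed {a. (\<lambda>(a2, a4, a6). cubic_disc a2 a4 (a6 :: 'p padic_int)) a = (\<lambda>_. 0) a}"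
      unfolding cubic_disc_def case_prod_unfold power2_eq_square power3_eq_cube
      by (intro closed_Collect_eq continuous_intros)
    thus ?thesis
      by (simp add: case_prod_unfold)
  qed
  ultimately have "range ?f - {(a2, a4, a6). cubic_disc a2 a4 (a6 :: 'p padic_int) = 0} \<in> sets borel"
    by auto
  also have "range ?f - {(a2, a4, a6). cubic_disc a2 a4 (a6 :: 'p padic_int) = 0} = flex_set"
  proof (rule Set.set_eqI)
    fix a :: "'p padic_int \<times> 'p padic_int \<times> 'p padic_int"
    obtain a2 a4 a6 where a: "a = (a2, a4, a6)"
      by (cases a)
    have "a \<in> range ?f \<longleftrightarrow> (\<exists>\<alpha> \<beta> r. flex_eqs a2 a4 a6 \<alpha> \<beta> r)"
      unfolding a by (simp add: image_iff flex_eqs_def power2_eq_square power3_eq_cube)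
    thus "a \<in> range ?f - {(a2, a4, a6). cubic_disc a2 a4 (a6 :: 'p padic_int) = 0} \<longleftrightarrow> a \<in> flex_set"
      unfolding a flex_set_def by auto
  qed
  finally show ?thesis .
qed

definition padic_cubes :: "'p::prime_card padic_int set" where
  "padic_cubes = range (\<lambda>x. x ^ 3)"

lemma sets_padic_cubes [measurable]: "(padic_cubes :: 'p::prime_card padic_int set) \<in> sets borel"
proof -
  have "compact (range (\<lambda>x :: 'p padic_int. x * x * x))"
    by (intro compact_continuous_image compact_padic_UNIV continuous_intros)
  hence "closed (range (\<lambda>x :: 'p padic_int. x * x * x))"
    by (rule compact_imp_closed)
  thus ?thesis
    unfolding padic_cubes_def power3_eq_cube by (rule borel_closed)
qed

lemma flex_special_iff:
  "flex_special \<alpha> b \<longleftrightarrow> (\<exists>\<omega> :: 'p::prime_card padic_int. \<omega>\<^sup>2 = -3) \<and> 8 * \<alpha> ^ 3 - 54 * b \<in> (padic_cubes :: 'p padic_int set)"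
  unfolding flex_special_def padic_cubes_def image_iff by (metis UNIV_I)

text \<open>The reciprocal of the number of flexes, i.e. of nontrivial \<open>3\<close>-torsion points.\<close>

definition flex_weight :: "'p::prime_card padic_int \<Rightarrow> 'p padic_int \<Rightarrow> real" where
  "flex_weight \<alpha> b = (if flex_special \<alpha> b then 1 / 8 else 1 / 2)"

lemma borel_measurable_flex_weight [measurable]:
  fixes f g :: "'a \<Rightarrow> 'p::prime_card padic_int"
  assumes [measurable]: "f \<in> borel_measurable N" "g \<in> borel_measurable N"
  shows "(\<lambda>x. flex_weight (f x) (g x)) \<in> borel_measurable N"
  unfolding flex_weight_def flex_special_iff by measurable

text \<open>\<open>nonbad\<close> says that no flex has slope 0, where a2 and a4 would not determine
  \<beta>. On a smooth curve the fibre is then the set of slopes of all flexes, so the weights,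
  being reciprocals of its size, sum to 1 unless it is empty.\<close>

lemma
  fixes a2 a4 y :: "'p::prime_card padic_int"
  assumes n2: "padic_norm (2 :: 'p padic_int) = 1" and nonbad: "\<nexists>r. a2 = -3 * r \<and> a4 = 3 * r\<^sup>2"
  shows finite_flex_fibre: "finite {\<alpha> \<in> flex_dom a2 a4. flex_a6 a2 a4 \<alpha> = y}" (is "finite ?S")
    and sum_flex_weight_fibre: "(\<Sum>\<alpha> | \<alpha> \<in> flex_dom a2 a4 \<and> flex_a6 a2 a4 \<alpha> = y.
      ennreal (flex_weight \<alpha> (flex_b a2 a4 \<alpha>))) = indicator flex_set (a2, a4, y)"
proof -
  define F where "F = {\<alpha>. \<exists>\<beta> r. flex_eqs a2 a4 y \<alpha> \<beta> r}"
  have S: "?S = {\<alpha>. \<alpha> \<noteq> 0 \<and> cubic_disc a2 a4 y \<noteq> 0 \<and> \<alpha> \<in> F}"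
    unfolding F_def using flex_dom_a6_iff by blast
  have z: "0 \<notin> F"
    using nonbad unfolding F_def flex_eqs_def by auto
  have "finite ?S \<and> (\<Sum>\<alpha>\<in>?S. ennreal (flex_weight \<alpha> (flex_b a2 a4 \<alpha>))) = indicator flex_set (a2, a4, y)"
  proof (cases "cubic_disc a2 a4 y \<noteq> 0 \<and> F \<noteq> {}")
    case False
    hence empty: "?S = {}"
      unfolding S by blast
    have "(a2, a4, y) \<notin> flex_set"
      using False unfolding flex_set_def F_def by blast
    thus ?thesis
      unfolding empty by simp
  next
    case True
    hence SF: "?S = F"
      unfolding S using z by auto
    have card: "finite F \<and> flex_weight \<alpha> (flex_b a2 a4 \<alpha>) = 1 / real (card F)" if \<alpha>: "\<alpha> \<in> F" for \<alpha>
    proof -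
      obtain \<beta> r where eqs: "flex_eqs a2 a4 y \<alpha> \<beta> r"
        using \<alpha> unfolding F_def by blast
      have "\<alpha> \<noteq> 0"
        using \<alpha> z by blast
      hence "flex_b a2 a4 \<alpha> = \<alpha> * r + \<beta>"
        using eqs flex_r_eq flex_\<beta>_eq unfolding flex_b_def flex_eqs_def by metis
      thus ?thesis
        using card_flexes[OF n2 _ _ eqs] True z unfolding F_def[symmetric]
        by (simp add: flex_weight_def)
    qed
    hence fin: "finite F"
      using True by blast
    have "(\<Sum>\<alpha>\<in>F. ennreal (flex_weight \<alpha> (flex_b a2 a4 \<alpha>))) = (\<Sum>\<alpha>\<in>F. ennreal (1 / real (card F)))"
      by (intro sum.cong refl) (simp add: card)
    also have "\<dots> = ennreal (\<Sum>\<alpha>\<in>F. 1 / real (card F))"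
      by (intro sum_ennreal) simp
    also have "\<dots> = 1"
      using fin True by simp
    finally show ?thesis
      unfolding SF using fin True unfolding flex_set_def F_def by auto
  qed
  thus "finite ?S" "(\<Sum>\<alpha>\<in>?S. ennreal (flex_weight \<alpha> (flex_b a2 a4 \<alpha>))) = indicator flex_set (a2, a4, y)"
    by blast+
qed

section \<open>The density of the cubics with a flex\<close>

lemma pred_padic_dvd [measurable]:
  fixes f g :: "'a \<Rightarrow> 'p::prime_card padic_int"
  assumes "f \<in> borel_measurable N" "g \<in> borel_measurable N"
  shows "Measurable.pred N (\<lambda>x. f x dvd g x)"
  using sets_padic_dvd[OF assms] by (simp add: pred_def)

lemma pred_padic_eq [measurable]:
  fixes f g :: "'a \<Rightarrow> 'p::prime_card padic_int"
  assumes [measurable]: "f \<in> borel_measurable N" "g \<in> borel_measurable N"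
  shows "Measurable.pred N (\<lambda>x. f x = g x)"
proof -
  have "Measurable.pred N (\<lambda>x. 0 dvd f x - g x)"
    by measurable
  thus ?thesis
    by simp
qed

lemma borel_measurable_flex_r [measurable]:
  fixes f g :: "'a \<Rightarrow> 'p::prime_card padic_int"
  assumes [measurable]: "f \<in> borel_measurable N" "g \<in> borel_measurable N"
  shows "(\<lambda>x. flex_r (f x) (g x)) \<in> borel_measurable N"
  unfolding flex_r_def by measurable

lemma borel_measurable_flex_b [measurable]:
  fixes f g h :: "'a \<Rightarrow> 'p::prime_card padic_int"
  assumes [measurable]: "f \<in> borel_measurable N" "g \<in> borel_measurable N" "h \<in> borel_measurable N"
  shows "(\<lambda>x. flex_b (f x) (g x) (h x)) \<in> borel_measurable N"
  unfolding flex_b_def flex_\<beta>_def by measurable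

lemma pred_flex_dom [measurable]:
  fixes f g h :: "'a \<Rightarrow> 'p::prime_card padic_int"
  assumes [measurable]: "f \<in> borel_measurable N" "g \<in> borel_measurable N" "h \<in> borel_measurable N"
  shows "Measurable.pred N (\<lambda>x. h x \<in> flex_dom (f x) (g x))"
  unfolding flex_dom_def mem_Collect_eq by measurable

section \<open>Integration over the slope\<close>

definition flex_density :: "'p::prime_card padic_int \<Rightarrow> 'p padic_int \<Rightarrow> 'p padic_int \<Rightarrow> ennreal" where
  "flex_density a2 a4 \<alpha> = ennreal ((padic_norm (flex_b a2 a4 \<alpha>))\<^sup>2 / padic_norm \<alpha>) *
     ennreal (flex_weight \<alpha> (flex_b a2 a4 \<alpha>)) * indicator (flex_dom a2 a4) \<alpha>"

lemma borel_measurable_flex_density [measurable]: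
  fixes f g h :: "'a \<Rightarrow> 'p::prime_card padic_int"
  assumes [measurable]: "f \<in> borel_measurable N" "g \<in> borel_measurable N" "h \<in> borel_measurable N"
  shows "(\<lambda>x. flex_density (f x) (g x) (h x)) \<in> borel_measurable N"
  unfolding flex_density_def indicator_def by measurable

text \<open>Area formula for \<alpha> \<mapsto> \<open>flex_a6 a2 a4 \<alpha>\<close>, with scaling
  factor |b|^2 / |\<alpha>|; every curve is counted with total weight 1.\<close>

lemma nn_integral_flex_slice:
  fixes a2 a4 :: "'p::prime_card padic_int"
  assumes n2: "padic_norm (2 :: 'p padic_int) = 1" and nonbad: "\<nexists>r. a2 = -3 * r \<and> a4 = 3 * r\<^sup>2"
  shows "(\<integral>\<^sup>+y. indicator flex_set (a2, a4, y) \<partial>haar_measure) =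
    (\<integral>\<^sup>+\<alpha>. flex_density a2 a4 \<alpha> \<partial>haar_measure)"
proof -
  let ?w = "\<lambda>\<alpha>. ennreal (flex_weight \<alpha> (flex_b a2 a4 \<alpha>))"
  let ?\<kappa> = "\<lambda>\<alpha>. (padic_norm (flex_b a2 a4 \<alpha>))\<^sup>2 / padic_norm \<alpha>"
  have "(\<integral>\<^sup>+\<alpha>. ennreal (?\<kappa> \<alpha>) * ?w \<alpha> * indicator (flex_dom a2 a4) \<alpha> \<partial>haar_measure) =
       (\<integral>\<^sup>+y. (\<Sum>\<alpha> | \<alpha> \<in> flex_dom a2 a4 \<and> flex_a6 a2 a4 \<alpha> = y. ?w \<alpha>) \<partial>haar_measure)"
  proof (rule padic_area_formula)
    show "?\<kappa> \<alpha> > 0" if "\<alpha> \<in> flex_dom a2 a4" for \<alpha>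
      using that by (auto simp: flex_dom_def)
    show "?w \<in> borel_measurable borel"
      by measurable
  qed (use flex_dom_locally_scaling[OF n2] finite_flex_fibre[OF n2 nonbad] in blast)+
  thus ?thesis
    by (simp only: sum_flex_weight_fibre[OF n2 nonbad] flex_density_def)
qed

text \<open>For given a2 at most one r is possible, hence at most one bad a4.\<close>

lemma AE_flex_nonbad:
  "AE a4 in haar_measure. \<nexists>r. a2 = -3 * r \<and> a4 = 3 * r\<^sup>2" for a2 :: "'p::prime_card padic_int"
proof (cases "\<exists>r. a2 = -3 * r")
  case True
  then obtain r where r: "a2 = -3 * r" ..
  show ?thesis
  proof (rule AE_mp[OF AE_haar_padic_not_eq[of "3 * r\<^sup>2"]], rule AE_I2, rule impI, rule notI)
    fix a4
    assume "a4 \<noteq> 3 * r\<^sup>2" "\<exists>r. a2 = -3 * r \<and> a4 = 3 * r\<^sup>2"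
    thus False
      unfolding r by auto
  qed
next
  case False
  thus ?thesis by (intro AE_I2) blast
qed

lemma sigma_finite_haar_padic: "sigma_finite_measure (haar_measure :: 'p::prime_card padic_int measure)"
proof -
  interpret prob_space "haar_measure :: 'p padic_int measure"
    by (rule prob_space_haar_padic)
  show ?thesis by unfold_locales
qed

lemma nn_integral_haar_commute:
  fixes f :: "'p::prime_card padic_int \<Rightarrow> 'p padic_int \<Rightarrow> ennreal"
  assumes "(\<lambda>(x, y). f x y) \<in> borel_measurable (borel \<Otimes>\<^sub>M borel)"
  shows "(\<integral>\<^sup>+x. (\<integral>\<^sup>+y. f x y \<partial>haar_measure) \<partial>haar_measure) =
    (\<integral>\<^sup>+y. (\<integral>\<^sup>+x. f x y \<partial>haar_measure) \<partial>haar_measure)"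
proof -
  interpret sigma_finite_measure "haar_measure :: 'p padic_int measure"
    by (rule sigma_finite_haar_padic)
  interpret pair_sigma_finite "haar_measure :: 'p padic_int measure" "haar_measure :: 'p padic_int measure" ..
  have "(\<lambda>(x, y). f x y) \<in> borel_measurable ((haar_measure :: 'p padic_int measure) \<Otimes>\<^sub>M (haar_measure :: 'p padic_int measure))"
    using assms by (simp add: measurable_cong_sets[OF sets_pair_measure_cong[OF sets_haar_padic sets_haar_padic] refl])
  from Fubini'[OF this] show ?thesis ..
qed

lemma borel_measurable_nn_integral_haar [measurable (raw)]:
  fixes f :: "'a \<Rightarrow> 'p::prime_card padic_int \<Rightarrow> ennreal"
  assumes "(\<lambda>(x, y). f x y) \<in> borel_measurable (N \<Otimes>\<^sub>M borel)"
  shows "(\<lambda>x. \<integral>\<^sup>+y. f x y \<partial>haar_measure) \<in> borel_measurable N"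
proof -
  interpret sigma_finite_measure "haar_measure :: 'p padic_int measure"
    by (rule sigma_finite_haar_padic)
  have "(\<lambda>(x, y). f x y) \<in> borel_measurable (N \<Otimes>\<^sub>M (haar_measure :: 'p padic_int measure))"
    using assms by (simp add: measurable_cong_sets[OF sets_pair_measure_cong[OF refl sets_haar_padic] refl])
  thus ?thesis
    by (rule borel_measurable_nn_integral)
qed

definition flex_slope_density :: "'p::prime_card padic_int \<Rightarrow> 'p padic_int \<Rightarrow> ennreal" where
  "flex_slope_density \<alpha> b = (if b \<noteq> 0 \<and> 4 * \<alpha> ^ 3 - 27 * b \<noteq> 0
     then ennreal ((padic_norm b)\<^sup>2 * flex_weight \<alpha> b) else 0)"

lemma borel_measurable_flex_slope_density [measurable]:
  fixes f g :: "'a \<Rightarrow> 'p::prime_card padic_int"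
  assumes [measurable]: "f \<in> borel_measurable N" "g \<in> borel_measurable N"
  shows "(\<lambda>x. flex_slope_density (f x) (g x)) \<in> borel_measurable N"
  unfolding flex_slope_density_def by measurable

lemma flex_density_eq_0:
  assumes "\<not> (3 dvd a2 - \<alpha>\<^sup>2 \<and> 2 * \<alpha> dvd a4 - 3 * (flex_r a2 \<alpha>)\<^sup>2)"
  shows "flex_density a2 a4 \<alpha> = 0"
proof -
  have "3 dvd \<alpha>\<^sup>2 - a2 \<longleftrightarrow> 3 dvd a2 - \<alpha>\<^sup>2"
    using dvd_minus_iff[of 3 "a2 - \<alpha>\<^sup>2"] by simp
  hence "\<alpha> \<notin> flex_dom a2 a4"
    using assms unfolding flex_dom_def by blast
  thus ?thesis
    by (simp add: flex_density_def)
qed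

lemma flex_density_param:
  fixes \<alpha> \<beta> r :: "'p::prime_card padic_int"
  assumes "\<alpha> \<noteq> 0" "a2 = \<alpha>\<^sup>2 - 3 * r" "a4 = 2 * \<alpha> * \<beta> + 3 * r\<^sup>2"
  shows "ennreal (padic_norm \<alpha>) * flex_density a2 a4 \<alpha> = flex_slope_density \<alpha> (\<alpha> * r + \<beta>)"
proof -
  have b: "flex_b a2 a4 \<alpha> = \<alpha> * r + \<beta>"
    unfolding flex_b_def flex_r_eq[OF assms(2)] flex_\<beta>_eq[OF assms] ..
  have "\<alpha> \<in> flex_dom a2 a4 \<longleftrightarrow> \<alpha> * r + \<beta> \<noteq> 0 \<and> 4 * \<alpha> ^ 3 - 27 * (\<alpha> * r + \<beta>) \<noteq> 0"
    unfolding flex_dom_def b mem_Collect_eq flex_r_eq[OF assms(2)] using assms by simp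
  moreover have "ennreal (padic_norm \<alpha>) * (ennreal (x / padic_norm \<alpha>) * ennreal y) = ennreal (x * y)"
    if "x \<ge> 0" "y \<ge> 0" for x y
    using that assms(1) by (simp flip: ennreal_mult add: mult.assoc[symmetric])
  moreover have "0 \<le> flex_weight \<alpha> (\<alpha> * r + \<beta>)"
    by (simp add: flex_weight_def)
  ultimately show ?thesis
    unfolding flex_density_def flex_slope_density_def b by simp
qed

text \<open>Substituting r for a2 costs |3|, and \<beta> for a4 costs |2 \<alpha>| = |\<alpha>|,
  which cancels the denominator of the density. A translation turns \<beta> into b = \<alpha> r +
  \<beta>, after which nothing depends on r.\<close>

lemma nn_integral_flex_density:
  fixes \<alpha> :: "'p::prime_card padic_int"
  assumes n2: "padic_norm (2 :: 'p padic_int) = 1" and \<alpha>: "\<alpha> \<noteq> 0"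
  shows "(\<integral>\<^sup>+a2. (\<integral>\<^sup>+a4. flex_density a2 a4 \<alpha> \<partial>haar_measure) \<partial>haar_measure) =
    ennreal (padic_norm (3 :: 'p padic_int)) * (\<integral>\<^sup>+b. flex_slope_density \<alpha> b \<partial>haar_measure)"
proof -
  let ?M = "haar_measure :: 'p padic_int measure"
  have inner: "(\<integral>\<^sup>+a4. flex_density (\<alpha>\<^sup>2 - 3 * r) a4 \<alpha> \<partial>?M) = (\<integral>\<^sup>+b. flex_slope_density \<alpha> b \<partial>?M)" for r
  proof -
    let ?a2 = "\<alpha>\<^sup>2 - 3 * r"
    have r: "flex_r ?a2 \<alpha> = r"
      by (rule flex_r_eq) simp
    have "(\<integral>\<^sup>+a4. flex_density ?a2 a4 \<alpha> \<partial>?M) =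
      (\<integral>\<^sup>+a4. flex_density ?a2 a4 \<alpha> * indicator {a4. 2 * \<alpha> dvd a4 - 3 * r\<^sup>2} a4 \<partial>?M)"
      using flex_density_eq_0[of ?a2 \<alpha>] r by (intro nn_integral_cong) (auto split: split_indicator)
    also have "\<dots> = ennreal (padic_norm (2 * \<alpha>)) * (\<integral>\<^sup>+\<beta>. flex_density ?a2 (3 * r\<^sup>2 + 2 * \<alpha> * \<beta>) \<alpha> \<partial>?M)"
      by (rule nn_integral_padic_affine) (use \<alpha> in simp_all)
    also have "\<dots> = (\<integral>\<^sup>+\<beta>. ennreal (padic_norm \<alpha>) * flex_density ?a2 (3 * r\<^sup>2 + 2 * \<alpha> * \<beta>) \<alpha> \<partial>?M)"
      by (subst nn_integral_cmult) (simp_all add: padic_norm_mult n2)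
    also have "\<dots> = (\<integral>\<^sup>+\<beta>. flex_slope_density \<alpha> (\<alpha> * r + \<beta>) \<partial>?M)"
      by (intro nn_integral_cong flex_density_param) (simp_all add: \<alpha>)
    also have "\<dots> = (\<integral>\<^sup>+b. flex_slope_density \<alpha> b \<partial>?M)"
      by (rule nn_integral_padic_translate) measurable
    finally show ?thesis .
  qed
  have "(\<integral>\<^sup>+a2. (\<integral>\<^sup>+a4. flex_density a2 a4 \<alpha> \<partial>?M) \<partial>?M) =
    (\<integral>\<^sup>+a2. (\<integral>\<^sup>+a4. flex_density a2 a4 \<alpha> \<partial>?M) * indicator {a2. - 3 dvd a2 - \<alpha>\<^sup>2} a2 \<partial>?M)"
  proof (rule nn_integral_cong)
    fix a2
    show "(\<integral>\<^sup>+a4. flex_density a2 a4 \<alpha> \<partial>?M) =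
      (\<integral>\<^sup>+a4. flex_density a2 a4 \<alpha> \<partial>?M) * indicator {a2. - 3 dvd a2 - \<alpha>\<^sup>2} a2"
      using flex_density_eq_0[of a2 \<alpha>] by (cases "3 dvd a2 - \<alpha>\<^sup>2") simp_all
  qed
  also have "\<dots> = ennreal (padic_norm (- 3 :: 'p padic_int)) *
      (\<integral>\<^sup>+r. (\<integral>\<^sup>+a4. flex_density (\<alpha>\<^sup>2 + - 3 * r) a4 \<alpha> \<partial>?M) \<partial>?M)"
    by (rule nn_integral_padic_affine) simp_all
  also have "(\<lambda>r. \<integral>\<^sup>+a4. flex_density (\<alpha>\<^sup>2 + - 3 * r) a4 \<alpha> \<partial>?M) = (\<lambda>r. \<integral>\<^sup>+b. flex_slope_density \<alpha> b \<partial>?M)"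
    using inner by auto
  finally show ?thesis
    by simp
qed

text \<open>Slice in a6, then pull the integral over the slope outside by Tonelli. The exceptional
  a4 and the slope 0 are null sets.\<close>

theorem nn_integral_flex_set:
  assumes n2: "padic_norm (2 :: 'p::prime_card padic_int) = 1"
  shows "(\<integral>\<^sup>+a2. (\<integral>\<^sup>+a4. (\<integral>\<^sup>+a6. indicator flex_set (a2, a4, a6) \<partial>haar_measure) \<partial>haar_measure)
      \<partial>(haar_measure :: 'p padic_int measure)) =
    ennreal (padic_norm (3 :: 'p padic_int)) *
      (\<integral>\<^sup>+\<alpha>. (\<integral>\<^sup>+b. flex_slope_density \<alpha> b \<partial>haar_measure) \<partial>(haar_measure :: 'p padic_int measure))"
proof -
  let ?M = "haar_measure :: 'p padic_int measure"
  have "(\<integral>\<^sup>+a2. (\<integral>\<^sup>+a4. (\<integral>\<^sup>+a6. indicator flex_set (a2, a4, a6) \<partial>?M) \<partial>?M) \<partial>?M) =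
    (\<integral>\<^sup>+a2. (\<integral>\<^sup>+a4. (\<integral>\<^sup>+\<alpha>. flex_density a2 a4 \<alpha> \<partial>?M) \<partial>?M) \<partial>?M)"
  proof (rule nn_integral_cong, rule nn_integral_cong_AE)
    fix a2
    show "AE a4 in ?M. (\<integral>\<^sup>+a6. indicator flex_set (a2, a4, a6) \<partial>?M) = (\<integral>\<^sup>+\<alpha>. flex_density a2 a4 \<alpha> \<partial>?M)"
      using AE_flex_nonbad[of a2] by (rule AE_mp) (intro AE_I2 impI nn_integral_flex_slice n2)
  qed
  also have "\<dots> = (\<integral>\<^sup>+a2. (\<integral>\<^sup>+\<alpha>. (\<integral>\<^sup>+a4. flex_density a2 a4 \<alpha> \<partial>?M) \<partial>?M) \<partial>?M)"
    by (intro nn_integral_cong nn_integral_haar_commute) measurable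
  also have "\<dots> = (\<integral>\<^sup>+\<alpha>. (\<integral>\<^sup>+a2. (\<integral>\<^sup>+a4. flex_density a2 a4 \<alpha> \<partial>?M) \<partial>?M) \<partial>?M)"
    by (intro nn_integral_haar_commute) measurable
  also have "\<dots> = (\<integral>\<^sup>+\<alpha>. ennreal (padic_norm (3 :: 'p padic_int)) * (\<integral>\<^sup>+b. flex_slope_density \<alpha> b \<partial>?M) \<partial>?M)"
  proof (rule nn_integral_cong_AE)
    show "AE \<alpha> in ?M. (\<integral>\<^sup>+a2. (\<integral>\<^sup>+a4. flex_density a2 a4 \<alpha> \<partial>?M) \<partial>?M) =
      ennreal (padic_norm (3 :: 'p padic_int)) * (\<integral>\<^sup>+b. flex_slope_density \<alpha> b \<partial>?M)"
      using AE_haar_padic_not_eq[of 0] by (rule AE_mp) (intro AE_I2 impI nn_integral_flex_density n2)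
  qed
  also have "\<dots> = ennreal (padic_norm (3 :: 'p padic_int)) * (\<integral>\<^sup>+\<alpha>. (\<integral>\<^sup>+b. flex_slope_density \<alpha> b \<partial>?M) \<partial>?M)"
    by (rule nn_integral_cmult) measurable
  finally show ?thesis .
qed

section \<open>Splitting off the last digit\<close>

lemma nn_integral_padic_digit:
  fixes f :: "'p::prime_card padic_int \<Rightarrow> ennreal"
  assumes [measurable]: "f \<in> borel_measurable borel"
  shows "(\<integral>\<^sup>+y. f y \<partial>haar_measure) =
    ennreal (1 / real CARD('p)) * (\<Sum>i\<in>{0..<int CARD('p)}. \<integral>\<^sup>+x. f (of_int i + unif * x) \<partial>haar_measure)"
proof -
  let ?R = "{0..<int CARD('p)}"
  let ?ind = "\<lambda>i y. indicator {y :: 'p padic_int. unif dvd y - of_int i} y :: ennreal"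
  have iff: "unif dvd y - of_int i \<longleftrightarrow> i = padic_residue y 1" if "i \<in> ?R" for i and y :: "'p padic_int"
  proof -
    have "unif dvd y - of_int i \<longleftrightarrow> padic_residue y 1 = padic_residue (of_int i :: 'p padic_int) 1"
      using unif_power_dvd_iff[of 1 "y - of_int i"] by (simp add: padic_residue_eq_iff_diff)
    thus ?thesis
      using that by (auto simp: padic_residue_of_int)
  qed
  have "(\<Sum>i\<in>?R. f y * ?ind i y) = f y" for y
  proof -
    have "(\<Sum>i\<in>?R. f y * ?ind i y) = (\<Sum>i\<in>?R. if i = padic_residue y 1 then f y else 0)"
      by (intro sum.cong refl) (auto simp: iff indicator_def)
    also have "\<dots> = f y"
      using padic_residue_range[of y 1] by simp
    finally show ?thesis .
  qed
  hence "(\<integral>\<^sup>+y. f y \<partial>haar_measure) = (\<integral>\<^sup>+y. (\<Sum>i\<in>?R. f y * ?ind i y) \<partial>haar_measure)"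
    by simp
  also have "\<dots> = (\<Sum>i\<in>?R. \<integral>\<^sup>+y. f y * ?ind i y \<partial>haar_measure)"
    by (intro nn_integral_sum) measurable
  also have "\<dots> = (\<Sum>i\<in>?R. ennreal (1 / real CARD('p)) * (\<integral>\<^sup>+x. f (of_int i + unif * x) \<partial>haar_measure))"
    by (intro sum.cong refl, subst nn_integral_padic_affine) (auto simp: unif_nonzero padic_norm_unif)
  finally show ?thesis
    by (simp add: sum_distrib_left)
qed

lemma padic_norm_of_int_digit:
  assumes "i \<in> {1..<int CARD('p::prime_card)}"
  shows "padic_norm (of_int i + unif * x :: 'p padic_int) = 1"
proof -
  have "padic_residue (of_int i :: 'p padic_int) 1 \<noteq> 0"
    using assms by (simp add: padic_residue_of_int)
  hence "padic_norm (of_int i :: 'p padic_int) = 1"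
    by (simp add: padic_unit_iff flip: padic_unit_iff_norm)
  moreover have "padic_norm (unif * x) < 1"
    by (simp add: padic_norm_lt_1_iff)
  ultimately show ?thesis
    using padic_norm_add_eq[of "unif * x" "of_int i"] by simp
qed

lemma sum_digits_split:
  "(\<Sum>i\<in>{0..<int CARD('p::prime_card)}. f i) = f 0 + (\<Sum>i\<in>{1..<int CARD('p)}. f i)"
proof -
  have "{0..<int CARD('p)} = insert 0 {1..<int CARD('p)}"
    using CARD_prime_gt_1[where 'p = 'p] by auto
  thus ?thesis by simp
qed

definition norm_sq_integral :: "'p::prime_card itself \<Rightarrow> ennreal" where
  "norm_sq_integral _ = (\<integral>\<^sup>+x. ennreal ((padic_norm (x :: 'p padic_int))\<^sup>2) \<partial>haar_measure)"

lemma nn_integral_haar_le_1: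
  fixes f :: "'p::prime_card padic_int \<Rightarrow> ennreal"
  assumes "\<And>x. f x \<le> 1"
  shows "(\<integral>\<^sup>+x. f x \<partial>haar_measure) \<le> 1"
proof -
  have "(\<integral>\<^sup>+x. f x \<partial>haar_measure) \<le> (\<integral>\<^sup>+x. 1 \<partial>(haar_measure :: 'p padic_int measure))"
    by (intro nn_integral_mono assms)
  thus ?thesis by simp
qed

lemma nn_integral_haar_const [simp]:
  "(\<integral>\<^sup>+x. c \<partial>(haar_measure :: 'p::prime_card padic_int measure)) = c"
  by simp

lemma norm_sq_le_1: "ennreal ((padic_norm x)\<^sup>2) \<le> 1"
  using padic_norm_le_1[of x] by (simp add: power_le_one)

lemma nn_integral_norm_sq_unif:
  "(\<integral>\<^sup>+x. ennreal ((padic_norm (unif * x :: 'p::prime_card padic_int))\<^sup>2) \<partial>haar_measure) =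
    ennreal (1 / real CARD('p) ^ 2) * norm_sq_integral TYPE('p)"
proof -
  have "(\<integral>\<^sup>+x. ennreal ((padic_norm (unif * x :: 'p padic_int))\<^sup>2) \<partial>haar_measure) =
    (\<integral>\<^sup>+x. ennreal (1 / real CARD('p) ^ 2) * ennreal ((padic_norm (x :: 'p padic_int))\<^sup>2) \<partial>haar_measure)"
    by (intro nn_integral_cong)
       (simp add: padic_norm_mult padic_norm_unif power_divide power_mult_distrib flip: ennreal_mult)
  also have "\<dots> = ennreal (1 / real CARD('p) ^ 2) * norm_sq_integral TYPE('p)"
    unfolding norm_sq_integral_def by (rule nn_integral_cmult) measurable
  finally show ?thesis .
qed

lemma ennreal_mult_affine:
  assumes "0 \<le> a" "0 \<le> b" "0 \<le> x" "0 \<le> c"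
  shows "ennreal a * (ennreal b * ennreal x + ennreal c) = ennreal (a * (b * x + c))"
  using assms by (simp add: ennreal_mult ennreal_plus)

lemma norm_sq_recursion:
  fixes x q :: real
  assumes q: "q > 1" and x: "x = 1 / q * (1 / q ^ 2 * x + (q - 1))"
  shows "x = q ^ 2 / (q ^ 2 + q + 1)"
proof -
  have "x * q ^ 3 = 1 / q * (1 / q ^ 2 * x + (q - 1)) * q ^ 3"
    by (rule arg_cong[OF x])
  also have "\<dots> = (1 / q * q) * ((1 / q ^ 2 * q ^ 2) * x + (q - 1) * q ^ 2)"
    by Groebner_Basis.algebra
  also have "\<dots> = x + (q - 1) * q ^ 2"
    using q by simp
  finally have "(q - 1) * (x * (q ^ 2 + q + 1)) = (q - 1) * q ^ 2"
    by Groebner_Basis.algebra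
  hence "x * (q ^ 2 + q + 1) = q ^ 2"
    using q by simp
  moreover have "q ^ 2 + q + 1 > 0"
    using q by (intro add_nonneg_pos) auto
  ultimately show ?thesis
    by (simp add: eq_divide_eq)
qed

text \<open>The class of 0 reproduces the integral with factor p^(-2), and each of the p - 1 classes
  of units contributes 1. Once the integral is known to be finite, this linear equation determines
  it.\<close>

lemma norm_sq_integral:
  "norm_sq_integral TYPE('p::prime_card) =
    ennreal (real CARD('p) ^ 2 / (real CARD('p) ^ 2 + real CARD('p) + 1))"
proof -
  let ?p = "real CARD('p)"
  let ?I = "norm_sq_integral TYPE('p)"
  have p: "?p > 1"
    using CARD_prime_gt_1[where 'p = 'p] by simp
  have "?I \<le> 1"
    unfolding norm_sq_integral_def by (intro nn_integral_haar_le_1 norm_sq_le_1)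
  hence "?I \<noteq> \<top>"
    by (auto simp: top_unique)
  then obtain I where I: "?I = ennreal I" "I \<ge> 0"
    by (cases ?I) auto
  have "?I = ennreal (1 / ?p) * (\<Sum>i\<in>{0..<int CARD('p)}. \<integral>\<^sup>+x. ennreal ((padic_norm (of_int i + unif * x :: 'p padic_int))\<^sup>2) \<partial>haar_measure)"
    unfolding norm_sq_integral_def by (rule nn_integral_padic_digit) measurable
  also have "(\<Sum>i\<in>{0..<int CARD('p)}. \<integral>\<^sup>+x. ennreal ((padic_norm (of_int i + unif * x :: 'p padic_int))\<^sup>2) \<partial>haar_measure) =
      ennreal (1 / ?p ^ 2) * ?I + (\<Sum>i\<in>{1..<int CARD('p)}. 1)"
    unfolding sum_digits_split
    by (intro arg_cong2[where f = "(+)"] sum.cong refl)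
       (simp_all add: nn_integral_norm_sq_unif padic_norm_of_int_digit)
  also have "(\<Sum>i\<in>{1..<int CARD('p)}. 1) = ennreal (?p - 1)"
    using p by (simp add: ennreal_of_nat_eq_real_of_nat of_nat_diff nat_diff_distrib)
  also have "ennreal (1 / ?p) * (ennreal (1 / ?p ^ 2) * ?I + ennreal (?p - 1)) =
      ennreal (1 / ?p * (1 / ?p ^ 2 * I + (?p - 1)))"
    unfolding I(1) using p I(2) by (intro ennreal_mult_affine) auto
  finally have "ennreal I = ennreal (1 / ?p * (1 / ?p ^ 2 * I + (?p - 1)))"
    unfolding I(1) .
  moreover have "0 \<le> 1 / ?p * (1 / ?p ^ 2 * I + (?p - 1))"
    using p I(2) by (intro mult_nonneg_nonneg add_nonneg_nonneg) auto
  ultimately have I_eq: "I = 1 / ?p * (1 / ?p ^ 2 * I + (?p - 1))"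
    using I(2) ennreal_inj[of I "1 / ?p * (1 / ?p ^ 2 * I + (?p - 1))"] by blast
  have "I = ?p ^ 2 / (?p ^ 2 + ?p + 1)"
    by (rule norm_sq_recursion[OF p I_eq])
  thus ?thesis
    unfolding I(1) by (rule arg_cong)
qed

section \<open>Cubes\<close>

lemma padic_cube_Hensel:
  fixes x y :: "'p::prime_card padic_int"
  assumes n3: "padic_norm (3 :: 'p padic_int) = 1" and x: "padic_norm x = 1"
    and xy: "unif dvd y - x ^ 3"
  obtains z where "y = (x + unif * z) ^ 3"
proof -
  \<comment> \<open>(x + p z)^3 = x^3 + p G(z), and the difference quotient of G is 3 x^2 modulo p,
    a unit. So G is an isometry, hence onto; this takes the place of Newton iteration.\<close>
  define G where "G z = 3 * x\<^sup>2 * z + unif * (3 * x * z\<^sup>2 + unif * z ^ 3)" for z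
  have G: "(x + unif * z) ^ 3 = x ^ 3 + unif * G z" for z
    unfolding G_def by Groebner_Basis.algebra
  have "padic_isometry G"
  proof (rule padic_isometry_iff_norm)
    fix z z'
    let ?c = "3 * x\<^sup>2 + unif * (3 * x * (z + z') + unif * (z\<^sup>2 + z * z' + z'\<^sup>2))"
    have "G z - G z' = (z - z') * ?c"
      unfolding G_def by Groebner_Basis.algebra
    moreover have "padic_norm (3 * x\<^sup>2) = 1"
      by (simp add: padic_norm_mult padic_norm_power n3 x)
    hence "padic_norm ?c = 1"
      by (subst padic_norm_add_eq) (simp_all add: padic_norm_lt_1_iff)
    ultimately show "padic_norm (G z - G z') = padic_norm (z - z')"
      by (simp add: padic_norm_mult)
  qed
  hence "surj G"
    by (rule padic_isometry_surj)
  from xy obtain t where "y - x ^ 3 = unif * t" ..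
  hence t: "y = x ^ 3 + unif * t"
    by (simp add: algebra_simps)
  moreover obtain z where "t = G z"
    using \<open>surj G\<close> by (rule surjE)
  ultimately have "y = (x + unif * z) ^ 3"
    by (simp add: G)
  thus ?thesis
    by (rule that)
qed

text \<open>A square root \<omega> of -3 amounts to a primitive cube root of unity \<zeta>, via
  \<omega> = 2 \<zeta> + 1. If p is 2 modulo 3, Fermat gives \<zeta> = 1 modulo p, and p would
  divide (\<zeta> - 1)(-\<zeta> - 2) = 3. If p is 1 modulo 3, a power of a primitive root can be
  lifted.\<close>

lemma sqrt_minus_3_iff:
  assumes "CARD('p::prime_card) \<ge> 3"
  shows "(\<exists>\<omega> :: 'p padic_int. \<omega>\<^sup>2 = -3) \<longleftrightarrow> CARD('p) mod 3 = 1"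
proof
  assume "\<exists>\<omega> :: 'p padic_int. \<omega>\<^sup>2 = -3"
  then obtain \<omega> :: "'p padic_int" where \<omega>: "\<omega>\<^sup>2 = -3" ..
  obtain t2 :: "'p padic_int" where t2: "2 * t2 = 1"
    using padic_norm_2[OF assms] by (rule ex_padic_inverse)
  define \<zeta> where "\<zeta> = (\<omega> - 1) * t2"
  have \<zeta>: "\<zeta>\<^sup>2 + \<zeta> + 1 = 0"
    using \<omega> t2 unfolding \<zeta>_def by Groebner_Basis.algebra
  have \<zeta>3: "\<zeta> ^ 3 = 1"
    using \<zeta> by Groebner_Basis.algebra
  have not3: "CARD('p) \<noteq> 3"
    by (rule CARD_neq_3_of_sqrt_minus_3[OF \<omega>])
  have "CARD('p) mod 3 \<noteq> 0"
  proof
    assume "CARD('p) mod 3 = 0"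
    hence "3 dvd CARD('p)"
      by auto
    thus False
      using prime_card[where 'a = 'p] not3 by (metis prime_nat_iff numeral_eq_one_iff semiring_norm(86))
  qed
  moreover have "CARD('p) mod 3 \<noteq> 2"
  proof
    assume mod: "CARD('p) mod 3 = 2"
    define k where "k = CARD('p) div 3"
    have k: "CARD('p) - 1 = 3 * k + 1"
      using mod unfolding k_def by presburger
    have "1 = \<zeta> * \<zeta>\<^sup>2"
      using \<zeta>3 by Groebner_Basis.algebra
    hence "\<zeta> dvd 1" ..
    hence res0: "padic_residue \<zeta> 1 \<noteq> 0"
      by (simp only: padic_unit_iff not_False_eq_True)
    define a where "a = nat (padic_residue \<zeta> 1)"
    have a: "int a = padic_residue \<zeta> 1"
      using padic_residue_range[of \<zeta> 1] by (simp add: a_def)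
    have "\<not> CARD('p) dvd a"
    proof
      assume "CARD('p) dvd a"
      hence "int CARD('p) dvd padic_residue \<zeta> 1"
        unfolding a[symmetric] by simp
      hence "padic_residue \<zeta> 1 = 0"
        using padic_residue_compat(2)[of \<zeta> 1] by (simp add: dvd_eq_mod_eq_0)
      thus False
        using res0 by contradiction
    qed
    hence "[a ^ (CARD('p) - 1) = 1] (mod CARD('p))"
      using prime_card[where 'a = 'p] by (intro fermat_theorem)
    hence "[int (a ^ (CARD('p) - 1)) = int 1] (mod int CARD('p))"
      by (simp only: cong_int_iff)
    hence "int CARD('p) dvd int a ^ (CARD('p) - 1) - 1"
      by (simp add: cong_iff_dvd_diff)
    then obtain m where "int a ^ (CARD('p) - 1) - 1 = int CARD('p) * m" ..
    hence m: "int a ^ (CARD('p) - 1) = 1 + int CARD('p) * m"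
      by simp
    define b where "b = (of_nat a :: 'p padic_int)"
    have "b ^ (CARD('p) - 1) = of_int (int a ^ (CARD('p) - 1))"
      by (simp add: b_def)
    hence "unif dvd b ^ (CARD('p) - 1) - 1"
      unfolding m by (simp add: unif_def)
    moreover have "unif dvd b - \<zeta>"
    proof -
      have "padic_residue b 1 = int a mod int CARD('p) ^ 1"
        using padic_residue_of_int[of "int a" 1, where 'p = 'p] by (simp add: b_def)
      also have "\<dots> = padic_residue \<zeta> 1"
        unfolding a by (rule padic_residue_compat)
      finally show ?thesis
        using unif_power_dvd_iff[of 1 "b - \<zeta>"] by (simp add: padic_residue_eq_iff_diff)
    qed
    hence "unif dvd b ^ (CARD('p) - 1) - \<zeta> ^ (CARD('p) - 1)"
      by (simp add: power_diff_sumr2)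
    ultimately have "unif dvd (b ^ (CARD('p) - 1) - 1) - (b ^ (CARD('p) - 1) - \<zeta> ^ (CARD('p) - 1))"
      by (rule dvd_diff)
    hence "unif dvd \<zeta> ^ (CARD('p) - 1) - 1"
      by simp
    also have "\<zeta> ^ (CARD('p) - 1) = \<zeta>"
      unfolding k by (simp add: power_mult \<zeta>3)
    finally have "unif dvd (\<zeta> - 1) * (- (\<zeta> + 2))"
      by simp
    also have "(\<zeta> - 1) * (- (\<zeta> + 2)) = 3"
      using \<zeta> by Groebner_Basis.algebra
    finally have "padic_norm (3 :: 'p padic_int) < 1"
      by (simp add: padic_norm_lt_1_iff)
    thus False
      using not3 by (simp add: padic_norm_3)
  qed
  ultimately show "CARD('p) mod 3 = 1"
    by presburger
next
  assume mod: "CARD('p) mod 3 = 1"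
  have not3: "CARD('p) \<noteq> 3"
    using mod by auto
  define k where "k = CARD('p) div 3"
  have k: "CARD('p) - 1 = 3 * k" "k > 0"
    using mod assms unfolding k_def by presburger+
  obtain g where g: "residue_primroot CARD('p) g"
    using prime_primitive_root_exists[of "CARD('p)"] prime_card[where 'a = 'p] prime_gt_1_nat by blast
  have ord: "Pocklington.ord CARD('p) g = CARD('p) - 1" and cop: "coprime CARD('p) g"
    using g prime_card[where 'a = 'p] by (auto simp: residue_primroot_def totient_prime)
  have "\<not> [g ^ k = 1] (mod CARD('p))"
  proof
    assume "[g ^ k = 1] (mod CARD('p))"
    hence "Pocklington.ord CARD('p) g dvd k"
      using ord_divides by blast
    hence "3 * k dvd k"
      by (simp only: ord k(1))
    hence "3 * k \<le> k"
      using k(2) by (rule dvd_imp_le)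
    thus False
      using k(2) by simp
  qed
  moreover have "[g ^ (CARD('p) - 1) = 1] (mod CARD('p))"
    unfolding ord_divides ord by (rule dvd_refl)
  ultimately have z: "\<not> int CARD('p) dvd int (g ^ k) - 1" "int CARD('p) dvd int (g ^ k) ^ 3 - 1"
    unfolding k(1) mult.commute[of 3] power_mult
    using cong_int_iff[of "g ^ k" 1 "CARD('p)"] cong_int_iff[of "(g ^ k) ^ 3" 1 "CARD('p)"]
    by (simp_all add: cong_iff_dvd_diff)
  \<comment> \<open>The class of x has order 3 modulo p. Hensel moves x to a true cube root of 1 in
    the same class, hence different from 1.\<close>
  define x where "x = (of_int (int (g ^ k)) :: 'p padic_int)"
  have dvd_iff: "unif dvd (of_int m :: 'p padic_int) \<longleftrightarrow> int CARD('p) dvd m" for m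
    using unif_power_dvd_iff[of 1 "of_int m :: 'p padic_int"] by (simp add: padic_residue_of_int dvd_eq_mod_eq_0)
  have "unif dvd (of_int (int (g ^ k) ^ 3 - 1) :: 'p padic_int)"
    unfolding dvd_iff by (rule z(2))
  hence x3: "unif dvd x ^ 3 - 1"
    by (simp add: x_def)
  have x1: "\<not> unif dvd x - 1"
    using z(1) dvd_iff[of "int (g ^ k) - 1"] by (simp add: x_def)
  have "padic_norm x = 1"
  proof (rule ccontr)
    assume "padic_norm x \<noteq> 1"
    hence "unif dvd x"
      using padic_norm_le_1[of x] by (simp flip: padic_norm_lt_1_iff)
    hence "unif dvd x ^ 3"
      by (simp add: dvd_power_le power3_eq_cube)
    hence "unif dvd x ^ 3 - (x ^ 3 - 1)"
      using x3 by (rule dvd_diff)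
    hence "padic_norm (1 :: 'p padic_int) < 1"
      unfolding padic_norm_lt_1_iff by simp
    thus False by simp
  qed
  moreover have "unif dvd 1 - x ^ 3"
    using x3 dvd_minus_iff[of unif "x ^ 3 - 1"] by simp
  moreover have "padic_norm (3 :: 'p padic_int) = 1"
    using not3 by (simp add: padic_norm_3)
  ultimately obtain t where t: "1 = (x + unif * t) ^ 3"
    using padic_cube_Hensel by blast
  define \<zeta> where "\<zeta> = x + unif * t"
  have "\<zeta> \<noteq> 1"
  proof
    assume "\<zeta> = 1"
    hence "x - 1 = unif * (- t)"
      unfolding \<zeta>_def by (simp add: algebra_simps eq_neg_iff_add_eq_0)
    thus False
      using x1 by (metis dvd_triv_left)
  qed
  moreover have "(\<zeta> - 1) * (\<zeta>\<^sup>2 + \<zeta> + 1) = 0"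
    using t unfolding \<zeta>_def[symmetric] by Groebner_Basis.algebra
  ultimately have "\<zeta>\<^sup>2 + \<zeta> + 1 = 0"
    by simp
  hence "(2 * \<zeta> + 1)\<^sup>2 = -3"
    by Groebner_Basis.algebra
  thus "\<exists>\<omega> :: 'p padic_int. \<omega>\<^sup>2 = -3" ..
qed

text \<open>In y^3 - z^3 = (y - z)(3 y^2 + (z - y)(2 y + z)) the term 3 y^2 dominates, as |z - y| <
  |x| = |y|.\<close>

lemma padic_cube_diff_norm:
  fixes x y z :: "'p::prime_card padic_int"
  assumes n3: "padic_norm (3 :: 'p padic_int) = 1"
    and y: "padic_norm (y - x) < padic_norm x" and z: "padic_norm (z - x) < padic_norm x"
  shows "padic_norm (y ^ 3 - z ^ 3) = (padic_norm x)\<^sup>2 * padic_norm (y - z)"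
proof -
  have ny: "padic_norm y = padic_norm x" and nz: "padic_norm z = padic_norm x"
    using y z padic_norm_eq_of_close[of x y] padic_norm_eq_of_close[of x z]
    by (simp_all add: padic_norm_diff_commute)
  have "padic_norm ((z - x) - (y - x)) < padic_norm x"
    using z y by (rule padic_norm_diff_less)
  hence zy: "padic_norm (z - y) < padic_norm x"
    by simp
  have x0: "0 < padic_norm x"
    using y padic_norm_nonneg[of "y - x"] by linarith
  have yz: "padic_norm (2 * y + z) \<le> padic_norm x"
  proof (rule padic_norm_add_le')
    show "padic_norm (2 * y) \<le> padic_norm x"
      using mult_right_mono[OF padic_norm_le_1[of 2] padic_norm_nonneg[of y]] by (simp add: padic_norm_mult ny)
  qed (simp add: nz)
  have "padic_norm ((z - y) * (2 * y + z)) < padic_norm x * padic_norm x"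
    unfolding padic_norm_mult
    by (rule le_less_trans[OF mult_left_mono[OF yz padic_norm_nonneg] mult_strict_right_mono[OF zy x0]])
  moreover have "padic_norm (3 * y\<^sup>2) = padic_norm x * padic_norm x"
    by (simp add: padic_norm_mult padic_norm_power n3 ny power2_eq_square)
  ultimately have "padic_norm (3 * y\<^sup>2 + (z - y) * (2 * y + z)) = (padic_norm x)\<^sup>2"
    by (subst padic_norm_add_eq) (simp_all add: power2_eq_square)
  moreover have "y ^ 3 - z ^ 3 = (3 * y\<^sup>2 + (z - y) * (2 * y + z)) * (y - z)"
    by Groebner_Basis.algebra
  ultimately show ?thesis
    by (simp only: padic_norm_mult)
qed

definition cubes_integral :: "'p::prime_card itself \<Rightarrow> ennreal" where
  "cubes_integral _ = (\<integral>\<^sup>+x. indicator (padic_cubes :: 'p padic_int set) x \<partial>haar_measure)"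

text \<open>The cubing map is 3-to-1 away from \<open>0\<close> and scales by \<open>\<bar>3 x\<^sup>2\<bar> = \<bar>x\<bar>\<^sup>2\<close>.\<close>

lemma cubes_integral:
  fixes \<omega> :: "'p::prime_card padic_int"
  assumes p: "CARD('p) \<ge> 3" and \<omega>: "\<omega>\<^sup>2 = -3"
  shows "3 * cubes_integral TYPE('p) = norm_sq_integral TYPE('p)"
proof -
  let ?M = "haar_measure :: 'p padic_int measure"
  have n3: "padic_norm (3 :: 'p padic_int) = 1"
    using CARD_neq_3_of_sqrt_minus_3[OF \<omega>] by (simp add: padic_norm_3)
  obtain t2 :: "'p padic_int" where t2: "2 * t2 = 1"
    using padic_norm_2[OF p] by (rule ex_padic_inverse)
  let ?D = "{x :: 'p padic_int. x \<noteq> 0}"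
  have fib: "finite {x \<in> ?D. x ^ 3 = y}" for y :: "'p padic_int"
  proof (cases "\<exists>c. c \<noteq> 0 \<and> y = c ^ 3")
    case True
    then obtain c where "c \<noteq> 0" "y = c ^ 3"
      by blast
    hence "finite {x. x ^ 3 = y}"
      using cube_roots(1)[OF \<omega> t2] by simp
    thus ?thesis
      by (rule rev_finite_subset) auto
  next
    case False
    hence empty: "{x \<in> ?D. x ^ 3 = y} = {}"
      by auto
    show ?thesis
      unfolding empty by simp
  qed
  have "(\<integral>\<^sup>+x. ennreal ((padic_norm x)\<^sup>2) * 1 * indicator ?D x \<partial>?M) =
    (\<integral>\<^sup>+y. (\<Sum>x | x \<in> ?D \<and> x ^ 3 = y. 1) \<partial>?M)"
  proof (rule padic_area_formula)
    fix x :: "'p padic_int"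
    assume "x \<in> ?D"
    hence x0: "0 < padic_norm x"
      by simp
    obtain N where N: "1 / real CARD('p) ^ N < padic_norm x"
      using ex_inverse_CARD_power_less[OF x0, where 'p = 'p] ..
    show "\<exists>N. \<forall>y z. padic_residue y N = padic_residue x N \<longrightarrow> padic_residue z N = padic_residue x N \<longrightarrow>
      y \<in> ?D \<and> (padic_norm y)\<^sup>2 = (padic_norm x)\<^sup>2 \<and>
      padic_norm (y ^ 3 - z ^ 3) = (padic_norm x)\<^sup>2 * padic_norm (y - z)"
    proof (intro exI[of _ N] allI impI)
      fix y z :: "'p padic_int"
      assume "padic_residue y N = padic_residue x N" "padic_residue z N = padic_residue x N"
      hence y: "padic_norm (y - x) < padic_norm x" and z: "padic_norm (z - x) < padic_norm x"
        using N unfolding padic_residue_eq_iff_norm by simp_all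
      have "padic_norm y = padic_norm x"
        using y padic_norm_eq_of_close[of x y] by (simp add: padic_norm_diff_commute)
      thus "y \<in> ?D \<and> (padic_norm y)\<^sup>2 = (padic_norm x)\<^sup>2 \<and>
          padic_norm (y ^ 3 - z ^ 3) = (padic_norm x)\<^sup>2 * padic_norm (y - z)"
        using padic_cube_diff_norm[OF n3 y z] \<open>x \<in> ?D\<close> by auto
    qed
  qed (use fib in auto)
  also have "(\<integral>\<^sup>+y. (\<Sum>x | x \<in> ?D \<and> x ^ 3 = y. 1) \<partial>?M) = (\<integral>\<^sup>+y. 3 * indicator padic_cubes y \<partial>?M)"
  proof (rule nn_integral_cong_AE, rule AE_mp[OF AE_haar_padic_not_eq[of 0]], rule AE_I2, rule impI)
    fix y :: "'p padic_int"
    assume y: "y \<noteq> 0"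
    show "(\<Sum>x | x \<in> ?D \<and> x ^ 3 = y. 1) = (3 :: ennreal) * indicator padic_cubes y"
    proof (cases "y \<in> padic_cubes")
      case True
      then obtain c where c: "y = c ^ 3"
        by (auto simp: padic_cubes_def)
      hence "c \<noteq> 0"
        using y by auto
      have "{x. x \<in> ?D \<and> x ^ 3 = y} = {x. x ^ 3 = c ^ 3}"
        using y unfolding c by auto
      thus ?thesis
        using True cube_roots(2)[OF \<omega> t2 \<open>c \<noteq> 0\<close>] by simp
    next
      case False
      hence empty: "{x. x \<in> ?D \<and> x ^ 3 = y} = {}"
        by (auto simp: padic_cubes_def)
      show ?thesis
        unfolding empty using False by simp
    qed
  qed
  also have "\<dots> = 3 * cubes_integral TYPE('p)"
    unfolding cubes_integral_def by (rule nn_integral_cmult) measurable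
  also have "(\<integral>\<^sup>+x. ennreal ((padic_norm x)\<^sup>2) * 1 * indicator ?D x \<partial>?M) = norm_sq_integral TYPE('p)"
    unfolding norm_sq_integral_def by (intro nn_integral_cong) (auto split: split_indicator)
  finally show ?thesis ..
qed

text \<open>A cube root of u^3 x has norm at most |u|, so it can be divided by u.\<close>

lemma padic_cubes_mult_iff:
  fixes u x :: "'p::prime_card padic_int"
  assumes "u \<noteq> 0"
  shows "u ^ 3 * x \<in> padic_cubes \<longleftrightarrow> x \<in> padic_cubes"
proof
  assume "u ^ 3 * x \<in> padic_cubes"
  then obtain y where y: "u ^ 3 * x = y ^ 3"
    by (auto simp: padic_cubes_def)
  hence "padic_norm u ^ 3 * padic_norm x = padic_norm y ^ 3"
    by (metis padic_norm_mult padic_norm_power)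
  moreover have "padic_norm u ^ 3 * padic_norm x \<le> padic_norm u ^ 3"
    by (intro mult_left_le padic_norm_le_1) simp
  ultimately have "padic_norm y ^ 3 \<le> padic_norm u ^ 3"
    by simp
  hence "padic_norm y \<le> padic_norm u"
    by (rule power_le_imp_le_base[of _ 2, simplified]) simp
  then obtain z where "y = u * z"
    unfolding padic_dvd_iff_norm[symmetric] ..
  hence "x = z ^ 3"
    using y assms by (simp add: power_mult_distrib)
  thus "x \<in> padic_cubes"
    by (simp add: padic_cubes_def)
next
  assume "x \<in> padic_cubes"
  then obtain y where "x = y ^ 3"
    by (auto simp: padic_cubes_def)
  hence "u ^ 3 * x = (u * y) ^ 3"
    by (simp add: power_mult_distrib)
  thus "u ^ 3 * x \<in> padic_cubes"
    unfolding padic_cubes_def by (rule range_eqI)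
qed

text \<open>The valuation of a nonzero cube is a multiple of 3.\<close>

lemma unif_power2_dvd_of_cube:
  fixes x :: "'p::prime_card padic_int"
  assumes "unif * x \<in> padic_cubes"
  shows "unif\<^sup>2 dvd x"
proof -
  obtain y where y: "unif * x = y ^ 3"
    using assms by (auto simp: padic_cubes_def)
  have "padic_norm y ^ 3 < 1"
    using padic_norm_lt_1_iff[of "y ^ 3"] by (simp add: y[symmetric] flip: padic_norm_power)
  hence "padic_norm y < 1"
    using padic_norm_le_1[of y] by (cases "padic_norm y = 1") auto
  then obtain z where "y = unif * z"
    unfolding padic_norm_lt_1_iff ..
  hence "unif * x = unif * (unif\<^sup>2 * z ^ 3)"
    using y by Groebner_Basis.algebra
  hence "x = unif\<^sup>2 * z ^ 3"
    by (simp add: unif_nonzero)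
  thus ?thesis by simp
qed

text \<open>For a unit, being a cube depends only on its class modulo p, by Hensel.\<close>

lemma digit_cube_iff:
  fixes x :: "'p::prime_card padic_int"
  assumes n3: "padic_norm (3 :: 'p padic_int) = 1" and i: "i \<in> {1..<int CARD('p)}"
  shows "of_int i + unif * x \<in> padic_cubes \<longleftrightarrow> (of_int i :: 'p padic_int) \<in> padic_cubes"
proof -
  have *: "y' \<in> padic_cubes" if y: "y \<in> padic_cubes" "padic_norm y = 1" and y': "unif dvd y' - y" for y y' :: "'p padic_int"
  proof -
    obtain z where z: "y = z ^ 3"
      using y(1) by (auto simp: padic_cubes_def)
    have "z * z\<^sup>2 = y"
      unfolding z by Groebner_Basis.algebra
    hence "z dvd y"
      by auto
    moreover have "y dvd 1"
      using y(2) by (simp add: padic_unit_iff_norm)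
    ultimately have "padic_norm z = 1"
      unfolding padic_unit_iff_norm[symmetric] by (rule dvd_trans)
    then obtain t where "y' = (z + unif * t) ^ 3"
      using y' unfolding z by (rule padic_cube_Hensel[OF n3])
    thus ?thesis
      unfolding padic_cubes_def by (rule range_eqI)
  qed
  have "padic_norm (of_int i :: 'p padic_int) = 1"
    using padic_norm_of_int_digit[OF i, of 0] by simp
  thus ?thesis
    using *[of "of_int i + unif * x" "of_int i"] *[of "of_int i" "of_int i + unif * x"]
      padic_norm_of_int_digit[OF i, of x] by auto
qed

text \<open>The number of nonzero cubic residues modulo p when |3| = 1. It serves as an unknown, to
  be eliminated between \<open>cubes_integral\<close> and
  \<open>cubes_integral_digits\<close>.\<close>

definition cubic_residues_count :: "'p::prime_card itself \<Rightarrow> ennreal" where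
  "cubic_residues_count _ = (\<Sum>i\<in>{1..<int CARD('p)}. indicator (padic_cubes :: 'p padic_int set) (of_int i))"

text \<open>p x is a cube only if x = p^2 y, and then p^3 y is a cube exactly when y is.\<close>

lemma nn_integral_unif_cubes:
  "(\<integral>\<^sup>+x. indicator padic_cubes (unif * x :: 'p::prime_card padic_int) \<partial>haar_measure) =
    ennreal (1 / real CARD('p) ^ 2) * cubes_integral TYPE('p)"
proof -
  let ?f = "\<lambda>x :: 'p padic_int. indicator padic_cubes (unif * x) :: ennreal"
  have "(\<integral>\<^sup>+x. ?f x \<partial>haar_measure) = (\<integral>\<^sup>+x. ?f x * indicator {x. unif\<^sup>2 dvd x - 0} x \<partial>haar_measure)"
    using unif_power2_dvd_of_cube by (intro nn_integral_cong) (auto split: split_indicator)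
  also have "\<dots> = ennreal (padic_norm (unif\<^sup>2 :: 'p padic_int)) * (\<integral>\<^sup>+x. ?f (0 + unif\<^sup>2 * x) \<partial>haar_measure)"
    by (rule nn_integral_padic_affine) (simp_all add: unif_nonzero)
  also have "(\<lambda>x :: 'p padic_int. ?f (0 + unif\<^sup>2 * x)) = indicator padic_cubes"
  proof
    fix x :: "'p padic_int"
    have "unif * (0 + unif\<^sup>2 * x) = unif ^ 3 * x"
      by (simp add: power2_eq_square power3_eq_cube mult.assoc)
    thus "?f (0 + unif\<^sup>2 * x) = indicator padic_cubes x"
      using padic_cubes_mult_iff[OF unif_nonzero, of x] by (simp only: indicator_def)
  qed
  finally show ?thesis
    by (simp add: cubes_integral_def padic_norm_power padic_norm_unif power_one_over)
qed

lemma cubes_integral_digits: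
  assumes n3: "padic_norm (3 :: 'p::prime_card padic_int) = 1"
  shows "cubes_integral TYPE('p) = ennreal (1 / real CARD('p)) *
    (ennreal (1 / real CARD('p) ^ 2) * cubes_integral TYPE('p) + cubic_residues_count TYPE('p))"
proof -
  have "cubes_integral TYPE('p) = ennreal (1 / real CARD('p)) *
    (\<Sum>i\<in>{0..<int CARD('p)}. \<integral>\<^sup>+x. indicator padic_cubes (of_int i + unif * x :: 'p padic_int) \<partial>haar_measure)"
    unfolding cubes_integral_def by (rule nn_integral_padic_digit) measurable
  also have "(\<Sum>i\<in>{0..<int CARD('p)}. \<integral>\<^sup>+x. indicator padic_cubes (of_int i + unif * x :: 'p padic_int) \<partial>haar_measure) =
    ennreal (1 / real CARD('p) ^ 2) * cubes_integral TYPE('p) + cubic_residues_count TYPE('p)"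
  proof -
    have "(indicator padic_cubes (of_int i + unif * x) :: ennreal) = indicator padic_cubes (of_int i :: 'p padic_int)"
      if "i \<in> {1..<int CARD('p)}" for i and x :: "'p padic_int"
      using digit_cube_iff[OF n3 that, of x] by (simp add: indicator_def)
    thus ?thesis
      unfolding sum_digits_split cubic_residues_count_def
      by (intro arg_cong2[where f = "(+)"] sum.cong refl) (simp_all add: nn_integral_unif_cubes)
  qed
  finally show ?thesis .
qed

section \<open>Cubes of the form a^3 + b\<close>

definition unit_cubes_integral :: "'p::prime_card itself \<Rightarrow> ennreal" where
  "unit_cubes_integral _ = (\<integral>\<^sup>+x. ennreal ((padic_norm (x - 1 :: 'p padic_int))\<^sup>2) * indicator padic_cubes x \<partial>haar_measure)"

text \<open>Compared with the measure of the cubes, the weight |x - 1|^2 differs from 1 only on the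
  class of 1, which consists of cubes. There the mass 1 / p is replaced by p^(-3) times the integral
  of |x|^2. The 1 / p stands on the left because subtraction in \<open>ennreal\<close> is
  truncated.\<close>

lemma unit_cubes_integral_digits:
  assumes n3: "padic_norm (3 :: 'p::prime_card padic_int) = 1"
  shows "unit_cubes_integral TYPE('p) + ennreal (1 / real CARD('p)) =
    cubes_integral TYPE('p) + ennreal (1 / real CARD('p)) * (ennreal (1 / real CARD('p) ^ 2) * norm_sq_integral TYPE('p))"
proof -
  let ?f = "\<lambda>x :: 'p padic_int. ennreal ((padic_norm (x - 1))\<^sup>2) * indicator padic_cubes x"
  let ?p = "ennreal (1 / real CARD('p))" and ?p2 = "ennreal (1 / real CARD('p) ^ 2)"
  have split: "{1..<int CARD('p)} = insert 1 {2..<int CARD('p)}"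
    using CARD_prime_gt_1[where 'p = 'p] by auto
  have one: "(1 :: 'p padic_int) \<in> padic_cubes"
    unfolding padic_cubes_def by (rule range_eqI[of _ _ 1]) simp
  have f0: "(\<integral>\<^sup>+x. ?f (of_int 0 + unif * x) \<partial>haar_measure) = ?p2 * cubes_integral TYPE('p)"
  proof -
    have "padic_norm (unif * x - 1 :: 'p padic_int) = 1" for x
      using padic_norm_add_eq[of "unif * x" "-1"] padic_norm_lt_1_iff[of "unif * x"] by simp
    thus ?thesis
      by (simp add: nn_integral_unif_cubes)
  qed
  have f1: "(\<integral>\<^sup>+x. ?f (of_int 1 + unif * x) \<partial>haar_measure) = ?p2 * norm_sq_integral TYPE('p)"
  proof -
    have "(1::int) \<in> {1..<int CARD('p)}"
      using CARD_prime_gt_1[where 'p = 'p] by simp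
    hence "1 + unif * x \<in> (padic_cubes :: 'p padic_int set)" for x
      using digit_cube_iff[OF n3, of 1 x] one by simp
    thus ?thesis
      by (simp add: nn_integral_norm_sq_unif)
  qed
  have f2: "(\<integral>\<^sup>+x. ?f (of_int i + unif * x) \<partial>haar_measure) = indicator (padic_cubes :: 'p padic_int set) (of_int i)"
    if i: "i \<in> {2..<int CARD('p)}" for i
  proof -
    have "padic_norm (of_int i + unif * x - 1 :: 'p padic_int) = 1" for x
      using padic_norm_of_int_digit[of "i - 1" x] i by (simp add: algebra_simps)
    moreover have "of_int i + unif * x \<in> padic_cubes \<longleftrightarrow> (of_int i :: 'p padic_int) \<in> padic_cubes" for x :: "'p padic_int"
      using i by (intro digit_cube_iff[OF n3]) auto
    ultimately show ?thesis
      by (simp add: indicator_def)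
  qed
  have "unit_cubes_integral TYPE('p) = ?p *
    (\<Sum>i\<in>{0..<int CARD('p)}. \<integral>\<^sup>+x. ?f (of_int i + unif * x) \<partial>haar_measure)"
    unfolding unit_cubes_integral_def by (rule nn_integral_padic_digit) measurable
  also have "(\<Sum>i\<in>{0..<int CARD('p)}. \<integral>\<^sup>+x. ?f (of_int i + unif * x) \<partial>haar_measure) =
    ?p2 * cubes_integral TYPE('p) + (?p2 * norm_sq_integral TYPE('p) +
      (\<Sum>i\<in>{2..<int CARD('p)}. indicator (padic_cubes :: 'p padic_int set) (of_int i)))"
  proof -
    let ?h = "\<lambda>i. \<integral>\<^sup>+x. ?f (of_int i + unif * x) \<partial>haar_measure"
    have "sum ?h {0..<int CARD('p)} = ?h 0 + sum ?h {1..<int CARD('p)}"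
      by (rule sum_digits_split)
    also have "sum ?h {1..<int CARD('p)} = ?h 1 + sum ?h {2..<int CARD('p)}"
      unfolding split by (rule sum.insert) auto
    finally show ?thesis
      by (simp only: f0 f1 sum.cong[OF refl f2])
  qed
  finally have "unit_cubes_integral TYPE('p) + ?p = ?p * (?p2 * cubes_integral TYPE('p) + (?p2 * norm_sq_integral TYPE('p) +
      (\<Sum>i\<in>{2..<int CARD('p)}. indicator (padic_cubes :: 'p padic_int set) (of_int i))) + 1)"
    by (simp add: distrib_left)
  also have "\<dots> = ?p * (?p2 * cubes_integral TYPE('p) + cubic_residues_count TYPE('p)) + ?p * (?p2 * norm_sq_integral TYPE('p))"
    unfolding cubic_residues_count_def split using one by (simp add: distrib_left add_ac)
  finally show ?thesis
    by (simp only: cubes_integral_digits[OF n3, symmetric])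
qed

definition cubes_line_integral :: "'p::prime_card padic_int \<Rightarrow> ennreal" where
  "cubes_line_integral a = (\<integral>\<^sup>+b. ennreal ((padic_norm b)\<^sup>2) * indicator padic_cubes (a ^ 3 + b) \<partial>haar_measure)"

definition cubes_plane_integral :: "'p::prime_card itself \<Rightarrow> ennreal" where
  "cubes_plane_integral _ = (\<integral>\<^sup>+a. cubes_line_integral (a :: 'p padic_int) \<partial>haar_measure)"

lemma borel_measurable_cubes_line_integral [measurable]:
  "(cubes_line_integral :: 'p::prime_card padic_int \<Rightarrow> ennreal) \<in> borel_measurable borel"
  unfolding cubes_line_integral_def[abs_def] indicator_def by measurable

text \<open>Homogeneity: for a unit a, the substitution b = a^3 x keeps the norm and reduces a^3 + b
  to 1 + x up to a cube.\<close>

lemma cubes_line_integral_unit: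
  fixes a :: "'p::prime_card padic_int"
  assumes a: "padic_norm a = 1"
  shows "cubes_line_integral a = unit_cubes_integral TYPE('p)"
proof -
  let ?f = "\<lambda>b. ennreal ((padic_norm b)\<^sup>2) * indicator padic_cubes (a ^ 3 + b)"
  let ?g = "\<lambda>x :: 'p padic_int. ennreal ((padic_norm (x - 1))\<^sup>2) * indicator padic_cubes x"
  have a0: "a \<noteq> 0"
    using a by auto
  have "a ^ 3 + a ^ 3 * x \<in> padic_cubes \<longleftrightarrow> 1 + x \<in> padic_cubes" for x
    using padic_cubes_mult_iff[OF a0, of "1 + x"] by (simp add: distrib_left)
  hence fg: "?f (0 + a ^ 3 * x) = ?g (1 + x)" for x
    by (simp add: padic_norm_mult padic_norm_power a indicator_def)
  have "cubes_line_integral a = (\<integral>\<^sup>+x. ?f (0 + a ^ 3 * x) \<partial>haar_measure)"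
    unfolding cubes_line_integral_def
    by (rule nn_integral_padic_unit_affine[symmetric]) (measurable, simp add: padic_norm_power a)
  also have "\<dots> = (\<integral>\<^sup>+x. ?g (1 + x) \<partial>haar_measure)"
    unfolding fg ..
  also have "\<dots> = unit_cubes_integral TYPE('p)"
    unfolding unit_cubes_integral_def by (rule nn_integral_padic_translate) measurable
  finally show ?thesis .
qed

text \<open>If p divides b and (p a)^3 + b is a cube, then p^3 divides b. Writing b = p^3 x costs
  p^(-3) in measure and p^(-6) in the integrand; one factor p^(-1) is common to all digits, which
  leaves p^(-8). For the other digits only the class of b modulo p matters.\<close>

lemma cubes_line_integral_unif:
  fixes a :: "'p::prime_card padic_int"
  assumes n3: "padic_norm (3 :: 'p padic_int) = 1"
  shows "cubes_line_integral (unif * a) = ennreal (1 / real CARD('p)) *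
    (ennreal (1 / real CARD('p) ^ 8) * cubes_line_integral a + cubic_residues_count TYPE('p))"
proof -
  let ?f = "\<lambda>b. ennreal ((padic_norm b)\<^sup>2) * indicator padic_cubes ((unif * a) ^ 3 + b)"
  let ?g = "\<lambda>b. ennreal ((padic_norm b)\<^sup>2) * indicator padic_cubes (a ^ 3 + b)"
  let ?h = "\<lambda>i. \<integral>\<^sup>+x. ?f (of_int i + unif * x) \<partial>haar_measure"
  have h0: "?h 0 = ennreal (1 / real CARD('p) ^ 8) * cubes_line_integral a"
  proof -
    have "?h 0 = (\<integral>\<^sup>+x. ?f (unif * x) * indicator {x. unif\<^sup>2 dvd x - 0} x \<partial>haar_measure)"
    proof (rule nn_integral_cong)
      fix x
      have "unif\<^sup>2 dvd x" if "(unif * a) ^ 3 + unif * x \<in> padic_cubes"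
      proof -
        have "(unif * a) ^ 3 + unif * x = unif * (unif\<^sup>2 * a ^ 3 + x)"
          by Groebner_Basis.algebra
        hence "unif * (unif\<^sup>2 * a ^ 3 + x) \<in> padic_cubes"
          using that by (simp only:)
        hence "unif\<^sup>2 dvd unif\<^sup>2 * a ^ 3 + x"
          by (rule unif_power2_dvd_of_cube)
        thus ?thesis
          by (simp add: dvd_add_right_iff)
      qed
      thus "?f (of_int 0 + unif * x) = ?f (unif * x) * indicator {x. unif\<^sup>2 dvd x - 0} x"
        by (auto split: split_indicator)
    qed
    also have "\<dots> = ennreal (padic_norm (unif\<^sup>2 :: 'p padic_int)) * (\<integral>\<^sup>+x. ?f (unif * (0 + unif\<^sup>2 * x)) \<partial>haar_measure)"
      by (rule nn_integral_padic_affine) (measurable, simp add: unif_nonzero)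
    also have "(\<lambda>x. ?f (unif * (0 + unif\<^sup>2 * x))) = (\<lambda>x. ennreal (1 / real CARD('p) ^ 6) * ?g x)"
    proof
      fix x
      have "(unif * a) ^ 3 + unif * (0 + unif\<^sup>2 * x) = unif ^ 3 * (a ^ 3 + x)"
        by Groebner_Basis.algebra
      hence "indicator padic_cubes ((unif * a) ^ 3 + unif * (0 + unif\<^sup>2 * x)) = (indicator padic_cubes (a ^ 3 + x) :: ennreal)"
        using padic_cubes_mult_iff[OF unif_nonzero, of "a ^ 3 + x"] by (simp only: indicator_def)
      moreover have "(padic_norm (unif * (0 + unif\<^sup>2 * x)))\<^sup>2 = 1 / real CARD('p) ^ 6 * (padic_norm x)\<^sup>2"
        by (simp add: padic_norm_mult padic_norm_power padic_norm_unif power_mult_distrib power_divide flip: power_mult power_add)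
      hence "ennreal ((padic_norm (unif * (0 + unif\<^sup>2 * x)))\<^sup>2) = ennreal (1 / real CARD('p) ^ 6) * ennreal ((padic_norm x)\<^sup>2)"
        by (simp only: ennreal_mult zero_le_power2 divide_nonneg_nonneg zero_le_one zero_le_power of_nat_0_le_iff)
      ultimately show "?f (unif * (0 + unif\<^sup>2 * x)) = ennreal (1 / real CARD('p) ^ 6) * ?g x"
        by (simp only: mult.assoc)
    qed
    also have "(\<integral>\<^sup>+x. ennreal (1 / real CARD('p) ^ 6) * ?g x \<partial>haar_measure) =
        ennreal (1 / real CARD('p) ^ 6) * cubes_line_integral a"
      unfolding cubes_line_integral_def by (rule nn_integral_cmult) measurable
    also have "ennreal (padic_norm (unif\<^sup>2 :: 'p padic_int)) * (ennreal (1 / real CARD('p) ^ 6) * cubes_line_integral a) =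
        (ennreal (1 / real CARD('p) ^ 2) * ennreal (1 / real CARD('p) ^ 6)) * cubes_line_integral a"
      by (simp only: padic_norm_power padic_norm_unif power_one_over mult.assoc)
    also have "ennreal (1 / real CARD('p) ^ 2) * ennreal (1 / real CARD('p) ^ 6) = ennreal (1 / real CARD('p) ^ 8)"
      by (simp flip: ennreal_mult power_add)
    finally show ?thesis .
  qed
  have hi: "?h i = indicator (padic_cubes :: 'p padic_int set) (of_int i)" if i: "i \<in> {1..<int CARD('p)}" for i
  proof -
    have "indicator padic_cubes ((unif * a) ^ 3 + (of_int i + unif * x)) = (indicator padic_cubes (of_int i :: 'p padic_int) :: ennreal)" for x
    proof -
      have "(unif * a) ^ 3 + (of_int i + unif * x) = of_int i + unif * (x + unif\<^sup>2 * a ^ 3)"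
        by Groebner_Basis.algebra
      thus ?thesis
        using digit_cube_iff[OF n3 i, of "x + unif\<^sup>2 * a ^ 3"] by (simp only: indicator_def)
    qed
    thus ?thesis
      by (simp add: padic_norm_of_int_digit[OF i])
  qed
  have "cubes_line_integral (unif * a) = ennreal (1 / real CARD('p)) * sum ?h {0..<int CARD('p)}"
    unfolding cubes_line_integral_def by (rule nn_integral_padic_digit) measurable
  also have "sum ?h {0..<int CARD('p)} = ?h 0 + sum ?h {1..<int CARD('p)}"
    by (rule sum_digits_split)
  finally show ?thesis
    by (simp only: h0 sum.cong[OF refl hi] cubic_residues_count_def)
qed

text \<open>The digit 0 of a gives the rescaled line integrals, every other digit the value at a
  unit.\<close>

lemma cubes_plane_integral_recursion:
  assumes n3: "padic_norm (3 :: 'p::prime_card padic_int) = 1"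
  shows "cubes_plane_integral TYPE('p) = ennreal (1 / real CARD('p)) *
    (ennreal (1 / real CARD('p)) * (ennreal (1 / real CARD('p) ^ 8) * cubes_plane_integral TYPE('p) + cubic_residues_count TYPE('p)) +
     ennreal (real CARD('p) - 1) * unit_cubes_integral TYPE('p))"
proof -
  let ?h = "\<lambda>i. \<integral>\<^sup>+x. cubes_line_integral (of_int i + unif * x :: 'p padic_int) \<partial>haar_measure"
  have p: "1 < CARD('p)"
    by (rule CARD_prime_gt_1)
  have h0: "?h 0 = ennreal (1 / real CARD('p)) *
    (ennreal (1 / real CARD('p) ^ 8) * cubes_plane_integral TYPE('p) + cubic_residues_count TYPE('p))"
  proof -
    have "?h 0 = (\<integral>\<^sup>+x. ennreal (1 / real CARD('p)) *
      (ennreal (1 / real CARD('p) ^ 8) * cubes_line_integral (x :: 'p padic_int) + cubic_residues_count TYPE('p)) \<partial>haar_measure)"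
      by (simp add: cubes_line_integral_unif[OF n3])
    also have "\<dots> = ennreal (1 / real CARD('p)) * (\<integral>\<^sup>+x.
      (ennreal (1 / real CARD('p) ^ 8) * cubes_line_integral (x :: 'p padic_int) + cubic_residues_count TYPE('p)) \<partial>haar_measure)"
      by (rule nn_integral_cmult) measurable
    also have "(\<integral>\<^sup>+x. (ennreal (1 / real CARD('p) ^ 8) * cubes_line_integral (x :: 'p padic_int) + cubic_residues_count TYPE('p)) \<partial>haar_measure) =
      (\<integral>\<^sup>+x. ennreal (1 / real CARD('p) ^ 8) * cubes_line_integral (x :: 'p padic_int) \<partial>haar_measure) +
      (\<integral>\<^sup>+x. cubic_residues_count TYPE('p) \<partial>(haar_measure :: 'p padic_int measure))"
      by (rule nn_integral_add) measurable
    also have "(\<integral>\<^sup>+x. ennreal (1 / real CARD('p) ^ 8) * cubes_line_integral (x :: 'p padic_int) \<partial>haar_measure) =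
      ennreal (1 / real CARD('p) ^ 8) * cubes_plane_integral TYPE('p)"
      unfolding cubes_plane_integral_def by (rule nn_integral_cmult) measurable
    finally show ?thesis
      by simp
  qed
  have hi: "?h i = unit_cubes_integral TYPE('p)" if i: "i \<in> {1..<int CARD('p)}" for i
    by (simp add: cubes_line_integral_unit[OF padic_norm_of_int_digit[OF i]])
  have "cubes_plane_integral TYPE('p) = ennreal (1 / real CARD('p)) * sum ?h {0..<int CARD('p)}"
    unfolding cubes_plane_integral_def by (rule nn_integral_padic_digit) measurable
  also have "sum ?h {0..<int CARD('p)} = ?h 0 + sum ?h {1..<int CARD('p)}"
    by (rule sum_digits_split)
  also have "sum ?h {1..<int CARD('p)} = (\<Sum>i\<in>{1..<int CARD('p)}. unit_cubes_integral TYPE('p))"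
    by (rule sum.cong[OF refl hi])
  also have "\<dots> = ennreal (real CARD('p) - 1) * unit_cubes_integral TYPE('p)"
    using p by (simp add: ennreal_of_nat_eq_real_of_nat of_nat_diff nat_diff_distrib)
  finally show ?thesis
    unfolding h0 .
qed

text \<open>I is the integral of |b|^2, Q the measure of the cubes, N the count of cubic residues, L
  the line integral at a unit, K the plane integral and m the integral sought. With u = 1 / q all
  relations become polynomial.\<close>

lemma flex_measure_recursion:
  fixes q I Q N L K m :: real
  assumes q: "q > 1" and I: "I = q ^ 2 / (q ^ 2 + q + 1)" and Q: "3 * Q = I"
    and N: "Q = 1 / q * (1 / q ^ 2 * Q + N)" and L: "L + 1 / q = Q + 1 / q * (1 / q ^ 2 * I)"
    and K: "K = 1 / q * (1 / q * (1 / q ^ 8 * K + N) + (q - 1) * L)" and m: "m + 3 / 8 * K = 1 / 2 * I"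
  shows "m = q ^ 2 * (3 * q ^ 6 + 4 * q ^ 2 - 4 * q + 4) / (8 * (q ^ 8 + q ^ 6 + q ^ 4 + q ^ 2 + 1))"
proof -
  define u where "u = 1 / q"
  have u: "u * q = 1"
    using q by (simp add: u_def)
  have upow: "1 / q ^ n = u ^ n" for n
    by (simp add: u_def power_one_over)
  \<comment> \<open>P = (q^10 - 1) / (q^2 - 1): the equation for K contains K again with the factor
    q^(-10), and q^2 - 1 divides the other side as well.\<close>
  define P where "P = q ^ 8 + q ^ 6 + q ^ 4 + q ^ 2 + 1"
  have P: "P > 0" and d: "q ^ 2 + q + 1 > 0"
    using q by (auto simp: P_def intro!: add_pos_pos)
  have I': "I * (q ^ 2 + q + 1) = q ^ 2"
    unfolding I using d by simp
  have N': "q * Q = u ^ 2 * Q + N"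
    using N[folded u_def, unfolded upow] u by Groebner_Basis.algebra
  have L': "L + u = Q + u * (u ^ 2 * I)"
    using L[folded u_def, unfolded upow] .
  have K': "q * K = u * (u ^ 8 * K + N) + (q - 1) * L"
    using K[folded u_def, unfolded upow] u by Groebner_Basis.algebra
  have K10: "q ^ 10 * K = K + q * (q ^ 7 * N) + (q - 1) * (q ^ 9 * L)"
  proof -
    have "q ^ 9 * (q * K) = q ^ 9 * (u * (u ^ 8 * K + N) + (q - 1) * L)"
      unfolding K' ..
    also have "\<dots> = (u * q) ^ 9 * K + (u * q) * q ^ 8 * N + (q - 1) * (q ^ 9 * L)"
      by Groebner_Basis.algebra
    finally have "q ^ 9 * (q * K) = K + q ^ 8 * N + (q - 1) * (q ^ 9 * L)"
      unfolding u by simp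
    thus ?thesis
      by Groebner_Basis.algebra
  qed
  have N7: "q ^ 7 * N = q ^ 8 * Q - q ^ 5 * Q"
  proof -
    have "q ^ 7 * N = q ^ 8 * Q - (u * q) ^ 2 * q ^ 5 * Q"
      using N' by Groebner_Basis.algebra
    thus ?thesis
      unfolding u by simp
  qed
  have L9: "q ^ 9 * L = q ^ 9 * Q + q ^ 6 * I - q ^ 8"
  proof -
    have "q ^ 9 * L = q ^ 9 * Q + (u * q) ^ 3 * q ^ 6 * I - (u * q) * q ^ 8"
      using L' by Groebner_Basis.algebra
    thus ?thesis
      unfolding u by simp
  qed
  have "3 * (q ^ 10 * K - K) = q * (q ^ 8 * (3 * Q) - q ^ 5 * (3 * Q)) + (q - 1) * (q ^ 9 * (3 * Q) + 3 * q ^ 6 * I - 3 * q ^ 8)"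
    unfolding K10 N7 L9 by Groebner_Basis.algebra
  hence "3 * (q ^ 10 * K - K) = I * (q ^ 9 - q ^ 6 + (q - 1) * (q ^ 9 + 3 * q ^ 6)) - 3 * (q - 1) * q ^ 8"
    unfolding Q by Groebner_Basis.algebra
  hence "3 * (q ^ 10 * K - K) * (q ^ 2 + q + 1) =
    (I * (q ^ 9 - q ^ 6 + (q - 1) * (q ^ 9 + 3 * q ^ 6)) - 3 * (q - 1) * q ^ 8) * (q ^ 2 + q + 1)"
    by (rule arg_cong)
  also have "\<dots> = (I * (q ^ 2 + q + 1)) * (q ^ 9 - q ^ 6 + (q - 1) * (q ^ 9 + 3 * q ^ 6)) - 3 * (q - 1) * q ^ 8 * (q ^ 2 + q + 1)"
    by Groebner_Basis.algebra
  also have "\<dots> = (q ^ 2 - 1) * (q ^ 8 * (q ^ 2 - 3 * q + 1))"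
    unfolding I' by Groebner_Basis.algebra
  also have "3 * (q ^ 10 * K - K) * (q ^ 2 + q + 1) = (q ^ 2 - 1) * (3 * K * P * (q ^ 2 + q + 1))"
    unfolding P_def by Groebner_Basis.algebra
  finally have "(q ^ 2 - 1) * (3 * K * P * (q ^ 2 + q + 1)) = (q ^ 2 - 1) * (q ^ 8 * (q ^ 2 - 3 * q + 1))" .
  moreover have "q ^ 2 - 1 \<noteq> 0"
    using q power2_eq_1_iff[of q] by auto
  ultimately have KP: "3 * K * P * (q ^ 2 + q + 1) = q ^ 8 * (q ^ 2 - 3 * q + 1)"
    by simp
  have m': "8 * m = 4 * I - 3 * K"
    using m by simp
  have "(q ^ 2 + q + 1) * (m * (8 * P)) = (8 * m) * (P * (q ^ 2 + q + 1))"
    by Groebner_Basis.algebra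
  also have "\<dots> = 4 * P * (I * (q ^ 2 + q + 1)) - 3 * K * P * (q ^ 2 + q + 1)"
    unfolding m' by Groebner_Basis.algebra
  also have "\<dots> = (q ^ 2 + q + 1) * (q ^ 2 * (3 * q ^ 6 + 4 * q ^ 2 - 4 * q + 4))"
    unfolding I' KP unfolding P_def by Groebner_Basis.algebra
  finally have "(q ^ 2 + q + 1) * (m * (8 * P)) = (q ^ 2 + q + 1) * (q ^ 2 * (3 * q ^ 6 + 4 * q ^ 2 - 4 * q + 4))" .
  hence "m * (8 * P) = q ^ 2 * (3 * q ^ 6 + 4 * q ^ 2 - 4 * q + 4)"
    using d by simp
  thus ?thesis
    using P unfolding P_def by (simp add: eq_divide_eq)
qed

section \<open>Assembling the integral over \<alpha> and b\<close>

lemma AE_flex_disc_nonzero: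
  "AE b in haar_measure. 4 * \<alpha> ^ 3 - 27 * b \<noteq> (0 :: 'p::prime_card padic_int)"
proof (cases "\<exists>b. 4 * \<alpha> ^ 3 - 27 * b = 0")
  case True
  then obtain b0 where b0: "4 * \<alpha> ^ 3 - 27 * b0 = 0" ..
  show ?thesis
  proof (rule AE_mp[OF AE_haar_padic_not_eq[of b0]], rule AE_I2, rule impI, rule notI)
    fix b
    assume "b \<noteq> b0" "4 * \<alpha> ^ 3 - 27 * b = 0"
    moreover from this(2) have "27 * (b - b0) = 0"
      using b0 by Groebner_Basis.algebra
    ultimately show False
      by simp
  qed
next
  case False
  thus ?thesis
    by simp
qed

lemma ennreal_half: "0 \<le> x \<Longrightarrow> ennreal (x * (1 / 2)) = ennreal (1 / 2) * ennreal x"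
  by (subst mult.commute, rule ennreal_mult) simp_all

lemma ennreal_eighth:
  assumes "0 \<le> x"
  shows "ennreal (x * (1 / 8)) + ennreal (3 / 8) * ennreal x = ennreal (1 / 2) * ennreal x"
proof -
  have "ennreal (x * (1 / 8)) + ennreal (3 / 8) * ennreal x = ennreal (x * (1 / 8)) + ennreal (3 / 8 * x)"
    using assms by (intro arg_cong2[where f = "(+)"] refl ennreal_mult[symmetric]) simp_all
  also have "\<dots> = ennreal (x * (1 / 8) + 3 / 8 * x)"
    using assms by (intro ennreal_plus[symmetric]) simp_all
  also have "x * (1 / 8) + 3 / 8 * x = x * (1 / 2)"
    by simp
  finally show ?thesis
    by (simp only: ennreal_half[OF assms])
qed

lemma nn_integral_flex_slope_density_generic:
  assumes "\<nexists>\<omega> :: 'p::prime_card padic_int. \<omega>\<^sup>2 = -3"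
  shows "(\<integral>\<^sup>+\<alpha>. (\<integral>\<^sup>+b. flex_slope_density \<alpha> b \<partial>haar_measure) \<partial>(haar_measure :: 'p padic_int measure)) =
    ennreal (1 / 2) * norm_sq_integral TYPE('p)"
proof -
  have "(\<integral>\<^sup>+b. flex_slope_density \<alpha> b \<partial>haar_measure) = ennreal (1 / 2) * norm_sq_integral TYPE('p)" for \<alpha> :: "'p padic_int"
  proof -
    have "(\<integral>\<^sup>+b. flex_slope_density \<alpha> b \<partial>haar_measure) =
      (\<integral>\<^sup>+b. ennreal (1 / 2) * ennreal ((padic_norm (b :: 'p padic_int))\<^sup>2) \<partial>haar_measure)"
    proof (rule nn_integral_cong_AE, rule AE_mp[OF AE_flex_disc_nonzero[of \<alpha>]], rule AE_I2, rule impI)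
      fix b
      assume "4 * \<alpha> ^ 3 - 27 * b \<noteq> 0"
      hence "flex_slope_density \<alpha> b = ennreal ((padic_norm b)\<^sup>2 * (1 / 2))"
        using assms by (simp add: flex_slope_density_def flex_weight_def flex_special_def)
      thus "flex_slope_density \<alpha> b = ennreal (1 / 2) * ennreal ((padic_norm b)\<^sup>2)"
        by (simp only: ennreal_half zero_le_power2)
    qed
    also have "\<dots> = ennreal (1 / 2) * norm_sq_integral TYPE('p)"
      unfolding norm_sq_integral_def by (rule nn_integral_cmult) measurable
    finally show ?thesis .
  qed
  thus ?thesis
    by simp
qed

text \<open>The weight is 1/2, lowered by 3/8 where 8 \<alpha>^3 - 54 b is a cube; the missing part
  is added on the left to stay within \<open>ennreal\<close>. As 2 and 54 are units, (2 \<alpha>)^3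
  + (-54 b) has the form a^3 + b treated above.\<close>

lemma nn_integral_flex_slope_density_special:
  fixes \<omega> :: "'p::prime_card padic_int"
  assumes p: "CARD('p) \<ge> 3" and \<omega>: "\<omega>\<^sup>2 = -3"
  shows "(\<integral>\<^sup>+\<alpha>. (\<integral>\<^sup>+b. flex_slope_density \<alpha> b \<partial>haar_measure) \<partial>(haar_measure :: 'p padic_int measure)) +
    ennreal (3 / 8) * cubes_plane_integral TYPE('p) = ennreal (1 / 2) * norm_sq_integral TYPE('p)"
proof -
  let ?M = "haar_measure :: 'p padic_int measure"
  have n2: "padic_norm (2 :: 'p padic_int) = 1"
    by (rule padic_norm_2[OF p])
  have n3: "padic_norm (3 :: 'p padic_int) = 1"
    using CARD_neq_3_of_sqrt_minus_3[OF \<omega>] by (simp add: padic_norm_3)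
  have "padic_norm (- (2 * 3 ^ 3) :: 'p padic_int) = 1"
    unfolding padic_norm_minus padic_norm_mult padic_norm_power n2 n3 by simp
  hence n54: "padic_norm (- 54 :: 'p padic_int) = 1"
    by simp
  have line: "(\<integral>\<^sup>+b. flex_slope_density \<alpha> b \<partial>?M) + ennreal (3 / 8) * cubes_line_integral (2 * \<alpha>) =
      ennreal (1 / 2) * norm_sq_integral TYPE('p)" for \<alpha> :: "'p padic_int"
  proof -
    let ?f = "\<lambda>b. ennreal ((padic_norm b)\<^sup>2) * indicator padic_cubes ((2 * \<alpha>) ^ 3 + b)"
    have "cubes_line_integral (2 * \<alpha>) = (\<integral>\<^sup>+b. ?f (0 + - 54 * b) \<partial>?M)"
      unfolding cubes_line_integral_def
      by (rule nn_integral_padic_unit_affine[symmetric]) (measurable, rule n54)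
    also have "\<dots> = (\<integral>\<^sup>+b. ennreal ((padic_norm b)\<^sup>2) * indicator padic_cubes (8 * \<alpha> ^ 3 - 54 * b) \<partial>?M)"
    proof (rule nn_integral_cong)
      fix b :: "'p padic_int"
      have "padic_norm (0 + - 54 * b) = padic_norm b"
        unfolding padic_norm_mult add_0_left n54 by simp
      thus "?f (0 + - 54 * b) = ennreal ((padic_norm b)\<^sup>2) * indicator padic_cubes (8 * \<alpha> ^ 3 - 54 * b)"
        by (simp add: power_mult_distrib)
    qed
    finally have "ennreal (3 / 8) * cubes_line_integral (2 * \<alpha>) =
      (\<integral>\<^sup>+b. ennreal (3 / 8) * (ennreal ((padic_norm b)\<^sup>2) * indicator padic_cubes (8 * \<alpha> ^ 3 - 54 * b)) \<partial>?M)"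
      by (simp only:) (rule nn_integral_cmult[symmetric], measurable)
    hence "(\<integral>\<^sup>+b. flex_slope_density \<alpha> b \<partial>?M) + ennreal (3 / 8) * cubes_line_integral (2 * \<alpha>) =
      (\<integral>\<^sup>+b. flex_slope_density \<alpha> b +
         ennreal (3 / 8) * (ennreal ((padic_norm b)\<^sup>2) * indicator padic_cubes (8 * \<alpha> ^ 3 - 54 * b)) \<partial>?M)"
      by (simp only:) (rule nn_integral_add[symmetric]; measurable)
    also have "\<dots> = (\<integral>\<^sup>+b. ennreal (1 / 2) * ennreal ((padic_norm (b :: 'p padic_int))\<^sup>2) \<partial>?M)"
    proof (rule nn_integral_cong_AE, rule AE_mp[OF AE_flex_disc_nonzero[of \<alpha>]], rule AE_I2, rule impI)
      fix b
      assume nz: "4 * \<alpha> ^ 3 - 27 * b \<noteq> 0"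
      have special: "flex_special \<alpha> b \<longleftrightarrow> 8 * \<alpha> ^ 3 - 54 * b \<in> padic_cubes"
        using \<omega> unfolding flex_special_iff by blast
      show "flex_slope_density \<alpha> b +
          ennreal (3 / 8) * (ennreal ((padic_norm b)\<^sup>2) * indicator padic_cubes (8 * \<alpha> ^ 3 - 54 * b)) =
          ennreal (1 / 2) * ennreal ((padic_norm b)\<^sup>2)"
      proof (cases "8 * \<alpha> ^ 3 - 54 * b \<in> padic_cubes")
        case True
        hence "flex_slope_density \<alpha> b = ennreal ((padic_norm b)\<^sup>2 * (1 / 8))"
          using nz by (simp add: flex_slope_density_def flex_weight_def special)
        thus ?thesis
          using True by (simp only: indicator_simps mult_1_right ennreal_eighth zero_le_power2)
      next
        case False
        hence "flex_slope_density \<alpha> b = ennreal ((padic_norm b)\<^sup>2 * (1 / 2))"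
          using nz by (simp add: flex_slope_density_def flex_weight_def special)
        thus ?thesis
          using False by (simp only: indicator_simps not_False_eq_True mult_zero_right add_0_right ennreal_half zero_le_power2)
      qed
    qed
    also have "\<dots> = ennreal (1 / 2) * norm_sq_integral TYPE('p)"
      unfolding norm_sq_integral_def by (rule nn_integral_cmult) measurable
    finally show ?thesis .
  qed
  have "cubes_plane_integral TYPE('p) = (\<integral>\<^sup>+\<alpha>. cubes_line_integral (0 + 2 * \<alpha> :: 'p padic_int) \<partial>?M)"
    unfolding cubes_plane_integral_def
    by (rule nn_integral_padic_unit_affine[symmetric]) (measurable, rule n2)
  hence "ennreal (3 / 8) * cubes_plane_integral TYPE('p) =
      (\<integral>\<^sup>+\<alpha>. ennreal (3 / 8) * cubes_line_integral (2 * \<alpha> :: 'p padic_int) \<partial>?M)"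
    by (simp only: add_0_left) (rule nn_integral_cmult[symmetric], measurable)
  hence "(\<integral>\<^sup>+\<alpha>. (\<integral>\<^sup>+b. flex_slope_density \<alpha> b \<partial>?M) \<partial>?M) + ennreal (3 / 8) * cubes_plane_integral TYPE('p) =
    (\<integral>\<^sup>+\<alpha>. ((\<integral>\<^sup>+b. flex_slope_density \<alpha> b \<partial>?M) + ennreal (3 / 8) * cubes_line_integral (2 * \<alpha>)) \<partial>?M)"
    by (simp only:) (rule nn_integral_add[symmetric]; measurable)
  thus ?thesis
    by (simp add: line)
qed

lemma ennreal_le_1_cases:
  assumes "x \<le> (1 :: ennreal)"
  obtains r where "x = ennreal r" "r \<ge> 0"
proof (cases x)
  case top
  thus ?thesis
    using assms by (simp add: top_unique)
qed (use that in auto)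

theorem flex_set_measure:
  assumes p: "CARD('p::prime_card) \<ge> 3"
  defines "q \<equiv> real CARD('p)"
    and "\<mu> \<equiv> (\<integral>\<^sup>+a2. (\<integral>\<^sup>+a4. (\<integral>\<^sup>+a6. indicator flex_set (a2, a4, a6) \<partial>haar_measure) \<partial>haar_measure)
      \<partial>(haar_measure :: 'p padic_int measure))"
  shows "CARD('p) mod 3 = 1 \<Longrightarrow>
      \<mu> = ennreal (q ^ 2 * (3 * q ^ 6 + 4 * q ^ 2 - 4 * q + 4) / (8 * (q ^ 8 + q ^ 6 + q ^ 4 + q ^ 2 + 1)))"
    and "CARD('p) mod 3 \<noteq> 1 \<Longrightarrow> \<mu> = ennreal ((if CARD('p) = 3 then 1 / 3 else 1) * (q ^ 2 / (2 * (q ^ 2 + q + 1))))"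
proof -
  let ?M = "haar_measure :: 'p padic_int measure"
  have q: "q > 1"
    using p by (simp add: q_def)
  have n2: "padic_norm (2 :: 'p padic_int) = 1"
    by (rule padic_norm_2[OF p])
  define I where "I = q ^ 2 / (q ^ 2 + q + 1)"
  have I: "norm_sq_integral TYPE('p) = ennreal I" "I \<ge> 0"
    using norm_sq_integral[where 'p = 'p] q by (simp_all add: I_def q_def)
  let ?S = "\<integral>\<^sup>+\<alpha>. (\<integral>\<^sup>+b. flex_slope_density \<alpha> b \<partial>?M) \<partial>?M"
  have \<mu>: "\<mu> = ennreal (padic_norm (3 :: 'p padic_int)) * ?S"
    unfolding \<mu>_def by (rule nn_integral_flex_set[OF n2])
  show "\<mu> = ennreal ((if CARD('p) = 3 then 1 / 3 else 1) * (q ^ 2 / (2 * (q ^ 2 + q + 1))))"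
    if "CARD('p) mod 3 \<noteq> 1"
  proof -
    have "\<nexists>\<omega> :: 'p padic_int. \<omega>\<^sup>2 = -3"
      using that sqrt_minus_3_iff[OF p] by blast
    hence "?S = ennreal (1 / 2) * ennreal I"
      unfolding I(1)[symmetric] by (rule nn_integral_flex_slope_density_generic)
    also have "\<dots> = ennreal (I * (1 / 2))"
      by (rule ennreal_half[OF I(2), symmetric])
    also have "I * (1 / 2) = q ^ 2 / (2 * (q ^ 2 + q + 1))"
      by (simp add: I_def)
    finally have S: "?S = ennreal (q ^ 2 / (2 * (q ^ 2 + q + 1)))" .
    show ?thesis
      unfolding \<mu> S padic_norm_3 by (rule ennreal_mult[symmetric]) (use q in auto)
  qed
  show "\<mu> = ennreal (q ^ 2 * (3 * q ^ 6 + 4 * q ^ 2 - 4 * q + 4) / (8 * (q ^ 8 + q ^ 6 + q ^ 4 + q ^ 2 + 1)))"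
    if mod: "CARD('p) mod 3 = 1"
  proof -
    obtain \<omega> :: "'p padic_int" where \<omega>: "\<omega>\<^sup>2 = -3"
      using mod sqrt_minus_3_iff[OF p] by blast
    have n3: "padic_norm (3 :: 'p padic_int) = 1"
      using CARD_neq_3_of_sqrt_minus_3[OF \<omega>] by (simp add: padic_norm_3)
    \<comment> \<open>All these integrals are at most 1, hence finite, so the equations between them
      can be transferred to the reals.\<close>
    have line_le: "cubes_line_integral a \<le> 1" for a :: "'p padic_int"
      unfolding cubes_line_integral_def
      by (intro nn_integral_haar_le_1) (auto simp: power_le_one padic_norm_le_1 split: split_indicator)
    have "cubes_plane_integral TYPE('p) \<le> 1"
      unfolding cubes_plane_integral_def by (intro nn_integral_haar_le_1 line_le)
    then obtain K where K: "cubes_plane_integral TYPE('p) = ennreal K" "K \<ge> 0"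
      by (rule ennreal_le_1_cases)
    have "unit_cubes_integral TYPE('p) \<le> 1"
      unfolding unit_cubes_integral_def
      by (intro nn_integral_haar_le_1) (auto simp: power_le_one padic_norm_le_1 split: split_indicator)
    then obtain L where L: "unit_cubes_integral TYPE('p) = ennreal L" "L \<ge> 0"
      by (rule ennreal_le_1_cases)
    have "cubes_integral TYPE('p) \<le> 1"
      unfolding cubes_integral_def by (intro nn_integral_haar_le_1) (auto split: split_indicator)
    then obtain Q where Q: "cubes_integral TYPE('p) = ennreal Q" "Q \<ge> 0"
      by (rule ennreal_le_1_cases)
    have "cubic_residues_count TYPE('p) < \<top>"
      unfolding cubic_residues_count_def by (simp add: indicator_def less_top[symmetric] sum_Pinfty)
    then obtain N where N: "cubic_residues_count TYPE('p) = ennreal N" "N \<ge> 0"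
      by (cases "cubic_residues_count TYPE('p)") auto
    have S_le: "?S \<le> 1"
    proof -
      have "?S \<le> ?S + ennreal (3 / 8) * cubes_plane_integral TYPE('p)"
        by simp
      also have "\<dots> = ennreal (1 / 2) * ennreal I"
        unfolding I(1)[symmetric] by (rule nn_integral_flex_slope_density_special[OF p \<omega>])
      also have "\<dots> = ennreal (I * (1 / 2))"
        by (rule ennreal_half[OF I(2), symmetric])
      also have "\<dots> \<le> ennreal 1"
      proof (rule ennreal_leI)
        have "I \<le> 1"
          using q unfolding I_def by (subst pos_divide_le_eq) (auto intro: add_nonneg_pos)
        thus "I * (1 / 2) \<le> 1"
          by simp
      qed
      finally show ?thesis
        by simp
    qed
    then obtain m where m: "?S = ennreal m" "m \<ge> 0"
      by (rule ennreal_le_1_cases)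
    have "3 * Q = I"
    proof -
      have "ennreal (3 * Q) = ennreal I"
        using cubes_integral[OF p \<omega>] unfolding Q I using Q(2) by (simp add: ennreal_mult)
      thus ?thesis
        using Q I by simp
    qed
    moreover have "Q = 1 / q * (1 / q ^ 2 * Q + N)"
    proof -
      have "ennreal Q = ennreal (1 / q) * (ennreal (1 / q ^ 2) * ennreal Q + ennreal N)"
        using cubes_integral_digits[OF n3] unfolding Q N q_def .
      also have "\<dots> = ennreal (1 / q * (1 / q ^ 2 * Q + N))"
        using q Q N by (intro ennreal_mult_affine) auto
      finally show ?thesis
        using q Q N by (subst (asm) ennreal_inj) (auto intro!: divide_nonneg_nonneg add_nonneg_nonneg mult_nonneg_nonneg)
    qed
    moreover have "L + 1 / q = Q + 1 / q * (1 / q ^ 2 * I)"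
    proof -
      have "ennreal L + ennreal (1 / q) = ennreal Q + ennreal (1 / q) * (ennreal (1 / q ^ 2) * ennreal I)"
        using unit_cubes_integral_digits[OF n3] unfolding Q I(1) L q_def .
      moreover have "ennreal L + ennreal (1 / q) = ennreal (L + 1 / q)"
        using q L by (intro ennreal_plus[symmetric]) auto
      moreover have "ennreal Q + ennreal (1 / q) * (ennreal (1 / q ^ 2) * ennreal I) = ennreal (Q + 1 / q * (1 / q ^ 2 * I))"
        using q Q I(2) by (simp add: ennreal_plus ennreal_mult del: times_divide_eq_left)
      moreover have "0 \<le> L + 1 / q" "0 \<le> Q + 1 / q * (1 / q ^ 2 * I)"
        using q L Q I(2) by (auto intro!: add_nonneg_nonneg mult_nonneg_nonneg)
      ultimately show ?thesis
        using ennreal_inj by metis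
    qed
    moreover have "K = 1 / q * (1 / q * (1 / q ^ 8 * K + N) + (q - 1) * L)"
    proof -
      let ?A = "1 / q * (1 / q ^ 8 * K + N)"
      have A: "0 \<le> ?A"
        using q K N by (intro mult_nonneg_nonneg add_nonneg_nonneg) auto
      have B: "0 \<le> (q - 1) * L"
        using q L by simp
      have "ennreal K = ennreal (1 / q) * (ennreal (1 / q) * (ennreal (1 / q ^ 8) * ennreal K + ennreal N) + ennreal (q - 1) * ennreal L)"
        using cubes_plane_integral_recursion[OF n3] unfolding K L N q_def .
      also have "ennreal (1 / q) * (ennreal (1 / q ^ 8) * ennreal K + ennreal N) = ennreal ?A"
        using q K N by (intro ennreal_mult_affine) auto
      also have "ennreal (q - 1) * ennreal L = ennreal ((q - 1) * L)"
        using q L by (intro ennreal_mult[symmetric]) auto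
      also have "ennreal ?A + ennreal ((q - 1) * L) = ennreal (?A + (q - 1) * L)"
        using A B by (rule ennreal_plus[symmetric])
      also have "ennreal (1 / q) * \<dots> = ennreal (1 / q * (?A + (q - 1) * L))"
        using q A B by (intro ennreal_mult[symmetric] add_nonneg_nonneg) auto
      finally have "ennreal K = ennreal (1 / q * (?A + (q - 1) * L))" .
      moreover have "0 \<le> 1 / q * (?A + (q - 1) * L)"
        using q K N L by (intro mult_nonneg_nonneg add_nonneg_nonneg) auto
      ultimately show ?thesis
        using K(2) ennreal_inj[of K "1 / q * (?A + (q - 1) * L)"] by blast
    qed
    moreover have "m + 3 / 8 * K = 1 / 2 * I"
    proof -
      have "ennreal m + ennreal (3 / 8) * ennreal K = ennreal (1 / 2) * ennreal I"
        using nn_integral_flex_slope_density_special[OF p \<omega>] unfolding m K I .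
      hence "ennreal (m + 3 / 8 * K) = ennreal (1 / 2 * I)"
        using m(2) K(2) I(2) by (simp only: ennreal_plus ennreal_mult mult_nonneg_nonneg divide_nonneg_nonneg zero_le_numeral zero_le_one)
      thus ?thesis
        using m(2) K(2) I(2) by (subst (asm) ennreal_inj) auto
    qed
    ultimately have "m = q ^ 2 * (3 * q ^ 6 + 4 * q ^ 2 - 4 * q + 4) / (8 * (q ^ 8 + q ^ 6 + q ^ 4 + q ^ 2 + 1))"
      by (intro flex_measure_recursion[OF q I_def])
    thus ?thesis
      by (simp add: \<mu> n3 m(1))
  qed
qed

section \<open>Points of order three\<close>

lemma to_fract_of_nat: "to_fract (of_nat n) = of_nat n"
  by (induction n) simp_all

lemma to_fract_numeral [simp]: "to_fract (numeral n) = numeral n"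
  using to_fract_of_nat[of "numeral n"] by simp

lemma to_fract_power [simp]: "to_fract (x ^ n) = to_fract x ^ n"
  by (induction n) simp_all

instance fract :: ("{idom, ring_char_0}") field_char_0
proof
  show "inj (of_nat :: nat \<Rightarrow> 'a fract)"
    unfolding inj_def to_fract_of_nat[symmetric] to_fract_eq_iff by simp
qed

text \<open>Completing the square: the coefficients \<open>b\<^sub>2 / 4, b\<^sub>4 / 2, b\<^sub>6 / 4\<close> of Tate's formulary.
  Here \<open>h\<close> stands for \<open>1 / 2\<close>.\<close>

lemma flex_of_3_torsion:
  fixes h :: "'a::field"
  assumes h: "2 * h = 1" and tors: "has_nontrivial_3_torsion_point (a1, a2, a3, a4, a6)"
  shows "\<exists>\<alpha> \<beta> r. flex_eqs (a2 + (h * a1)\<^sup>2) (a4 + h * a1 * a3) (a6 + (h * a3)\<^sup>2) \<alpha> \<beta> r \<and> \<alpha> * r + \<beta> \<noteq> (0 :: 'a)"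
proof -
  obtain P where P: "P \<in> ec_points (a1, a2, a3, a4, a6)" "P \<noteq> Infinity"
    "ec_add (a1, a2, a3, a4, a6) (ec_add (a1, a2, a3, a4, a6) P P) P = Infinity"
    using tors by (auto simp: has_nontrivial_3_torsion_point_def)
  then obtain x y where xy: "P = Affine x y"
    by (cases P) auto
  have E: "y\<^sup>2 + a1 * x * y + a3 * y = x ^ 3 + a2 * x\<^sup>2 + a4 * x + a6"
    using P(1) xy by simp
  define d where "d = 2 * y + a1 * x + a3"
  \<comment> \<open>Otherwise P + P would be \<open>Infinity\<close> and the triple sum would be P
    itself.\<close>
  have "y \<noteq> - y - a1 * x - a3"
    using P(2,3) unfolding xy by (auto split: if_splits)
  hence d0: "d \<noteq> 0"
    unfolding d_def by (auto simp: algebra_simps eq_neg_iff_add_eq_0)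
  define l where "l = (3 * x\<^sup>2 + 2 * a2 * x + a4 - a1 * y) / d"
  define m where "m = y - l * x"
  define x3 where "x3 = l\<^sup>2 + a1 * l - a2 - x - x"
  have dbl: "ec_add (a1, a2, a3, a4, a6) P P = Affine x3 (- (l * x3 + m) - a1 * x3 - a3)"
    using \<open>y \<noteq> - y - a1 * x - a3\<close> unfolding xy by (simp add: Let_def x3_def m_def l_def d_def)
  \<comment> \<open>The triple sum vanishes only if P + P is the reflection of P. So the doubled
    point has the abscissa of P, and the tangent meets the curve there three times.\<close>
  have x3: "x3 = x"
  proof -
    have "ec_add (a1, a2, a3, a4, a6) (Affine x3 (- (l * x3 + m) - a1 * x3 - a3)) (Affine x y) = Infinity"
      using P(3) unfolding dbl by (simp only: xy)
    thus ?thesis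
      by (simp add: Let_def split: if_splits)
  qed
  have l: "l * d = 3 * x\<^sup>2 + 2 * a2 * x + a4 - a1 * y"
    using d0 by (simp add: l_def)
  have 2: "l\<^sup>2 + a1 * l - a2 = 3 * x"
    using x3 unfolding x3_def by (simp add: algebra_simps)
  \<comment> \<open>The tangent y = l x + m, written in the coordinate y + h (a1 x + a3) of the
    completed square.\<close>
  define \<alpha> where "\<alpha> = l + h * a1"
  define \<beta> where "\<beta> = m + h * a3"
  have "a2 + (h * a1)\<^sup>2 = \<alpha>\<^sup>2 - 3 * x"
    using 2 h unfolding \<alpha>_def by Groebner_Basis.algebra
  moreover have "a4 + h * a1 * a3 = 2 * \<alpha> * \<beta> + 3 * x\<^sup>2"
    using 2 h l unfolding \<alpha>_def \<beta>_def m_def d_def by Groebner_Basis.algebra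
  moreover have "a6 + (h * a3)\<^sup>2 = \<beta>\<^sup>2 - x ^ 3"
    using 2 h l E unfolding \<beta>_def m_def d_def by Groebner_Basis.algebra
  moreover have "2 * (\<alpha> * x + \<beta>) = d"
    using h unfolding \<alpha>_def \<beta>_def m_def d_def by Groebner_Basis.algebra
  hence "\<alpha> * x + \<beta> \<noteq> 0"
    using d0 by (metis mult_zero_right)
  ultimately show ?thesis
    unfolding flex_eqs_def by blast
qed

text \<open>The tangent has triple contact at r, so doubling returns the abscissa r and the
  reflected point. The condition on \<alpha> r + \<beta> says that the point is not of order two, so
  the tangent slope has a nonzero denominator.\<close>

lemma flex_imp_3_torsion:
  fixes \<alpha> :: "'a::field"
  assumes h: "2 * h = 1" and b: "\<alpha> * r + \<beta> \<noteq> 0"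
    and eqs: "flex_eqs (a2 + (h * a1)\<^sup>2) (a4 + h * a1 * a3) (a6 + (h * a3)\<^sup>2) \<alpha> \<beta> r"
  shows "has_nontrivial_3_torsion_point (a1, a2, a3, a4, a6)"
proof -
  define A where "A = h * a1"
  define C where "C = h * a3"
  define l where "l = \<alpha> - A"
  define m where "m = \<beta> - C"
  define y where "y = l * r + m"
  define d where "d = 2 * y + a1 * r + a3"
  have a: "a1 = 2 * A" "a3 = 2 * C"
    using h unfolding A_def C_def by Groebner_Basis.algebra+
  have e: "a2 = \<alpha>\<^sup>2 - 3 * r - A\<^sup>2" "a4 = 2 * \<alpha> * \<beta> + 3 * r\<^sup>2 - 2 * A * C" "a6 = \<beta>\<^sup>2 - r ^ 3 - C\<^sup>2"
    using eqs a(2) unfolding flex_eqs_def A_def[symmetric] C_def[symmetric]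
    by (auto simp: eq_diff_eq mult.left_commute mult.assoc)
  have E: "y\<^sup>2 + a1 * r * y + a3 * y = r ^ 3 + a2 * r\<^sup>2 + a4 * r + a6"
    unfolding a e y_def l_def m_def by Groebner_Basis.algebra
  have "2 \<noteq> (0 :: 'a)"
    using h by auto
  moreover have "d = 2 * (\<alpha> * r + \<beta>)"
    unfolding d_def a y_def l_def m_def by Groebner_Basis.algebra
  ultimately have d0: "d \<noteq> 0"
    using b by (metis mult_eq_0_iff)
  have ld: "l * d = 3 * r\<^sup>2 + 2 * a2 * r + a4 - a1 * y"
    unfolding d_def a e y_def l_def m_def by Groebner_Basis.algebra
  have l: "(3 * r\<^sup>2 + 2 * a2 * r + a4 - a1 * y) / (2 * y + a1 * r + a3) = l"
    unfolding ld[symmetric] d_def[symmetric] using d0 by (rule nonzero_mult_div_cancel_right)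
  have x3: "l\<^sup>2 + a1 * l - a2 - r - r = r"
    unfolding a e l_def by (simp add: algebra_simps power2_eq_square)
  have ne: "y \<noteq> - y - a1 * r - a3"
    using d0 unfolding d_def by (auto simp: algebra_simps eq_neg_iff_add_eq_0)
  have dbl: "ec_add (a1, a2, a3, a4, a6) (Affine r y) (Affine r y) = Affine r (- y - a1 * r - a3)"
  proof -
    have "ec_add (a1, a2, a3, a4, a6) (Affine r y) (Affine r y) = Affine r (- (l * r + (y - l * r)) - a1 * r - a3)"
      unfolding ec_add.simps using ne by (simp only: Let_def l x3 if_True if_False simp_thms)
    thus ?thesis
      by simp
  qed
  have "ec_add (a1, a2, a3, a4, a6) (ec_add (a1, a2, a3, a4, a6) (Affine r y) (Affine r y)) (Affine r y) = Infinity"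
    unfolding dbl by simp
  moreover have "Affine r y \<in> ec_points (a1, a2, a3, a4, a6)"
    using E by simp
  ultimately show ?thesis
    unfolding has_nontrivial_3_torsion_point_def by blast
qed

section \<open>Smoothness of curves with a flex\<close>

lemma flex_singular_point_imp:
  fixes \<alpha> :: "'a::{field_char_0}"
  assumes h: "2 * h = 1"
    and eqs: "flex_eqs (a2 + (h * a1)\<^sup>2) (a4 + h * a1 * a3) (a6 + (h * a3)\<^sup>2) \<alpha> \<beta> r"
    and nz: "(x, y, z) \<noteq> (0, 0, 0)"
    and F: "weierstrass_form (a1, a2, a3, a4, a6) x y z = 0" "weierstrass_form_dx (a1, a2, a3, a4, a6) x y z = 0"
      "weierstrass_form_dy (a1, a2, a3, a4, a6) x y z = 0" "weierstrass_form_dz (a1, a2, a3, a4, a6) x y z = 0"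
  shows "\<alpha> * r + \<beta> = 0 \<or> 4 * \<alpha> ^ 3 - 27 * (\<alpha> * r + \<beta>) = 0"
proof -
  have e: "a2 = \<alpha>\<^sup>2 - 3 * r - (h * a1)\<^sup>2" "a4 = 2 * \<alpha> * \<beta> + 3 * r\<^sup>2 - h * a1 * a3" "a6 = \<beta>\<^sup>2 - r ^ 3 - (h * a3)\<^sup>2"
    using eqs by (auto simp: flex_eqs_def algebra_simps)
  have z: "z \<noteq> 0"
  proof
    assume z: "z = 0"
    have "x ^ 3 = 0"
      using F(1) z by simp
    hence "x = 0"
      by simp
    moreover from this have "y\<^sup>2 = 0"
      using F(4) z by simp
    ultimately show False
      using z nz by simp
  qed
  have "z * (2 * y + a1 * x + a3 * z) = 0"
    using F(3) by (simp add: algebra_simps power2_eq_square)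
  hence "2 * y + a1 * x + a3 * z = 0"
    using z by simp
  hence y: "y = - h * (a1 * x + a3 * z)"
    using h by Groebner_Basis.algebra
  define b where "b = \<alpha> * r + \<beta>"
  \<comment> \<open>A singular point has y = - h (a1 x + a3 z). What remains is X^3 + (\<alpha> X +
    b)^2 and its derivative, homogenized: \<xi> stands for X and v for the value of the
    line.\<close>
  define \<xi> where "\<xi> = x - r * z"
  define v where "v = \<alpha> * \<xi> + b * z"
  have 1: "v\<^sup>2 * z + \<xi> ^ 3 = 0"
    using F(1) h unfolding weierstrass_form.simps y e v_def \<xi>_def b_def by Groebner_Basis.algebra
  have 2: "2 * \<alpha> * v * z + 3 * \<xi>\<^sup>2 = 0"
    using F(2) h unfolding weierstrass_form_dx.simps y e v_def \<xi>_def b_def by Groebner_Basis.algebra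
  \<comment> \<open>Isolate and square the first term of the second relation, then substitute v^2 z
    from the first.\<close>
  have "\<xi> ^ 3 * (9 * \<xi> + 4 * \<alpha>\<^sup>2 * z) = 0"
    using 1 2 by Groebner_Basis.algebra
  hence "\<xi> = 0 \<or> 9 * \<xi> + 4 * \<alpha>\<^sup>2 * z = 0"
    by auto
  thus ?thesis
  proof
    assume "\<xi> = 0"
    hence "v = 0"
      using 1 z by simp
    hence "b = 0"
      using \<open>\<xi> = 0\<close> z unfolding v_def by simp
    thus ?thesis
      unfolding b_def ..
  next
    assume 3: "9 * \<xi> + 4 * \<alpha>\<^sup>2 * z = 0"
    show ?thesis
    proof (cases "\<alpha> = 0")
      case True
      hence "\<xi> = 0"
        using 3 by simp
      hence "v = 0"
        using 1 z by simp
      hence "b = 0"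
        using True z unfolding v_def by simp
      thus ?thesis
        unfolding b_def ..
    next
      case False
      have "2 * \<alpha> * z\<^sup>2 * (27 * b - 4 * \<alpha> ^ 3) = 0"
        using 2 3 unfolding v_def by Groebner_Basis.algebra
      hence "4 * \<alpha> ^ 3 - 27 * b = 0"
        using False z by simp
      thus ?thesis
        unfolding b_def ..
    qed
  qed
qed

text \<open>X^3 + (\<alpha> X + b)^2 has the multiple root 0 if b = 0, and -4 t^2 if \<alpha> = 3 t
  and b = 4 t^3, which is the other case.\<close>

lemma flex_singular_point_exists:
  fixes \<alpha> :: "'a::{field_char_0}"
  assumes h: "2 * h = 1"
    and eqs: "flex_eqs (a2 + (h * a1)\<^sup>2) (a4 + h * a1 * a3) (a6 + (h * a3)\<^sup>2) \<alpha> \<beta> r"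
    and sing: "\<alpha> * r + \<beta> = 0 \<or> 4 * \<alpha> ^ 3 - 27 * (\<alpha> * r + \<beta>) = 0"
  shows "\<exists>x y. weierstrass_form (a1, a2, a3, a4, a6) x y 1 = 0 \<and> weierstrass_form_dx (a1, a2, a3, a4, a6) x y 1 = 0 \<and>
      weierstrass_form_dy (a1, a2, a3, a4, a6) x y 1 = 0 \<and> weierstrass_form_dz (a1, a2, a3, a4, a6) x y 1 = 0"
proof -
  define b where "b = \<alpha> * r + \<beta>"
  have \<beta>: "\<beta> = b - \<alpha> * r"
    by (simp add: b_def)
  have e: "a2 = \<alpha>\<^sup>2 - 3 * r - (h * a1)\<^sup>2" "a4 = 2 * \<alpha> * \<beta> + 3 * r\<^sup>2 - h * a1 * a3" "a6 = \<beta>\<^sup>2 - r ^ 3 - (h * a3)\<^sup>2"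
    using eqs by (auto simp: flex_eqs_def algebra_simps)
  obtain \<xi> where \<xi>: "(\<alpha> * \<xi> + b)\<^sup>2 + \<xi> ^ 3 = 0" "2 * \<alpha> * (\<alpha> * \<xi> + b) + 3 * \<xi>\<^sup>2 = 0"
  proof (cases "b = 0")
    case True
    thus ?thesis
      by (intro that[of 0]) simp_all
  next
    case False
    define t where "t = \<alpha> / 3"
    have \<alpha>: "\<alpha> = 3 * t"
      by (simp add: t_def)
    have b: "b = 4 * t ^ 3"
      using sing False unfolding b_def[symmetric] t_def by (auto simp: power3_eq_cube)
    show ?thesis
    proof (rule that[of "- 4 * t\<^sup>2"])
      show "(\<alpha> * (- 4 * t\<^sup>2) + b)\<^sup>2 + (- 4 * t\<^sup>2) ^ 3 = 0"
        unfolding \<alpha> b by Groebner_Basis.algebra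
      show "2 * \<alpha> * (\<alpha> * (- 4 * t\<^sup>2) + b) + 3 * (- 4 * t\<^sup>2)\<^sup>2 = 0"
        unfolding \<alpha> b by Groebner_Basis.algebra
    qed
  qed
  define x where "x = \<xi> + r"
  define y where "y = - h * (a1 * x + a3)"
  have x: "\<xi> = x - r"
    by (simp add: x_def)
  have 1: "weierstrass_form (a1, a2, a3, a4, a6) x y 1 = 0"
    using \<xi>(1) h unfolding weierstrass_form.simps power_one mult_1_right y_def e \<beta> x by Groebner_Basis.algebra
  have 2: "weierstrass_form_dx (a1, a2, a3, a4, a6) x y 1 = 0"
    using \<xi>(2) h unfolding weierstrass_form_dx.simps power_one mult_1_right y_def e \<beta> x by Groebner_Basis.algebra
  have 3: "weierstrass_form_dy (a1, a2, a3, a4, a6) x y 1 = 0"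
    using h unfolding weierstrass_form_dy.simps power_one mult_1_right y_def by Groebner_Basis.algebra
  \<comment> \<open>Euler's identity for a form of degree 3 yields the remaining partial
    derivative.\<close>
  have "x * weierstrass_form_dx (a1, a2, a3, a4, a6) x y 1 + y * weierstrass_form_dy (a1, a2, a3, a4, a6) x y 1 +
      weierstrass_form_dz (a1, a2, a3, a4, a6) x y 1 = 3 * weierstrass_form (a1, a2, a3, a4, a6) x y 1"
    unfolding weierstrass_form.simps weierstrass_form_dx.simps weierstrass_form_dy.simps weierstrass_form_dz.simps power_one mult_1_right
    by Groebner_Basis.algebra
  hence 4: "weierstrass_form_dz (a1, a2, a3, a4, a6) x y 1 = 0"
    unfolding 1 2 3 by simp
  show ?thesis
    using 1 2 3 4 by blast
qed

text \<open>Both conditions are polynomial in elements of the base field, so they can be tested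
  after the injective embedding into the algebraic closure.\<close>

lemma defines_elliptic_curve_flex_iff:
  fixes \<alpha> :: "'a::{field_char_0}"
  assumes h: "2 * h = 1"
    and eqs: "flex_eqs (a2 + (h * a1)\<^sup>2) (a4 + h * a1 * a3) (a6 + (h * a3)\<^sup>2) \<alpha> \<beta> r"
  shows "defines_elliptic_curve (a1, a2, a3, a4, a6) \<longleftrightarrow>
    \<alpha> * r + \<beta> \<noteq> 0 \<and> 4 * \<alpha> ^ 3 - 27 * (\<alpha> * r + \<beta>) \<noteq> 0"
proof -
  have h': "2 * to_ac h = 1"
    using arg_cong[OF h, of to_ac] by simp
  have eqs': "flex_eqs (to_ac a2 + (to_ac h * to_ac a1)\<^sup>2) (to_ac a4 + to_ac h * to_ac a1 * to_ac a3)
      (to_ac a6 + (to_ac h * to_ac a3)\<^sup>2) (to_ac \<alpha>) (to_ac \<beta>) (to_ac r)"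
    using eqs unfolding flex_eqs_def
    by (simp flip: to_ac_add to_ac_mult to_ac_power to_ac_diff to_ac_numeral)
  have "to_ac \<alpha> * to_ac r + to_ac \<beta> = to_ac (\<alpha> * r + \<beta>)"
    "4 * to_ac \<alpha> ^ 3 - 27 * (to_ac \<alpha> * to_ac r + to_ac \<beta>) = to_ac (4 * \<alpha> ^ 3 - 27 * (\<alpha> * r + \<beta>))"
    by simp_all
  hence iff: "to_ac \<alpha> * to_ac r + to_ac \<beta> = 0 \<or> 4 * to_ac \<alpha> ^ 3 - 27 * (to_ac \<alpha> * to_ac r + to_ac \<beta>) = 0 \<longleftrightarrow>
    \<alpha> * r + \<beta> = 0 \<or> 4 * \<alpha> ^ 3 - 27 * (\<alpha> * r + \<beta>) = 0"
    by (simp only: to_ac_eq_0_iff)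
  let ?F = "(to_ac a1, to_ac a2, to_ac a3, to_ac a4, to_ac a6)"
  let ?sing = "\<lambda>x y z. (x, y, z) \<noteq> (0, 0, 0) \<and> weierstrass_form ?F x y z = 0 \<and> weierstrass_form_dx ?F x y z = 0 \<and>
    weierstrass_form_dy ?F x y z = 0 \<and> weierstrass_form_dz ?F x y z = 0"
  have "(\<exists>x y z. ?sing x y z) \<longleftrightarrow> \<alpha> * r + \<beta> = 0 \<or> 4 * \<alpha> ^ 3 - 27 * (\<alpha> * r + \<beta>) = 0"
  proof
    assume "\<exists>x y z. ?sing x y z"
    then obtain x y z where "?sing x y z"
      by blast
    thus "\<alpha> * r + \<beta> = 0 \<or> 4 * \<alpha> ^ 3 - 27 * (\<alpha> * r + \<beta>) = 0"
      unfolding iff[symmetric] by (elim conjE) (rule flex_singular_point_imp[OF h' eqs'])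
  next
    assume "\<alpha> * r + \<beta> = 0 \<or> 4 * \<alpha> ^ 3 - 27 * (\<alpha> * r + \<beta>) = 0"
    from flex_singular_point_exists[OF h' eqs' this[folded iff]]
    obtain x y where "weierstrass_form ?F x y 1 = 0 \<and> weierstrass_form_dx ?F x y 1 = 0 \<and>
      weierstrass_form_dy ?F x y 1 = 0 \<and> weierstrass_form_dz ?F x y 1 = 0"
      by blast
    moreover have "(x, y, 1) \<noteq> (0, 0, 0 :: 'a alg_closure)"
      by simp
    ultimately show "\<exists>x y z. ?sing x y z"
      by blast
  qed
  thus ?thesis
    unfolding defines_elliptic_curve_def Let_def map_weierstrass.simps by blast
qed

section \<open>Integrality of flexes over the p-adic numbers\<close>

lemma padic_cases:
  fixes q :: "'p::prime_card padic"
  obtains (integral) a where "q = to_fract a" | (inverse) c where "padic_norm c < 1" "q * to_fract c = 1"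
proof -
  obtain a b where q: "q = Fract a b" "b \<noteq> 0"
    by (cases q)
  show ?thesis
  proof (cases "b dvd a")
    case True
    then obtain k where "a = b * k" ..
    hence "q = to_fract k"
      using q by (simp add: to_fract_def eq_fract mult.commute)
    thus ?thesis
      by (rule integral)
  next
    case False
    hence less: "padic_norm b < padic_norm a"
      by (simp add: padic_dvd_iff_norm)
    hence "a dvd b"
      by (simp add: padic_dvd_iff_norm)
    then obtain c where c: "b = a * c" ..
    have "padic_norm c < 1"
      using less padic_norm_nonneg[of b] unfolding c padic_norm_mult by (simp add: mult_less_cancel_left2)
    moreover have "q * to_fract c = 1"
      using q c by (simp add: to_fract_def eq_fract One_fract_def)
    ultimately show ?thesis
      by (rule inverse)
  qed
qed

text \<open>If q = 1 / c with |c| < 1, then a c^2 = 1 would make c a unit.\<close>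

lemma padic_integral_of_power2:
  fixes q :: "'p::prime_card padic"
  assumes "q\<^sup>2 = to_fract a"
  obtains d where "q = to_fract d"
proof (cases q rule: padic_cases)
  case (inverse c)
  have "to_fract (a * c\<^sup>2) = (q * to_fract c)\<^sup>2"
    by (simp add: power_mult_distrib assms)
  hence "to_fract (a * c\<^sup>2) = to_fract 1"
    using inverse by simp
  hence "c dvd 1"
    unfolding to_fract_eq_iff by (metis dvd_triv_right mult.assoc power2_eq_square)
  thus ?thesis
    using inverse by (simp add: padic_unit_iff_norm)
qed

text \<open>The 3-division polynomial at r, with b2 = 4 a2, b4 = 2 a4, b6 = 4 a6 and b8 = 4 a2 a6 -
  a4^2.\<close>

lemma flex_eqs_quartic:
  assumes "flex_eqs a2 a4 a6 \<alpha> \<beta> r"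
  shows "3 * r ^ 4 + 4 * a2 * r ^ 3 + 6 * a4 * r\<^sup>2 + 12 * a6 * r + (4 * a2 * a6 - a4\<^sup>2) = (0 :: 'a::idom)"
proof -
  have a: "a2 = \<alpha>\<^sup>2 - 3 * r" "a4 = 2 * \<alpha> * \<beta> + 3 * r\<^sup>2" "a6 = \<beta>\<^sup>2 - r ^ 3"
    using assms by (auto simp: flex_eqs_def)
  show ?thesis
    unfolding a by Groebner_Basis.algebra
qed

lemma flex_eqs_to_fract_iff [simp]:
  "flex_eqs (to_fract a2) (to_fract a4) (to_fract a6) (to_fract \<alpha>) (to_fract \<beta>) (to_fract r) \<longleftrightarrow>
   flex_eqs a2 a4 a6 \<alpha> \<beta> r"
  unfolding flex_eqs_def
  by (simp flip: to_fract_add to_fract_mult to_fract_power to_fract_diff to_fract_numeral)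

text \<open>If r = 1 / t with |t| < 1, the 3-division polynomial makes t divide 3, so p = 3 and |t|
  = 1/3. Then \<beta>^2 = a6 + r^3 makes t (1 + a6 t^3) a square, although its valuation is 1. Once
  r is integral, so are \<alpha>^2 and \<beta>^2, hence \<alpha> and \<beta>.\<close>

lemma flex_eqs_integral:
  fixes a2 a4 a6 :: "'p::prime_card padic_int"
  assumes eqs: "flex_eqs (to_fract a2) (to_fract a4) (to_fract a6) \<alpha> \<beta> r"
  obtains \<alpha>' \<beta>' r' where "\<alpha> = to_fract \<alpha>'" "\<beta> = to_fract \<beta>'" "r = to_fract r'"
proof (cases r rule: padic_cases)
  case (integral r')
  have "\<alpha>\<^sup>2 = to_fract (a2 + 3 * r')" "\<beta>\<^sup>2 = to_fract (a6 + r' ^ 3)"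
    using eqs integral by (simp_all add: flex_eqs_def)
  then obtain \<alpha>' \<beta>' where "\<alpha> = to_fract \<alpha>'" "\<beta> = to_fract \<beta>'"
    by (metis padic_integral_of_power2)
  thus ?thesis
    using integral by (rule that)
next
  case (inverse t)
  have unif: "unif dvd t"
    using inverse by (simp add: padic_norm_lt_1_iff)
  have "3 + 4 * to_fract a2 * to_fract t + 6 * to_fract a4 * (to_fract t)\<^sup>2 + 12 * to_fract a6 * to_fract t ^ 3
      + (4 * to_fract a2 * to_fract a6 - (to_fract a4)\<^sup>2) * to_fract t ^ 4 = 0"
    using flex_eqs_quartic[OF eqs] inverse(2) by Groebner_Basis.algebra
  hence "to_fract (3 + 4 * a2 * t + 6 * a4 * t\<^sup>2 + 12 * a6 * t ^ 3 + (4 * a2 * a6 - a4\<^sup>2) * t ^ 4) = to_fract 0"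
    by simp
  hence 0: "3 + 4 * a2 * t + 6 * a4 * t\<^sup>2 + 12 * a6 * t ^ 3 + (4 * a2 * a6 - a4\<^sup>2) * t ^ 4 = 0"
    unfolding to_fract_eq_iff .
  have "3 = t * (- (4 * a2 + 6 * a4 * t + 12 * a6 * t\<^sup>2 + (4 * a2 * a6 - a4\<^sup>2) * t ^ 3))"
    using 0 by Groebner_Basis.algebra
  hence t3: "padic_norm (3 :: 'p padic_int) \<le> padic_norm t"
    by (metis dvd_triv_left padic_dvd_iff_norm)
  hence 3: "CARD('p) = 3"
    using inverse(1) padic_norm_3[where 'p = 'p] by (auto split: if_splits)
  hence t: "padic_norm t \<le> padic_norm (3 :: 'p padic_int)"
    using unif padic_norm_unif[where 'p = 'p] padic_norm_3[where 'p = 'p] by (simp add: padic_dvd_iff_norm)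
  have nt: "padic_norm t = 1 / 3"
    using t3 t 3 padic_norm_3[where 'p = 'p] by simp
  have "(\<beta> * (to_fract t)\<^sup>2)\<^sup>2 = to_fract t * (1 + to_fract a6 * to_fract t ^ 3)"
    using eqs inverse(2) unfolding flex_eqs_def by Groebner_Basis.algebra
  hence *: "(\<beta> * (to_fract t)\<^sup>2)\<^sup>2 = to_fract (t * (1 + a6 * t ^ 3))"
    by simp
  then obtain d where "\<beta> * (to_fract t)\<^sup>2 = to_fract d"
    by (rule padic_integral_of_power2)
  hence "to_fract (d\<^sup>2) = to_fract (t * (1 + a6 * t ^ 3))"
    using * by simp
  hence d: "d\<^sup>2 = t * (1 + a6 * t ^ 3)"
    unfolding to_fract_eq_iff .
  have "padic_norm a6 * padic_norm t ^ 3 \<le> 1 * (1 / 3) ^ 3"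
    unfolding nt by (intro mult_mono padic_norm_le_1) simp_all
  hence "padic_norm a6 * padic_norm t ^ 3 < 1"
    by (simp add: power3_eq_cube)
  hence "padic_norm (1 + a6 * t ^ 3) = 1"
    by (subst padic_norm_add_eq) (simp_all add: padic_norm_mult padic_norm_power)
  hence "(padic_norm d)\<^sup>2 = 1 / real CARD('p)"
    using arg_cong[OF d, of padic_norm] nt 3 by (simp add: padic_norm_mult padic_norm_power)
  thus ?thesis
    using padic_norm_power2_neq[of d] by blast
qed

text \<open>Integrality of the flexes brings the question down to the p-adic integers. Smoothness is
  compared with the discriminant only for curves that have a flex, which is the case on both
  sides.\<close>

lemma W_tors_iff_flex_set:
  fixes h :: "'p::prime_card padic_int"
  assumes h: "2 * h = 1"
  shows "(a1, a2, a3, a4, a6) \<in> W_tors \<longleftrightarrow> (a2 + (h * a1)\<^sup>2, a4 + h * a1 * a3, a6 + (h * a3)\<^sup>2) \<in> flex_set"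
proof -
  let ?E = "(to_fract a1, to_fract a2, to_fract a3, to_fract a4, to_fract a6) :: 'p padic weierstrass"
  let ?a2 = "a2 + (h * a1)\<^sup>2" and ?a4 = "a4 + h * a1 * a3" and ?a6 = "a6 + (h * a3)\<^sup>2"
  have H: "2 * to_fract h = 1"
    using arg_cong[OF h, of to_fract] by simp
  have to_fract_eqs: "to_fract a2 + (to_fract h * to_fract a1)\<^sup>2 = to_fract ?a2"
    "to_fract a4 + to_fract h * to_fract a1 * to_fract a3 = to_fract ?a4"
    "to_fract a6 + (to_fract h * to_fract a3)\<^sup>2 = to_fract ?a6"
    by simp_all
  have ell: "defines_elliptic_curve ?E \<longleftrightarrow> cubic_disc ?a2 ?a4 ?a6 \<noteq> 0"
    and nz: "cubic_disc ?a2 ?a4 ?a6 \<noteq> 0 \<Longrightarrow> to_fract \<alpha> * to_fract r + to_fract \<beta> \<noteq> 0"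
    if eqs: "flex_eqs ?a2 ?a4 ?a6 \<alpha> \<beta> r" for \<alpha> \<beta> r
  proof -
    have F: "flex_eqs (to_fract a2 + (to_fract h * to_fract a1)\<^sup>2) (to_fract a4 + to_fract h * to_fract a1 * to_fract a3)
        (to_fract a6 + (to_fract h * to_fract a3)\<^sup>2) (to_fract \<alpha>) (to_fract \<beta>) (to_fract r)"
      using eqs unfolding to_fract_eqs flex_eqs_to_fract_iff .
    have c: "to_fract \<alpha> * to_fract r + to_fract \<beta> = to_fract (\<alpha> * r + \<beta>)"
      "4 * to_fract \<alpha> ^ 3 - 27 * to_fract (\<alpha> * r + \<beta>) = to_fract (4 * \<alpha> ^ 3 - 27 * (\<alpha> * r + \<beta>))"
      by (simp_all only: to_fract_add to_fract_diff to_fract_mult to_fract_power to_fract_numeral)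
    show "defines_elliptic_curve ?E \<longleftrightarrow> cubic_disc ?a2 ?a4 ?a6 \<noteq> 0"
      unfolding defines_elliptic_curve_flex_iff[OF H F] c cubic_disc_flex[OF eqs] to_fract_eq_0_iff by simp
    show "to_fract \<alpha> * to_fract r + to_fract \<beta> \<noteq> 0" if "cubic_disc ?a2 ?a4 ?a6 \<noteq> 0"
      using that unfolding c cubic_disc_flex[OF eqs] to_fract_eq_0_iff by simp
  qed
  have "\<exists>\<alpha> \<beta> r. flex_eqs ?a2 ?a4 ?a6 \<alpha> \<beta> r" if tors: "has_nontrivial_3_torsion_point ?E"
  proof -
    obtain \<alpha> \<beta> r where *: "flex_eqs (to_fract ?a2) (to_fract ?a4) (to_fract ?a6) \<alpha> \<beta> r"
      using flex_of_3_torsion[OF H tors] unfolding to_fract_eqs by blast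
    then obtain \<alpha>' \<beta>' r' where "\<alpha> = to_fract \<alpha>'" "\<beta> = to_fract \<beta>'" "r = to_fract r'"
      by (rule flex_eqs_integral)
    thus ?thesis
      using * by (simp del: to_fract_add to_fract_mult to_fract_power) blast
  qed
  moreover have "has_nontrivial_3_torsion_point ?E"
    if "flex_eqs ?a2 ?a4 ?a6 \<alpha> \<beta> r" "cubic_disc ?a2 ?a4 ?a6 \<noteq> 0" for \<alpha> \<beta> r
  proof (rule flex_imp_3_torsion[OF H nz[OF that]])
    show "flex_eqs (to_fract a2 + (to_fract h * to_fract a1)\<^sup>2) (to_fract a4 + to_fract h * to_fract a1 * to_fract a3)
        (to_fract a6 + (to_fract h * to_fract a3)\<^sup>2) (to_fract \<alpha>) (to_fract \<beta>) (to_fract r)"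
      using that(1) unfolding to_fract_eqs flex_eqs_to_fract_iff .
  qed
  ultimately show ?thesis
    using ell unfolding W_tors_def flex_set_def Let_def by (auto simp del: to_fract_add to_fract_mult to_fract_power)
qed

section \<open>Integration over the five coefficients\<close>

lemma haar_measure_padic5_eq:
  "(haar_measure :: 'p::prime_card padic_int weierstrass measure) =
     haar_measure \<Otimes>\<^sub>M haar_measure \<Otimes>\<^sub>M haar_measure \<Otimes>\<^sub>M haar_measure \<Otimes>\<^sub>M haar_measure"
  by (rule is_normalized_haar_unique[OF haar_measure_padic5]) (intro is_normalized_haar_pair haar_measure_padic)

lemma nn_integral_haar_padic5:
  fixes f :: "'p::prime_card padic_int weierstrass \<Rightarrow> ennreal"
  assumes f: "f \<in> borel_measurable borel"
  shows "(\<integral>\<^sup>+w. f w \<partial>haar_measure) = (\<integral>\<^sup>+a1. \<integral>\<^sup>+a2. \<integral>\<^sup>+a3. \<integral>\<^sup>+a4. \<integral>\<^sup>+a6. f (a1, a2, a3, a4, a6)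
    \<partial>haar_measure \<partial>haar_measure \<partial>haar_measure \<partial>haar_measure \<partial>haar_measure)"
proof -
  let ?M = "haar_measure :: 'p padic_int measure"
  have sf: "sigma_finite_measure ?M" "sigma_finite_measure (?M \<Otimes>\<^sub>M ?M)"
    "sigma_finite_measure (?M \<Otimes>\<^sub>M ?M \<Otimes>\<^sub>M ?M)" "sigma_finite_measure (?M \<Otimes>\<^sub>M ?M \<Otimes>\<^sub>M ?M \<Otimes>\<^sub>M ?M)"
    by (intro sigma_finite_pair_measure sigma_finite_haar_padic)+
  have [measurable]: "f \<in> borel_measurable (?M \<Otimes>\<^sub>M ?M \<Otimes>\<^sub>M ?M \<Otimes>\<^sub>M ?M \<Otimes>\<^sub>M ?M)"
    using f haar_measure_padic5[where 'p = 'p]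
    unfolding haar_measure_padic5_eq[symmetric] is_normalized_haar_def by (simp cong: measurable_cong_sets)
  have 4: "(\<integral>\<^sup>+w. g w \<partial>(?M \<Otimes>\<^sub>M ?M)) = (\<integral>\<^sup>+x. \<integral>\<^sup>+y. g (x, y) \<partial>?M \<partial>?M)"
    if "g \<in> borel_measurable (?M \<Otimes>\<^sub>M ?M)" for g
    using sigma_finite_measure.nn_integral_fst[OF sf(1) that] ..
  have 3: "(\<integral>\<^sup>+w. g w \<partial>(?M \<Otimes>\<^sub>M ?M \<Otimes>\<^sub>M ?M)) = (\<integral>\<^sup>+x. \<integral>\<^sup>+y. \<integral>\<^sup>+z. g (x, y, z) \<partial>?M \<partial>?M \<partial>?M)"
    if [measurable]: "g \<in> borel_measurable (?M \<Otimes>\<^sub>M ?M \<Otimes>\<^sub>M ?M)" for g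
    by (simp add: sigma_finite_measure.nn_integral_fst[OF sf(2), symmetric] 4)
  have 2: "(\<integral>\<^sup>+w. g w \<partial>(?M \<Otimes>\<^sub>M ?M \<Otimes>\<^sub>M ?M \<Otimes>\<^sub>M ?M)) =
      (\<integral>\<^sup>+x. \<integral>\<^sup>+y. \<integral>\<^sup>+z. \<integral>\<^sup>+u. g (x, y, z, u) \<partial>?M \<partial>?M \<partial>?M \<partial>?M)"
    if [measurable]: "g \<in> borel_measurable (?M \<Otimes>\<^sub>M ?M \<Otimes>\<^sub>M ?M \<Otimes>\<^sub>M ?M)" for g
    by (simp add: sigma_finite_measure.nn_integral_fst[OF sf(3), symmetric] 3)
  show ?thesis
    unfolding haar_measure_padic5_eq
    by (simp add: sigma_finite_measure.nn_integral_fst[OF sf(4), symmetric] 2)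
qed

text \<open>Completing the square shifts a6, a4 and a2 by amounts that depend only on variables
  integrated further outside. Working from the inside out, each shift disappears by translation
  invariance, and the integrals over a3 and a1 become integrals of constants.\<close>

lemma emeasure_W_tors:
  assumes p: "CARD('p::prime_card) \<ge> 3"
  shows "emeasure haar_measure (W_tors :: 'p padic_int weierstrass set) =
    (\<integral>\<^sup>+a2. \<integral>\<^sup>+a4. \<integral>\<^sup>+a6. indicator flex_set (a2, a4, a6 :: 'p padic_int) \<partial>haar_measure \<partial>haar_measure \<partial>haar_measure)"
proof -
  obtain h :: "'p padic_int" where h: "2 * h = 1"
    using ex_padic_inverse[OF padic_norm_2[OF p]] .
  let ?B = "borel :: 'p padic_int measure"
  let ?\<phi> = "\<lambda>(a1, a2, a3, a4, a6). ((h * a1)\<^sup>2 + a2, h * a1 * a3 + a4, (h * a3)\<^sup>2 + a6)"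
  have W: "W_tors = ?\<phi> -` flex_set"
    using W_tors_iff_flex_set[OF h] by (auto simp: add.commute)
  have \<phi>: "?\<phi> \<in> borel_measurable borel"
  proof -
    have "?\<phi> \<in> (?B \<Otimes>\<^sub>M ?B \<Otimes>\<^sub>M ?B \<Otimes>\<^sub>M ?B \<Otimes>\<^sub>M ?B) \<rightarrow>\<^sub>M (?B \<Otimes>\<^sub>M ?B \<Otimes>\<^sub>M ?B)"
      by measurable
    thus ?thesis
      unfolding borel_prod .
  qed
  have [measurable]: "(flex_set :: ('p padic_int \<times> 'p padic_int \<times> 'p padic_int) set) \<in> sets (?B \<Otimes>\<^sub>M ?B \<Otimes>\<^sub>M ?B)"
    unfolding borel_prod by (rule sets_flex_set)
  have W_sets: "W_tors \<in> sets (borel :: 'p padic_int weierstrass measure)"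
    using measurable_sets[OF \<phi> sets_flex_set] by (simp add: W)
  have const: "(\<integral>\<^sup>+a. c \<partial>(haar_measure :: 'p padic_int measure)) = c" for c
    by simp
  have "emeasure haar_measure (W_tors :: 'p padic_int weierstrass set) =
      (\<integral>\<^sup>+w. indicator (W_tors :: 'p padic_int weierstrass set) w \<partial>haar_measure)"
    using W_sets haar_measure_padic5[where 'p = 'p]
    by (intro nn_integral_indicator[symmetric]) (auto simp: is_normalized_haar_def)
  also have "\<dots> = (\<integral>\<^sup>+a1. \<integral>\<^sup>+a2. \<integral>\<^sup>+a3. \<integral>\<^sup>+a4. \<integral>\<^sup>+a6. indicator W_tors (a1, a2, a3, a4, a6)
    \<partial>haar_measure \<partial>haar_measure \<partial>haar_measure \<partial>haar_measure \<partial>(haar_measure :: 'p padic_int measure))"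
    using W_sets by (intro nn_integral_haar_padic5) simp
  also have "\<dots> = (\<integral>\<^sup>+a1. \<integral>\<^sup>+a2. \<integral>\<^sup>+a3. \<integral>\<^sup>+a4. \<integral>\<^sup>+a6.
      indicator flex_set ((h * a1)\<^sup>2 + a2, h * a1 * a3 + a4, (h * a3)\<^sup>2 + a6)
    \<partial>haar_measure \<partial>haar_measure \<partial>haar_measure \<partial>haar_measure \<partial>(haar_measure :: 'p padic_int measure))"
    unfolding W by (simp add: indicator_def)
  also have "\<dots> = (\<integral>\<^sup>+a1. \<integral>\<^sup>+a2. \<integral>\<^sup>+a3. \<integral>\<^sup>+a4. \<integral>\<^sup>+a6.
      indicator flex_set ((h * a1)\<^sup>2 + a2, h * a1 * a3 + a4, a6)
    \<partial>haar_measure \<partial>haar_measure \<partial>haar_measure \<partial>haar_measure \<partial>(haar_measure :: 'p padic_int measure))"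
    by (subst nn_integral_padic_translate[where f = "\<lambda>z. indicator flex_set (x, y, z)" for x y]) simp_all
  also have "\<dots> = (\<integral>\<^sup>+a1. \<integral>\<^sup>+a2. \<integral>\<^sup>+a3. \<integral>\<^sup>+a4. \<integral>\<^sup>+a6.
      indicator flex_set ((h * a1)\<^sup>2 + a2, a4, a6)
    \<partial>haar_measure \<partial>haar_measure \<partial>(haar_measure :: 'p padic_int measure) \<partial>haar_measure \<partial>(haar_measure :: 'p padic_int measure))"
    by (subst nn_integral_padic_translate[where f = "\<lambda>y. \<integral>\<^sup>+z. indicator flex_set (x, y, z) \<partial>haar_measure" for x]) simp_all
  also have "\<dots> = (\<integral>\<^sup>+a1. \<integral>\<^sup>+a2. \<integral>\<^sup>+a4. \<integral>\<^sup>+a6. indicator flex_set ((h * a1)\<^sup>2 + a2, a4, a6)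
    \<partial>haar_measure \<partial>haar_measure \<partial>haar_measure \<partial>(haar_measure :: 'p padic_int measure))"
    unfolding const ..
  also have "\<dots> = (\<integral>\<^sup>+a1. \<integral>\<^sup>+a2. \<integral>\<^sup>+a4. \<integral>\<^sup>+a6. indicator flex_set (a2, a4, a6 :: 'p padic_int)
    \<partial>haar_measure \<partial>haar_measure \<partial>haar_measure \<partial>(haar_measure :: 'p padic_int measure))"
    by (subst nn_integral_padic_translate[where f = "\<lambda>x. \<integral>\<^sup>+y. \<integral>\<^sup>+z. indicator flex_set (x, y, z) \<partial>haar_measure \<partial>haar_measure"])
      simp_all
  finally show ?thesis
    unfolding const .
qed

theorem theorem1p1:
  fixes p :: nat
  assumes "p = CARD('p::prime_card)" and "p \<ge> 3"
  shows "(p mod 3 = 1 \<longrightarrow> measure haar_measure (W_tors :: 'p padic_int weierstrass set) =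
            real p ^ 2 * (3 * real p ^ 6 + 4 * real p ^ 2 - 4 * real p + 4) /
              (8 * (real p ^ 8 + real p ^ 6 + real p ^ 4 + real p ^ 2 + 1))) \<and>
         (p mod 3 = 2 \<longrightarrow> measure haar_measure (W_tors :: 'p padic_int weierstrass set) =
            real p ^ 2 / (2 * (real p ^ 2 + real p + 1))) \<and>
         (p = 3 \<longrightarrow> measure haar_measure (W_tors :: 'p padic_int weierstrass set) = 3 / 26)"
proof -
  have p: "CARD('p) \<ge> 3"
    using assms by simp
  have eq: "measure haar_measure (W_tors :: 'p padic_int weierstrass set) = x"
    if "emeasure haar_measure (W_tors :: 'p padic_int weierstrass set) = ennreal x" "0 \<le> x" for x
    using that by (simp add: measure_def)
  \<comment> \<open>Nonnegativity is what lets \<open>measure\<close> be read off from an equation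
    in \<open>ennreal\<close>.\<close>
  have "0 \<le> real p ^ 2 * (3 * real p ^ 6 + 4 * real p ^ 2 - 4 * real p + 4) /
      (8 * (real p ^ 8 + real p ^ 6 + real p ^ 4 + real p ^ 2 + 1))"
  proof -
    have "0 \<le> 3 * real p ^ 6 + 3 * (real p)\<^sup>2 + (real p - 2)\<^sup>2"
      by simp
    also have "\<dots> = 3 * real p ^ 6 + 4 * real p ^ 2 - 4 * real p + 4"
      by (simp add: power2_eq_square algebra_simps)
    finally show ?thesis
      by (intro divide_nonneg_nonneg mult_nonneg_nonneg) simp_all
  qed
  moreover have "0 \<le> (if CARD('p) = 3 then 1 / 3 else 1) * ((real p)\<^sup>2 / (2 * ((real p)\<^sup>2 + real p + 1)))"
    by simp
  \<comment> \<open>For p = 3 the factor |3| = 1/3 turns 9/26 into 3/26.\<close>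
  ultimately show ?thesis
    using flex_set_measure[OF p, folded emeasure_W_tors[OF p] assms(1)]
    by (intro conjI impI eq) auto
qed

end
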